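(* Let $K$ be a number field with $s\geq 1$ real embeddings and $2t\geq 2$ complex embeddings, and let $X(K,U)$ be an Oeljeklaus-Toma manifold associated with $K$ and a subgroup $U$ of the group of totally positive units of $K$. If $X(K,U)$ admits a locally conformally Kähler (LCK) metric, then $K$ has exactly $2t=2$ complex embeddings.
   Context: Let $K$ be a number field having $s\geq 1$ real embeddings and $2t\geq 2$ complex (non-real) embeddings into $\mathbb{C}$, labeled so that $\sigma_1,\dots,\sigma_s$ are the real ones and $\sigma_{s+t+i}=\overline{\sigma}_{s+i}$ for $i=1,\dots,t$. Let $\mathcal{O}_K$ be the ring of integers of $K$, $\mathcal{O}_K^*$ its group of units, and $\mathcal{O}_K^{*,+}$ the subgroup of totally positive units, i.e. those $u\in\mathcal{O}_K^*$ with $\sigma_i(u)>0$ for all $i=1,\dots,s$. Let $\mathbb{H}=\{z\in\mathbb{C} : \operatorname{Im}(z)>0\}$. The groups $\mathcal{O}_K$ and $\mathcal{O}_K^{*,+}$ act on $\mathbb{H}^s\times\mathbb{C}^t\subset\mathbb{C}^{s+t}$ by $$a\cdot(x_i)_{i=1,\dots,s+t}=(x_i+\sigma_i(a))_{i=1,\dots,s+t}\quad (a\in\mathcal{O}_K),\qquad u\cdot(x_i)_{i=1,\dots,s+t}=(\sigma_i(u)x_i)_{i=1,\dots,s+t}\quad (u\in\mathcal{O}_K^{*,+}),$$ and these combine to an action of $\mathcal{O}_K^{*,+}\ltimes\mathcal{O}_K$. Let $U\subset\mathcal{O}_K^{*,+}$ be a subgroup such that the action of $U\ltimes\mathcal{O}_K$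 on $\mathbb{H}^s\times\mathbb{C}^t$ is (properly) discrete and cocompact. The resulting compact complex manifold $X(K,U)=(\mathbb{H}^s\times\mathbb{C}^t)/(U\ltimes\mathcal{O}_K)$ is called an Oeljeklaus-Toma manifold. A locally conformally Kähler (LCK) metric on a complex manifold is a Hermitian metric whose associated $(1,1)$-form $\omega$ satisfies $d\omega=\theta\wedge\omega$ for some closed $1$-form $\theta$. *)

theory Defs
  imports "HOL-Analysis.Analysis" "HOL-Computational_Algebra.Polynomial"
begin

section \<open>Number fields\<close>

definition number_field :: "'k::field_char_0 itself \<Rightarrow> bool" where
  "number_field _ \<longleftrightarrow>
    (\<exists>B :: 'k set. finite_dimensional_vector_space (\<lambda>(q::rat) (x::'k). of_rat q * x) B)"

definition field_embedding :: "('k::field_char_0 \<Rightarrow> complex) \<Rightarrow> bool" where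
  "field_embedding f \<longleftrightarrow>
    f 1 = 1 \<and> (\<forall>x y. f (x + y) = f x + f y) \<and> (\<forall>x y. f (x * y) = f x * f y)"

definition real_embeddings :: "('k::field_char_0 \<Rightarrow> complex) set" where
  "real_embeddings = {f. field_embedding f \<and> (\<forall>x. f x \<in> \<real>)}"

definition complex_embeddings :: "('k::field_char_0 \<Rightarrow> complex) set" where
  "complex_embeddings = {f. field_embedding f \<and> \<not> (\<forall>x. f x \<in> \<real>)}"

text \<open>
  A labelling of the embeddings: the index type \<^typ>\<open>'s\<close> enumerates the real embeddings, and
  \<^typ>\<open>'t\<close> enumerates one representative of every pair of conjugate non-real embeddings. As types
  are nonempty, a labelling exists only if there are real and non-real embeddings.
\<close>

definition embedding_labelling ::
  "('s::finite + 't::finite \<Rightarrow> 'k::field_char_0 \<Rightarrow> complex) \<Rightarrow> bool" where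
  "embedding_labelling \<sigma> \<longleftrightarrow>
    bij_betw (\<lambda>i. \<sigma> (Inl i)) UNIV real_embeddings \<and>
    bij_betw (case_sum (\<lambda>j. \<sigma> (Inr j)) (\<lambda>j x. cnj (\<sigma> (Inr j) x))) (UNIV :: ('t + 't) set)
      complex_embeddings"

definition ring_of_integers :: "'k::field_char_0 set" where
  "ring_of_integers = {x. algebraic_int x}"

definition integer_units :: "'k::field_char_0 set" where
  "integer_units = {u \<in> ring_of_integers. \<exists>v \<in> ring_of_integers. u * v = 1}"

definition totally_positive_units :: "'k::field_char_0 set" where
  "totally_positive_units =
    {u \<in> integer_units. \<forall>f \<in> real_embeddings. f u \<in> \<real> \<and> 0 < Re (f u)}"

definition totally_positive_unit_subgroup :: "'k::field_char_0 set \<Rightarrow> bool" where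
  "totally_positive_unit_subgroup U \<longleftrightarrow>
    U \<subseteq> totally_positive_units \<and> 1 \<in> U \<and>
    (\<forall>u \<in> U. \<forall>v \<in> U. u * v \<in> U) \<and> (\<forall>u \<in> U. inverse u \<in> U)"


section \<open>Smooth maps and differential forms on open subsets of \<open>\<complex>\<^sup>n\<close>\<close>

text \<open>\<open>C_on k S f\<close>: the map \<open>f\<close> is of class \<open>C\<^sup>k\<close> (in the real sense) on the open set \<open>S\<close>.\<close>

primrec C_on :: "nat \<Rightarrow> 'a::euclidean_space set \<Rightarrow> ('a \<Rightarrow> 'b::real_normed_vector) \<Rightarrow> bool" where
  "C_on 0 S f \<longleftrightarrow> continuous_on S f"
| "C_on (Suc k) S f \<longleftrightarrow>
     (\<forall>x\<in>S. f differentiable (at x)) \<and>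
     (\<forall>v. C_on k S (\<lambda>x. frechet_derivative f (at x) v))"

definition smooth_on :: "'a::euclidean_space set \<Rightarrow> ('a \<Rightarrow> 'b::real_normed_vector) \<Rightarrow> bool" where
  "smooth_on S f \<longleftrightarrow> (\<forall>k. C_on k S f)"

text \<open>
  Real \<open>k\<close>-forms are functions of a base point and \<open>k\<close> tangent vectors. Both the exterior
  derivative and the wedge product are normalised without factorials.
\<close>

definition ext_deriv1 ::
  "('a::euclidean_space \<Rightarrow> 'a \<Rightarrow> real) \<Rightarrow> 'a \<Rightarrow> 'a \<Rightarrow> 'a \<Rightarrow> real" where
  "ext_deriv1 \<theta> x u v =
    frechet_derivative (\<lambda>y. \<theta> y v) (at x) u - frechet_derivative (\<lambda>y. \<theta> y u) (at x) v"

definition ext_deriv2 ::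
  "('a::euclidean_space \<Rightarrow> 'a \<Rightarrow> 'a \<Rightarrow> real) \<Rightarrow> 'a \<Rightarrow> 'a \<Rightarrow> 'a \<Rightarrow> 'a \<Rightarrow> real" where
  "ext_deriv2 \<omega> x u v w =
    frechet_derivative (\<lambda>y. \<omega> y v w) (at x) u - frechet_derivative (\<lambda>y. \<omega> y u w) (at x) v
      + frechet_derivative (\<lambda>y. \<omega> y u v) (at x) w"

definition wedge12 ::
  "('a \<Rightarrow> 'a \<Rightarrow> real) \<Rightarrow> ('a \<Rightarrow> 'a \<Rightarrow> 'a \<Rightarrow> real) \<Rightarrow> 'a \<Rightarrow> 'a \<Rightarrow> 'a \<Rightarrow> 'a \<Rightarrow> real" where
  "wedge12 \<theta> \<omega> x u v w = \<theta> x u * \<omega> x v w - \<theta> x v * \<omega> x u w + \<theta> x w * \<omega> x u v"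


section \<open>Locally conformally Kaehler metrics on complex manifolds\<close>

text \<open>
  A complex manifold of dimension \<^term>\<open>CARD('n)\<close> is given by an atlas of charts \<open>(W, \<phi>)\<close>, where
  \<open>W\<close> is the domain of the chart and only the values of \<open>\<phi>\<close> on \<open>W\<close> matter. Tensor fields are
  families of local expressions in the charts which transform into each other under the changes
  of charts.
\<close>

type_synonym ('p, 'n) chart = "'p set \<times> ('p \<Rightarrow> complex ^ 'n)"

definition chart_image :: "('p, 'n::finite) chart \<Rightarrow> (complex ^ 'n) set" where
  "chart_image c = snd c ` fst c"

definition transition ::
  "('p, 'n::finite) chart \<Rightarrow> ('p, 'n) chart \<Rightarrow> complex ^ 'n \<Rightarrow> complex ^ 'n" where
  "transition c c' = snd c' \<circ> inv_into (fst c) (snd c)"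

definition transition_deriv ::
  "('p, 'n::finite) chart \<Rightarrow> ('p, 'n) chart \<Rightarrow> 'p \<Rightarrow> complex ^ 'n \<Rightarrow> complex ^ 'n" where
  "transition_deriv c c' p = frechet_derivative (transition c c') (at (snd c p))"

definition one_form ::
  "('p, 'n::finite) chart set \<Rightarrow> (('p, 'n) chart \<Rightarrow> complex ^ 'n \<Rightarrow> complex ^ 'n \<Rightarrow> real) \<Rightarrow> bool"
  where
  "one_form A \<theta> \<longleftrightarrow>
    (\<forall>c\<in>A. \<forall>x\<in>chart_image c. linear (\<theta> c x)) \<and>
    (\<forall>c\<in>A. \<forall>v. smooth_on (chart_image c) (\<lambda>x. \<theta> c x v)) \<and>
    (\<forall>c\<in>A. \<forall>c'\<in>A. \<forall>p \<in> fst c \<inter> fst c'. \<forall>v.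
      \<theta> c (snd c p) v = \<theta> c' (snd c' p) (transition_deriv c c' p v))"

definition closed_one_form ::
  "('p, 'n::finite) chart set \<Rightarrow> (('p, 'n) chart \<Rightarrow> complex ^ 'n \<Rightarrow> complex ^ 'n \<Rightarrow> real) \<Rightarrow> bool"
  where
  "closed_one_form A \<theta> \<longleftrightarrow> one_form A \<theta> \<and>
    (\<forall>c\<in>A. \<forall>x\<in>chart_image c. \<forall>u v. ext_deriv1 (\<theta> c) x u v = 0)"

text \<open>
  A Hermitian metric is represented by its real part, a Riemannian metric for which the complex
  structure \<open>v \<mapsto> \<i> *s v\<close> is an isometry.
\<close>

definition hermitian_metric ::
  "('p, 'n::finite) chart set \<Rightarrow>
    (('p, 'n) chart \<Rightarrow> complex ^ 'n \<Rightarrow> complex ^ 'n \<Rightarrow> complex ^ 'n \<Rightarrow> real) \<Rightarrow> bool" where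
  "hermitian_metric A g \<longleftrightarrow>
    (\<forall>c\<in>A. \<forall>x\<in>chart_image c.
      bilinear (g c x) \<and>
      (\<forall>v w. g c x v w = g c x w v) \<and>
      (\<forall>v. v \<noteq> 0 \<longrightarrow> 0 < g c x v v) \<and>
      (\<forall>v w. g c x (\<i> *s v) (\<i> *s w) = g c x v w)) \<and>
    (\<forall>c\<in>A. \<forall>v w. smooth_on (chart_image c) (\<lambda>x. g c x v w)) \<and>
    (\<forall>c\<in>A. \<forall>c'\<in>A. \<forall>p \<in> fst c \<inter> fst c'. \<forall>v w.
      g c (snd c p) v w
        = g c' (snd c' p) (transition_deriv c c' p v) (transition_deriv c c' p w))"

definition fundamental_form ::
  "(('p, 'n::finite) chart \<Rightarrow> complex ^ 'n \<Rightarrow> complex ^ 'n \<Rightarrow> complex ^ 'n \<Rightarrow> real) \<Rightarrow>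
    ('p, 'n) chart \<Rightarrow> complex ^ 'n \<Rightarrow> complex ^ 'n \<Rightarrow> complex ^ 'n \<Rightarrow> real" where
  "fundamental_form g c x v w = g c x (\<i> *s v) w"

definition lck_metric ::
  "('p, 'n::finite) chart set \<Rightarrow>
    (('p, 'n) chart \<Rightarrow> complex ^ 'n \<Rightarrow> complex ^ 'n \<Rightarrow> complex ^ 'n \<Rightarrow> real) \<Rightarrow> bool" where
  "lck_metric A g \<longleftrightarrow> hermitian_metric A g \<and>
    (\<exists>\<theta>. closed_one_form A \<theta> \<and>
      (\<forall>c\<in>A. \<forall>x\<in>chart_image c. \<forall>u v w.
        ext_deriv2 (fundamental_form g c) x u v w = wedge12 (\<theta> c) (fundamental_form g c) x u v w))"


section \<open>Oeljeklaus-Toma manifolds\<close>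

definition quotient_topology :: "'a topology \<Rightarrow> ('a \<Rightarrow> 'b) \<Rightarrow> 'b topology" where
  "quotient_topology X q =
    topology (\<lambda>W. W \<subseteq> q ` topspace X \<and> openin X {x \<in> topspace X. q x \<in> W})"

lemma openin_quotient_topology:
  "openin (quotient_topology X q) W \<longleftrightarrow>
    W \<subseteq> q ` topspace X \<and> openin X {x \<in> topspace X. q x \<in> W}"
proof -
  let ?P = "\<lambda>W. W \<subseteq> q ` topspace X \<and> openin X {x \<in> topspace X. q x \<in> W}"
  have "istopology ?P"
    unfolding istopology_def
  proof (intro conjI allI impI)
    fix S T assume S: "?P S" and T: "?P T"
    show "S \<inter> T \<subseteq> q ` topspace X"
      using S by blast
    have "{x \<in> topspace X. q x \<in> S \<inter> T} =
        {x \<in> topspace X. q x \<in> S} \<inter> {x \<in> topspace X. q x \<in> T}"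
      by blast
    then show "openin X {x \<in> topspace X. q x \<in> S \<inter> T}"
      using S T by (simp add: openin_Int)
  next
    fix K assume K: "\<forall>S\<in>K. ?P S"
    show "\<Union>K \<subseteq> q ` topspace X"
      using K by blast
    have "{x \<in> topspace X. q x \<in> \<Union>K} = (\<Union>S\<in>K. {x \<in> topspace X. q x \<in> S})"
      by blast
    then show "openin X {x \<in> topspace X. q x \<in> \<Union>K}"
      using K by auto
  qed
  then show ?thesis
    unfolding quotient_topology_def by (simp add: topology_inverse')
qed

lemma topspace_quotient_topology: "topspace (quotient_topology X q) = q ` topspace X"
proof
  show "topspace (quotient_topology X q) \<subseteq> q ` topspace X"
    unfolding topspace_def[of "quotient_topology X q"] by (auto simp: openin_quotient_topology)
  have "{x \<in> topspace X. q x \<in> q ` topspace X} = topspace X"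
    by blast
  then have "openin (quotient_topology X q) (q ` topspace X)"
    by (simp add: openin_quotient_topology)
  then show "q ` topspace X \<subseteq> topspace (quotient_topology X q)"
    by (rule openin_subset)
qed

lemma quotient_map_quotient_topology: "quotient_map X (quotient_topology X q) q"
  by (auto simp: quotient_map_def topspace_quotient_topology openin_quotient_topology)

text \<open>\<open>\<H>\<^sup>s \<times> \<complex>\<^sup>t\<close>\<close>

definition ot_domain :: "(complex ^ ('s::finite + 't::finite)) set" where
  "ot_domain = {x. \<forall>i. 0 < Im (x $ Inl i)}"

text \<open>The action of the element \<open>(u, a)\<close> of the semidirect product of units and integers.\<close>

definition ot_act ::
  "('s::finite + 't::finite \<Rightarrow> 'k::field_char_0 \<Rightarrow> complex) \<Rightarrow> 'k \<times> 'k \<Rightarrow>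
    complex ^ ('s + 't) \<Rightarrow> complex ^ ('s + 't)" where
  "ot_act \<sigma> = (\<lambda>(u, a) x. \<chi> i. \<sigma> i u * x $ i + \<sigma> i a)"

lemma ot_act_compose:
  assumes "\<And>i. field_embedding (\<sigma> i)"
  shows "ot_act \<sigma> (u, a) (ot_act \<sigma> (v, b) x) = ot_act \<sigma> (u * v, a + u * b) x"
  using assms by (simp add: ot_act_def field_embedding_def vec_eq_iff algebra_simps)

lemma ot_act_domain:
  assumes "embedding_labelling \<sigma>" "u \<in> totally_positive_units" "x \<in> ot_domain"
  shows "ot_act \<sigma> (u, a) x \<in> ot_domain"
proof -
  have "\<sigma> (Inl i) \<in> real_embeddings" for i
    using assms(1) by (auto simp: embedding_labelling_def bij_betw_def)
  then show ?thesis
    using assms(2,3)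
    by (auto simp: ot_act_def ot_domain_def totally_positive_units_def real_embeddings_def
        complex_is_Real_iff)
qed

definition ot_orbit ::
  "('s::finite + 't::finite \<Rightarrow> 'k::field_char_0 \<Rightarrow> complex) \<Rightarrow> 'k set \<Rightarrow>
    complex ^ ('s + 't) \<Rightarrow> (complex ^ ('s + 't)) set" where
  "ot_orbit \<sigma> U x = (\<lambda>\<gamma>. ot_act \<sigma> \<gamma> x) ` (U \<times> ring_of_integers)"

definition ot_properly_discontinuous ::
  "('s::finite + 't::finite \<Rightarrow> 'k::field_char_0 \<Rightarrow> complex) \<Rightarrow> 'k set \<Rightarrow> bool" where
  "ot_properly_discontinuous \<sigma> U \<longleftrightarrow>
    (\<forall>C. compact C \<and> C \<subseteq> ot_domain \<longrightarrow>
      finite {\<gamma> \<in> U \<times> ring_of_integers. ot_act \<sigma> \<gamma> ` C \<inter> C \<noteq> {}})"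

text \<open>The underlying topological space of \<open>X(K, U)\<close>; its points are orbits.\<close>

definition ot_space ::
  "('s::finite + 't::finite \<Rightarrow> 'k::field_char_0 \<Rightarrow> complex) \<Rightarrow> 'k set \<Rightarrow>
    (complex ^ ('s + 't)) set topology" where
  "ot_space \<sigma> U = quotient_topology (top_of_set ot_domain) (ot_orbit \<sigma> U)"

text \<open>
  The complex structure of \<open>X(K, U)\<close>: the charts are the inverses of the orbit map on those
  open sets where it is injective. The action is automatically free, since a fixed point of
  \<open>(u, a)\<close> gives \<open>(\<sigma>\<^sub>i(u) - 1) x\<^sub>i = - \<sigma>\<^sub>i(a)\<close> for a real embedding \<open>\<sigma>\<^sub>i\<close>, where \<open>x\<^sub>i\<close> is not real.
  So for a properly discontinuous action the charts cover the quotient.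
\<close>

definition ot_atlas ::
  "('s::finite + 't::finite \<Rightarrow> 'k::field_char_0 \<Rightarrow> complex) \<Rightarrow> 'k set \<Rightarrow>
    ((complex ^ ('s + 't)) set, 's + 't) chart set" where
  "ot_atlas \<sigma> U =
    {(ot_orbit \<sigma> U ` V, inv_into V (ot_orbit \<sigma> U)) | V.
      open V \<and> V \<subseteq> ot_domain \<and> inj_on (ot_orbit \<sigma> U) V}"

definition oeljeklaus_toma ::
  "('s::finite + 't::finite \<Rightarrow> 'k::field_char_0 \<Rightarrow> complex) \<Rightarrow> 'k set \<Rightarrow> bool" where
  "oeljeklaus_toma \<sigma> U \<longleftrightarrow>
    totally_positive_unit_subgroup U \<and>
    ot_properly_discontinuous \<sigma> U \<and>
    compact_space (ot_space \<sigma> U)"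

end

(*
  On \<H>^s x \<C>^t, which is convex, the Lee form of a lifted LCK metric is df, and \<Omega> = exp(-f) \<omega>
  is a closed form on which units act by homotheties and integers trivially, because u - 1 divides a
  nonzero integer for every unit u \<noteq> 1.  On a region of bounded imaginary parts \<Omega> is comparable with
  the flat metric.  So its integral over the disc of radius R in the j-th complex coordinate line
  grows like R^2, while Stokes' theorem and the closedness of \<Omega> show that it changes by O(R) when
  the disc is moved in the other directions.  Comparing the discs centred at x and u x shows that
  u has the homothety factor |\<sigma>_j(u)|^2, so |\<sigma>_j(u)| is the same for all non-real \<sigma>_j.

  If \<tau> and \<tau>' belong to different complex places, then the relation
  \<tau>(u) \<tau>bar(u) = \<tau>'(u) \<tau>'bar(u) is moved by a homomorphism extending \<sigma> o \<tau>^-1 to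
  \<sigma>(u) \<beta>(u) = \<gamma>(u) \<delta>(u), with \<sigma> real and \<gamma>, \<delta> \<noteq> \<sigma>.  By the product formula this
  is a linear relation between the logarithms of u at the real places, in which \<sigma> has a positive
  coefficient.  There are no such relations, since the quotient is compact.
*)
theory Submission
  imports Defs "Jordan_Normal_Form.Char_Poly" "HOL-Computational_Algebra.Fundamental_Theorem_Algebra"
begin

section \<open>Algebraic integers form a ring\<close>

text \<open>Several classical inputs are bypassed. No normal closure of K is formed: for finitely
  many algebraic \<open>l\<close>, the commuting operators that send an additive function
  \<open>g\<close> on the complex numbers to \<open>\<lambda>y. g (l * y)\<close> have a joint
  eigenfunction, and the eigenvalue as a function of \<open>l\<close> is the required homomorphism.
  Starting from a suitable \<open>g\<close> prescribes some of its values. The same device proves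
  the product formula: an irrational norm would be moved by such a homomorphism, although this only
  permutes the embeddings. Neither Dirichlet's unit theorem nor the lattice property of the integers
  enters; cocompactness and proper discontinuity of the action take their place. Nor is the closed
  form averaged over the translations: it is enough to know its growth along a complex line.

  The passage to a real place is forced. With the product formula, equal moduli at the complex
  places only express these moduli by the values at the real places, which is no contradiction yet;
  a relation among the real places themselves has to be produced.\<close>

lemma module_of_int: "Modules.module (\<lambda>(n::int) (x::'a::comm_ring_1). of_int n * x)"
  by unfold_locales (simp_all add: algebra_simps)

abbreviation int_span :: "'a::comm_ring_1 set \<Rightarrow> 'a set" where
  "int_span \<equiv> Modules.module.span (\<lambda>(n::int) x. of_int n * x)"

text \<open>The determinant trick: multiplication by \<open>x\<close> acts on the generators through
  an integer matrix, so \<open>x\<close> is a root of its monic characteristic polynomial. The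
  nonzero generator \<open>w\<close> keeps the vector of generators from vanishing.\<close>

lemma algebraic_int_if_stable_lattice:
  fixes x :: "'a::field_char_0"
  assumes "finite V" "w \<in> V" "w \<noteq> 0" and stable: "\<And>v. v \<in> V \<Longrightarrow> x * v \<in> int_span V"
  shows "algebraic_int x"
proof -
  interpret M: Modules.module "\<lambda>(n::int) (x::'a). of_int n * x" by (rule module_of_int)
  obtain n and v :: "nat \<Rightarrow> 'a" where bij: "bij_betw v {0..<n} V"
    using ex_bij_betw_nat_finite[OF \<open>finite V\<close>] by blast
  have "\<exists>c. x * v i = (\<Sum>u\<in>V. of_int (c u) * u)" if "i < n" for i
    using stable[of "v i"] bij that M.span_finite[OF \<open>finite V\<close>]
    by (auto simp: bij_betw_def)
  then obtain c :: "nat \<Rightarrow> 'a \<Rightarrow> int" where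
    c: "\<And>i. i < n \<Longrightarrow> x * v i = (\<Sum>u\<in>V. of_int (c i u) * u)"
    by metis
  define A where "A = Matrix.mat n n (\<lambda>(i, j). c i (v j))"
  define y where "y = Matrix.vec n v"
  have A: "A \<in> carrier_mat n n" by (simp add: A_def)
  have A': "map_mat (of_int :: int \<Rightarrow> 'a) A \<in> carrier_mat n n" using A by simp
  have "map_mat of_int A *\<^sub>v y = x \<cdot>\<^sub>v y"
  proof (rule eq_vecI)
    fix i assume "i < dim_vec (x \<cdot>\<^sub>v y)"
    then have i: "i < n" by (simp add: y_def)
    have "vec_index (map_mat of_int A *\<^sub>v y) i = (\<Sum>j\<in>{0..<n}. of_int (c i (v j)) * v j)"
      using i by (simp add: A_def y_def scalar_prod_def)
    also have "\<dots> = (\<Sum>u\<in>V. of_int (c i u) * u)"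
      by (rule sum.reindex_bij_betw[OF bij])
    also have "\<dots> = vec_index (x \<cdot>\<^sub>v y) i"
      using i c by (simp add: y_def)
    finally show "vec_index (map_mat of_int A *\<^sub>v y) i = vec_index (x \<cdot>\<^sub>v y) i" .
  qed (simp add: A_def y_def)
  moreover have "y \<noteq> 0\<^sub>v n"
  proof
    assume 0: "y = 0\<^sub>v n"
    obtain i where i: "i < n" "v i = w"
      using \<open>w \<in> V\<close> bij by (auto simp: bij_betw_def)
    then show False using arg_cong[OF 0, of "\<lambda>z. vec_index z i"] \<open>w \<noteq> 0\<close> by (simp add: y_def)
  qed
  ultimately have "eigenvalue (map_mat of_int A) x"
    unfolding eigenvalue_def eigenvector_def by (intro exI[of _ y]) (auto simp: A_def y_def)
  moreover have "char_poly (map_mat (of_int :: int \<Rightarrow> 'a) A) = map_poly of_int (char_poly A)"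
    by (rule of_int_hom.char_poly_hom[OF A])
  ultimately have "poly (map_poly of_int (char_poly A)) x = 0"
    using eigenvalue_root_char_poly[OF A', of x] by simp
  moreover have "lead_coeff (char_poly A) = 1"
    using degree_monic_char_poly[OF A] by auto
  ultimately show ?thesis
    unfolding algebraic_int_altdef_ipoly by blast
qed

lemma algebraic_int_power_reduce:
  fixes x :: "'a::field_char_0"
  assumes "algebraic_int x"
  obtains n c where "n > 0" "x ^ n = (\<Sum>k<n. of_int (c k) * x ^ k)"
proof -
  obtain p where p: "poly (map_poly of_int p) x = 0" "lead_coeff p = 1"
    using assms unfolding algebraic_int_altdef_ipoly by blast
  have "degree p > 0"
  proof (rule Nat.gr0I)
    assume "degree p = 0"
    then obtain a where "p = [:a:]" by (elim degree_eq_zeroE)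
    then show False using p by simp
  qed
  moreover have "x ^ degree p = (\<Sum>k<degree p. of_int (- coeff p k) * x ^ k)"
  proof -
    have "0 = (\<Sum>k\<le>degree p. of_int (coeff p k) * x ^ k)"
      using p(1) by (simp add: poly_altdef degree_map_poly coeff_map_poly)
    also have "\<dots> = x ^ degree p + (\<Sum>k<degree p. of_int (coeff p k) * x ^ k)"
      using p(2) by (simp add: lessThan_Suc_atMost[symmetric])
    finally show ?thesis by (simp add: sum_negf eq_neg_iff_add_eq_0)
  qed
  ultimately show thesis by (rule that)
qed

text \<open>The monomials in \<open>x\<close> and \<open>y\<close> below the degrees of their monic
  relations generate a lattice that is stable under both multiplications, hence under those by the
  sum and the product.\<close>

lemma
  fixes x y :: "'a::field_char_0"
  assumes x: "algebraic_int x" and y: "algebraic_int y"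
  shows algebraic_int_plus: "algebraic_int (x + y)"
    and algebraic_int_times: "algebraic_int (x * y)"
proof -
  interpret M: Modules.module "\<lambda>(n::int) (x::'a). of_int n * x" by (rule module_of_int)
  obtain n c where n: "n > 0" and xn: "x ^ n = (\<Sum>k<n. of_int (c k) * x ^ k)"
    using x by (rule algebraic_int_power_reduce)
  obtain m d where m: "m > 0" and yn: "y ^ m = (\<Sum>k<m. of_int (d k) * y ^ k)"
    using y by (rule algebraic_int_power_reduce)
  define V where "V = (\<lambda>(i, j). x ^ i * y ^ j) ` ({..<n} \<times> {..<m})"
  have V: "x ^ i * y ^ j \<in> int_span V" if "i < n" "j < m" for i j
    using that by (auto simp: V_def intro!: M.span_base)
  have xV: "x * v \<in> int_span V" if v: "v \<in> V" for v
  proof -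
    obtain i j where ij: "v = x ^ i * y ^ j" "i < n" "j < m" using v by (auto simp: V_def)
    show ?thesis
    proof (cases "Suc i < n")
      case True
      then show ?thesis using V[of "Suc i" j] ij by (simp add: algebra_simps)
    next
      case False
      with ij have "Suc i = n" by simp
      then have "x * v = x ^ n * y ^ j"
        using ij(1) by auto
      also have "\<dots> = (\<Sum>k<n. of_int (c k) * (x ^ k * y ^ j))"
        unfolding xn by (simp add: sum_distrib_right mult.assoc)
      also have "\<dots> \<in> int_span V"
        using V ij by (intro M.span_sum M.span_scale) auto
      finally show ?thesis .
    qed
  qed
  have yV: "y * v \<in> int_span V" if v: "v \<in> V" for v
  proof -
    obtain i j where ij: "v = x ^ i * y ^ j" "i < n" "j < m" using v by (auto simp: V_def)
    show ?thesis
    proof (cases "Suc j < m")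
      case True
      then show ?thesis using V[of i "Suc j"] ij by (simp add: algebra_simps)
    next
      case False
      with ij have "Suc j = m" by simp
      then have "y * v = x ^ i * y ^ m"
        using ij(1) by (auto simp: mult.left_commute)
      also have "\<dots> = (\<Sum>k<m. of_int (d k) * (x ^ i * y ^ k))"
        unfolding yn by (simp add: sum_distrib_left mult.left_commute)
      also have "\<dots> \<in> int_span V"
        using V ij by (intro M.span_sum M.span_scale) auto
      finally show ?thesis .
    qed
  qed
  have xS: "x * s \<in> int_span V" if "s \<in> int_span V" for s
    using that
  proof (induction rule: M.span_induct_alt)
    case (step a v s)
    have "x * (of_int a * v + s) = of_int a * (x * v) + x * s" by (simp add: algebra_simps)
    also have "\<dots> \<in> int_span V" using step xV by (intro M.span_add M.span_scale) auto
    finally show ?case .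
  qed (simp add: M.span_zero)
  have fin: "finite V" by (simp add: V_def)
  have one: "1 \<in> V" using n m by (force simp: V_def image_iff)
  show "algebraic_int (x + y)"
    using fin one by (rule algebraic_int_if_stable_lattice)
      (use xV yV in \<open>auto simp: distrib_right intro: M.span_add\<close>)
  show "algebraic_int (x * y)"
    using fin one by (rule algebraic_int_if_stable_lattice) (use xS yV in \<open>auto simp: mult.assoc\<close>)
qed

lemma algebraic_int_sum:
  fixes f :: "'b \<Rightarrow> 'a::field_char_0"
  assumes "\<And>i. i \<in> I \<Longrightarrow> algebraic_int (f i)"
  shows "algebraic_int (\<Sum>i\<in>I. f i)"
  using assms by (induction I rule: infinite_finite_induct) (auto intro: algebraic_int_plus)

lemma algebraic_int_prod:
  fixes f :: "'b \<Rightarrow> 'a::field_char_0"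
  assumes "\<And>i. i \<in> I \<Longrightarrow> algebraic_int (f i)"
  shows "algebraic_int (\<Prod>i\<in>I. f i)"
  using assms by (induction I rule: infinite_finite_induct) (auto intro: algebraic_int_times)

lemma algebraic_int_power:
  fixes x :: "'a::field_char_0"
  shows "algebraic_int x \<Longrightarrow> algebraic_int (x ^ n)"
  by (induction n) (auto intro: algebraic_int_times)

text \<open>In an integer relation for \<open>x\<close> with nonzero constant term, the remaining
  terms are \<open>x\<close> times an integral element. A vanishing constant term is removed by
  cancelling \<open>x\<close>.\<close>

lemma algebraic_int_dvd_of_int:
  fixes x :: "'a::field_char_0"
  assumes "algebraic_int x" "x \<noteq> 0"
  obtains w N where "algebraic_int w" "N \<noteq> (0::int)" "x * w = of_int N"
proof -
  obtain p where p: "poly (map_poly of_int p) x = 0" "p \<noteq> 0"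
    using assms unfolding algebraic_int_altdef_ipoly by force
  have "\<exists>w N. algebraic_int w \<and> N \<noteq> (0::int) \<and> x * w = of_int N"
    using p
  proof (induction p)
    case (pCons a q)
    define w where "w = poly (map_poly of_int q) x"
    have w: "of_int a + x * w = 0" using pCons.prems by (simp add: w_def map_poly_pCons)
    show ?case
    proof (cases "a = 0")
      case True
      with w assms have "w = 0" by simp
      with True pCons show ?thesis unfolding w_def by auto
    next
      case False
      have "algebraic_int w"
        unfolding w_def poly_altdef
        by (intro algebraic_int_sum algebraic_int_times algebraic_int_power assms)
          (simp add: coeff_map_poly)
      with False w show ?thesis
        by (intro exI[of _ w] exI[of _ "-a"]) (simp add: eq_neg_iff_add_eq_0 add.commute)
    qed
  qed simp
  then show thesis using that by blast
qed

no_notation vec_index (infixl "$" 100)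

section \<open>Homomorphisms from joint eigenfunctions\<close>

text \<open>For the operator T that sends \<open>g\<close> to \<open>\<lambda>y. g (l * y)\<close>
  this is the identity p(T) = T q(T) - r q(T), applied to \<open>g\<close>.\<close>

lemma shift_poly_linear_factor:
  fixes g :: "'a::comm_ring_1 \<Rightarrow> complex"
  assumes "p = [:-r, 1:] * q"
  shows "(\<Sum>k\<le>degree p. coeff p k * g (l ^ k * y)) =
    (\<Sum>k\<le>degree q. coeff q k * g (l ^ k * (l * y))) - r * (\<Sum>k\<le>degree q. coeff q k * g (l ^ k * y))"
proof (cases "q = 0")
  case False
  then have deg: "degree p = Suc (degree q)"
    unfolding assms by (subst degree_mult_eq) auto
  have c: "coeff p k = (case k of 0 \<Rightarrow> 0 | Suc j \<Rightarrow> coeff q j) - r * coeff q k" for k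
    unfolding assms by (auto simp: coeff_pCons split: nat.splits)
  have "(\<Sum>k\<le>degree p. coeff p k * g (l ^ k * y)) =
      (\<Sum>k\<le>Suc (degree q). (case k of 0 \<Rightarrow> 0 | Suc j \<Rightarrow> coeff q j) * g (l ^ k * y)) -
      (\<Sum>k\<le>Suc (degree q). r * (coeff q k * g (l ^ k * y)))"
    by (simp only: deg c left_diff_distrib sum_subtractf mult.assoc)
  also have "(\<Sum>k\<le>Suc (degree q). (case k of 0 \<Rightarrow> 0 | Suc j \<Rightarrow> coeff q j) * g (l ^ k * y)) =
      (\<Sum>k\<le>degree q. coeff q k * g (l ^ k * (l * y)))"
    by (subst sum.atMost_Suc_shift) (simp add: mult_ac)
  also have "(\<Sum>k\<le>Suc (degree q). r * (coeff q k * g (l ^ k * y))) =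
      r * (\<Sum>k\<le>degree q. coeff q k * g (l ^ k * y))"
    by (simp add: coeff_eq_0 sum_distrib_left)
  finally show ?thesis .
qed (simp add: assms)

text \<open>
  The eigenvector of the operator \<open>g \<mapsto> (\<lambda>y. g (l * y))\<close> is taken from the cyclic span of \<open>g\<close>, as
  it inherits the eigenvector equations of \<open>g\<close> for other multipliers.
\<close>

lemma eigenfunction_in_cyclic_span:
  fixes g :: "'a::comm_ring_1 \<Rightarrow> complex"
  assumes "p \<noteq> 0" "g y0 \<noteq> 0" "\<And>y. (\<Sum>k\<le>degree p. coeff p k * g (l ^ k * y)) = 0"
  shows "\<exists>q r. poly p r = 0 \<and> (\<exists>y. (\<Sum>k\<le>degree q. coeff q k * g (l ^ k * y)) \<noteq> 0) \<and>
    (\<forall>y. (\<Sum>k\<le>degree q. coeff q k * g (l ^ k * (l * y))) =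
      r * (\<Sum>k\<le>degree q. coeff q k * g (l ^ k * y)))"
  using assms
proof (induction "degree p" arbitrary: p)
  case 0
  then obtain c where "p = [:c:]" by (metis degree_eq_zeroE)
  with 0 show ?case using "0.prems"(3)[of y0] by simp
next
  case (Suc n)
  then have "\<not> constant (poly p)"
    by (simp add: constant_degree)
  then obtain r where r: "poly p r = 0"
    using fundamental_theorem_of_algebra by blast
  then obtain q where q: "p = [:-r, 1:] * q"
    by (auto simp: poly_eq_0_iff_dvd elim: dvdE)
  then have "q \<noteq> 0" using Suc.prems(1) by auto
  then have deg: "degree q = n"
    using Suc.hyps(2) unfolding q by (subst (asm) degree_mult_eq) auto
  show ?case
  \<comment> \<open>Either the function obtained from \<open>q\<close> is the eigenfunction, or
    \<open>q\<close> kills \<open>g\<close> too and has smaller degree.\<close>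
  proof (cases "\<exists>y. (\<Sum>k\<le>degree q. coeff q k * g (l ^ k * y)) \<noteq> 0")
    case True
    with r show ?thesis
      using Suc.prems(3) unfolding shift_poly_linear_factor[OF q] by auto
  next
    case False
    then have "\<exists>q' r. poly q r = 0 \<and> (\<exists>y. (\<Sum>k\<le>degree q'. coeff q' k * g (l ^ k * y)) \<noteq> 0) \<and>
        (\<forall>y. (\<Sum>k\<le>degree q'. coeff q' k * g (l ^ k * (l * y))) =
          r * (\<Sum>k\<le>degree q'. coeff q' k * g (l ^ k * y)))"
      using Suc.hyps(1)[of q] deg \<open>q \<noteq> 0\<close> Suc.prems(2) by blast
    then show ?thesis unfolding q by auto
  qed
qed

lemma additive_of_int:
  fixes g :: "'a::comm_ring_1 \<Rightarrow> complex"
  assumes "Modules.additive g"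
  shows "g (of_int n * y) = of_int n * g y"
proof -
  interpret Modules.additive g by fact
  have nat: "g (of_nat m * y) = of_nat m * g y" for m
    by (induction m) (simp_all add: zero add distrib_right)
  show ?thesis
  proof (cases n rule: int_cases)
    case (neg m)
    have "g (- of_nat (Suc m) * y) = - of_nat (Suc m) * g y"
      by (simp only: mult_minus_left minus nat)
    with neg show ?thesis by (simp only: of_int_minus of_int_of_nat_eq)
  qed (use nat in simp)
qed

text \<open>Additive functions commute with integer multiples, so an integer polynomial with root
  \<open>l\<close> kills \<open>g\<close>. The last conjunct, which holds because the operators
  commute, preserves the eigenvalues found earlier and so permits an induction over several
  multipliers.\<close>

lemma eigenfunction_of_algebraic:
  fixes g :: "complex \<Rightarrow> complex"
  assumes "algebraic l" "Modules.additive g" "g y0 \<noteq> 0"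
  shows "\<exists>g' y1 r. Modules.additive g' \<and> g' y1 \<noteq> 0 \<and> (\<forall>y. g' (l * y) = r * g' y) \<and>
    (\<forall>m c. (\<forall>y. g (m * y) = c * g y) \<longrightarrow> (\<forall>y. g' (m * y) = c * g' y))"
proof -
  interpret Modules.additive g by fact
  obtain p where p: "\<And>i. coeff p i \<in> \<int>" "p \<noteq> 0" "poly p l = 0"
    using \<open>algebraic l\<close> by (rule algebraicE) blast
  have "(\<Sum>k\<le>degree p. coeff p k * g (l ^ k * y)) = 0" for y
  proof -
    have "coeff p k * g (l ^ k * y) = g (coeff p k * (l ^ k * y))" for k
      using p(1)[of k] additive_of_int[OF \<open>Modules.additive g\<close>] by (auto elim!: Ints_cases)
    then have "(\<Sum>k\<le>degree p. coeff p k * g (l ^ k * y)) = (\<Sum>k\<le>degree p. g (coeff p k * (l ^ k * y)))"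
      by simp
    also have "\<dots> = g (\<Sum>k\<le>degree p. coeff p k * (l ^ k * y))"
      by (rule sum[symmetric])
    also have "(\<Sum>k\<le>degree p. coeff p k * (l ^ k * y)) = poly p l * y"
      by (simp add: poly_altdef sum_distrib_right mult.assoc)
    finally show ?thesis using p(3) zero by simp
  qed
  from eigenfunction_in_cyclic_span[where g = g, OF p(2) assms(3) this]
  obtain q r y1 where q: "(\<Sum>k\<le>degree q. coeff q k * g (l ^ k * y1)) \<noteq> 0"
    "\<And>y. (\<Sum>k\<le>degree q. coeff q k * g (l ^ k * (l * y))) = r * (\<Sum>k\<le>degree q. coeff q k * g (l ^ k * y))"
    by blast
  define g' where "g' = (\<lambda>y. \<Sum>k\<le>degree q. coeff q k * g (l ^ k * y))"
  have "g' (m * y) = c * g' y" if "\<forall>y. g (m * y) = c * g y" for m c y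
  proof -
    have "l ^ k * (m * y) = m * (l ^ k * y)" for k by (simp add: mult_ac)
    then show ?thesis by (simp add: g'_def that sum_distrib_left mult_ac)
  qed
  moreover have "Modules.additive g'"
    unfolding g'_def by unfold_locales (simp add: distrib_left add sum.distrib)
  moreover have "g' y1 \<noteq> 0" "\<forall>y. g' (l * y) = r * g' y"
    using q by (auto simp: g'_def)
  ultimately show ?thesis by blast
qed

lemma joint_eigenfunction:
  fixes g :: "complex \<Rightarrow> complex"
  assumes "finite A" "\<forall>l\<in>A. algebraic l" "Modules.additive g" "g y0 \<noteq> 0"
  shows "\<exists>g' y1. Modules.additive g' \<and> g' y1 \<noteq> 0 \<and> (\<forall>l\<in>A. \<exists>c. \<forall>y. g' (l * y) = c * g' y) \<and>
    (\<forall>m c. (\<forall>y. g (m * y) = c * g y) \<longrightarrow> (\<forall>y. g' (m * y) = c * g' y))"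
  using assms
proof (induction A rule: finite_induct)
  case empty
  then show ?case by blast
next
  case (insert l A)
  from insert.prems(1) have "\<forall>l\<in>A. algebraic l" by simp
  from insert.IH[OF this insert.prems(2,3)]
  obtain g1 y1 where g1: "Modules.additive g1" "g1 y1 \<noteq> 0" "\<forall>l\<in>A. \<exists>c. \<forall>y. g1 (l * y) = c * g1 y"
    "\<forall>m c. (\<forall>y. g (m * y) = c * g y) \<longrightarrow> (\<forall>y. g1 (m * y) = c * g1 y)"
    by (elim exE conjE)
  from insert.prems(1) have "algebraic l" by simp
  then obtain g2 y2 r where g2: "Modules.additive g2" "g2 y2 \<noteq> 0" "\<forall>y. g2 (l * y) = r * g2 y"
    "\<forall>m c. (\<forall>y. g1 (m * y) = c * g1 y) \<longrightarrow> (\<forall>y. g2 (m * y) = c * g2 y)"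
    using eigenfunction_of_algebraic[OF _ g1(1,2)] by blast
  from g2(3,4) g1(3,4) have "\<forall>k\<in>insert l A. \<exists>c. \<forall>y. g2 (k * y) = c * g2 y"
    "\<forall>m c. (\<forall>y. g (m * y) = c * g y) \<longrightarrow> (\<forall>y. g2 (m * y) = c * g2 y)"
    by blast+
  with g2(1,2) show ?case by blast
qed

text \<open>Stands for an isomorphism between subrings of the complex numbers. Injectivity keeps
  different embeddings different after composition with \<open>\<Lambda>\<close>.\<close>

definition partial_hom :: "complex set \<Rightarrow> (complex \<Rightarrow> complex) \<Rightarrow> bool" where
  "partial_hom R \<Lambda> \<longleftrightarrow> 1 \<in> R \<and> \<Lambda> 1 = 1 \<and>
    (\<forall>x\<in>R. \<forall>y\<in>R. x + y \<in> R \<and> x * y \<in> R \<and> \<Lambda> (x + y) = \<Lambda> x + \<Lambda> y \<and> \<Lambda> (x * y) = \<Lambda> x * \<Lambda> y) \<and>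
    inj_on \<Lambda> R"

text \<open>Eigenvalues of a joint eigenfunction add and multiply with the multipliers. If two
  multipliers shared an eigenvalue, the function would vanish on all multiples of their difference,
  that is, everywhere. Eigenvalues of the initial \<open>g\<close> survive, which prescribes values
  of \<open>\<Lambda>\<close>.\<close>

lemma partial_hom_extends:
  fixes g :: "complex \<Rightarrow> complex"
  assumes "finite A" "\<forall>l\<in>A. algebraic l" "Modules.additive g" "g y0 \<noteq> 0"
  shows "\<exists>R \<Lambda>. partial_hom R \<Lambda> \<and> A \<subseteq> R \<and> (\<forall>m c. (\<forall>y. g (m * y) = c * g y) \<longrightarrow> m \<in> R \<and> \<Lambda> m = c)"
proof -
  obtain g' y1 where g': "Modules.additive g'" "g' y1 \<noteq> 0" "\<forall>l\<in>A. \<exists>c. \<forall>y. g' (l * y) = c * g' y"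
    "\<forall>m c. (\<forall>y. g (m * y) = c * g y) \<longrightarrow> (\<forall>y. g' (m * y) = c * g' y)"
    using joint_eigenfunction[OF assms] by blast
  interpret Modules.additive g' by fact
  define R where "R = {l. \<exists>c. \<forall>y. g' (l * y) = c * g' y}"
  define \<Lambda> where "\<Lambda> = (\<lambda>l. g' (l * y1) / g' y1)"
  have \<Lambda>_eq: "m \<in> R \<and> \<Lambda> m = c" if "\<And>y. g' (m * y) = c * g' y" for m c
    using that g'(2) by (auto simp: R_def \<Lambda>_def)
  have R: "g' (m * y) = \<Lambda> m * g' y" if "m \<in> R" for m y
    using that g'(2) by (auto simp: R_def \<Lambda>_def)
  have "partial_hom R \<Lambda>"
    unfolding partial_hom_def
  proof (intro conjI ballI)
    show "1 \<in> R" "\<Lambda> 1 = 1" using \<Lambda>_eq[of 1 1] by auto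
    show "x + y \<in> R" "\<Lambda> (x + y) = \<Lambda> x + \<Lambda> y" if "x \<in> R" "y \<in> R" for x y
      using \<Lambda>_eq[of "x + y" "\<Lambda> x + \<Lambda> y"] that by (simp_all add: distrib_right add R)
    show "x * y \<in> R" "\<Lambda> (x * y) = \<Lambda> x * \<Lambda> y" if "x \<in> R" "y \<in> R" for x y
      using \<Lambda>_eq[of "x * y" "\<Lambda> x * \<Lambda> y"] that by (simp_all add: mult.assoc R)
    show "inj_on \<Lambda> R"
    proof (rule inj_onI, rule ccontr)
      fix x y assume xy: "x \<in> R" "y \<in> R" "\<Lambda> x = \<Lambda> y" "x \<noteq> y"
      have "g' ((x - y) * z) = 0" for z
        using xy by (simp add: left_diff_distrib diff R)
      from this[of "y1 / (x - y)"] show False using xy(4) g'(2) by simp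
    qed
  qed
  moreover have "A \<subseteq> R" using g'(3) by (auto simp: R_def)
  moreover have "m \<in> R \<and> \<Lambda> m = c" if "\<forall>y. g (m * y) = c * g y" for m c
    using that g'(4) by (intro \<Lambda>_eq) blast
  ultimately show ?thesis by blast
qed

section \<open>Embeddings of number fields and the extension of homomorphisms\<close>

lemma field_embedding_ring_hom:
  assumes "field_embedding f"
  shows "f 1 = 1" "f (x + y) = f x + f y" "f (x * y) = f x * f y"
  using assms by (auto simp: field_embedding_def)

lemma field_embedding_additive: "field_embedding f \<Longrightarrow> Modules.additive f"
  by unfold_locales (simp add: field_embedding_ring_hom)

lemma field_embedding_simps:
  assumes f: "field_embedding f"
  shows "f 0 = 0" "f (- x) = - f x" "f (x - y) = f x - f y" "f (of_int n) = of_int n"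
    "f (of_rat q) = of_rat q" "f (x ^ m) = f x ^ m" "f (sum h A) = (\<Sum>a\<in>A. f (h a))"
    "f x = 0 \<longleftrightarrow> x = 0" "f (inverse x) = inverse (f x)" "f x = f y \<longleftrightarrow> x = y"
proof -
  interpret Modules.additive f using f by (rule field_embedding_additive)
  note hom = field_embedding_ring_hom[OF f]
  show "f 0 = 0" by (rule zero)
  show "f (- x) = - f x" by (rule minus)
  show diff': "f (x - y) = f x - f y" for x y by (rule diff)
  show int: "f (of_int n) = of_int n" for n
  proof -
    have nat: "f (of_nat m) = of_nat m" for m
      by (induction m) (simp_all add: zero hom)
    show ?thesis
      by (cases n rule: int_cases) (simp_all add: nat minus hom diff')
  qed
  show "f (x ^ m) = f x ^ m" by (induction m) (simp_all add: hom)
  show "f (sum h A) = (\<Sum>a\<in>A. f (h a))" by (rule sum)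
  show nz: "f x = 0 \<longleftrightarrow> x = 0" for x
  proof
    assume "f x = 0"
    then have "f (x * inverse x) = 0" by (simp add: hom)
    then show "x = 0" using hom(1) by (cases "x = 0") auto
  qed (simp add: zero)
  show inv: "f (inverse x) = inverse (f x)" for x
  proof (cases "x = 0")
    case False
    have "f x * f (inverse x) = f (x * inverse x)" by (rule hom(3)[symmetric])
    also have "\<dots> = 1" using False hom(1) by simp
    finally show ?thesis by (rule inverse_unique[symmetric])
  qed (simp add: zero)
  show "f x = f y \<longleftrightarrow> x = y"
    using nz[of "x - y"] diff'[of x y] by simp
  show "f (of_rat q) = of_rat q"
    by (cases q) (simp add: of_rat_rat divide_inverse hom inv int)
qed

lemma field_embedding_poly:
  assumes f: "field_embedding f"
  shows "f (poly p x) = poly (map_poly f p) (f x)"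
  by (induction p)
    (simp_all add: field_embedding_simps[OF f] field_embedding_ring_hom[OF f] map_poly_pCons)

lemma field_embedding_algebraic:
  assumes f: "field_embedding f" and "algebraic x"
  shows "algebraic (f x)"
proof -
  obtain p where p: "\<And>i. coeff p i \<in> \<int>" "p \<noteq> 0" "poly p x = 0"
    using \<open>algebraic x\<close> by (rule algebraicE) blast
  have "coeff (map_poly f p) i \<in> \<int>" for i
    using p(1)[of i] by (auto elim!: Ints_cases simp: coeff_map_poly field_embedding_simps[OF f])
  moreover have "map_poly f p \<noteq> 0"
    using p(2) by (subst map_poly_eq_0_iff) (auto simp: field_embedding_simps[OF f])
  moreover have "poly (map_poly f p) (f x) = 0"
    using p(3) by (simp add: field_embedding_simps[OF f] flip: field_embedding_poly[OF f])
  ultimately show ?thesis by (rule algebraicI)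
qed

lemma field_embedding_algebraic_int:
  assumes f: "field_embedding f" and "algebraic_int x"
  shows "algebraic_int (f x)"
proof -
  obtain p where p: "lead_coeff p = 1" "\<forall>i. coeff p i \<in> \<int>" "poly p x = 0"
    using assms(2) by (auto elim: algebraic_int.cases)
  have "\<forall>i. coeff (map_poly f p) i \<in> \<int>"
  proof
    fix i show "coeff (map_poly f p) i \<in> \<int>"
      using p(2)[rule_format, of i]
      by (auto elim!: Ints_cases simp: coeff_map_poly field_embedding_simps[OF f])
  qed
  moreover have "lead_coeff (map_poly f p) = 1"
    using p(1) by (subst degree_map_poly)
      (auto simp: coeff_map_poly field_embedding_simps[OF f] field_embedding_ring_hom[OF f])
  moreover have "poly (map_poly f p) (f x) = 0"
    using p(3) by (simp add: field_embedding_simps[OF f] flip: field_embedding_poly[OF f])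
  ultimately show ?thesis by (intro algebraic_int.intros)
qed

lemma number_field_algebraic:
  assumes "number_field TYPE('k::field_char_0)"
  shows "algebraic (x :: 'k)"
proof -
  obtain B where B: "finite_dimensional_vector_space (\<lambda>(q::rat) (x::'k). of_rat q * x) B"
    using assms unfolding number_field_def by blast
  interpret finite_dimensional_vector_space "\<lambda>(q::rat) (x::'k). of_rat q * x" B by fact
  define n where "n = card B"
  show ?thesis
  \<comment> \<open>If two powers coincide, their set may be too small to be dependent, but then a
    difference of two monomials already kills \<open>x\<close>.\<close>
  proof (cases "inj_on (\<lambda>i. x ^ i) {..n}")
    case False
    then obtain i j where ij: "i < j" "x ^ i = x ^ j"
      unfolding inj_on_def by (metis linorder_neqE_nat)
    define p :: "'k poly" where "p = monom 1 j - monom 1 i"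
    have "p \<noteq> 0"
      using ij(1) by (auto simp: p_def poly_eq_iff intro!: exI[of _ j])
    moreover have "poly p x = 0" using ij by (simp add: p_def poly_monom)
    ultimately show ?thesis
      by (intro algebraicI[of p]) (auto simp: p_def)
  next
    case True
    define S where "S = (\<lambda>i. x ^ i) ` {..n}"
    have "card S > card B" using True by (simp add: S_def card_image n_def)
    moreover have "finite S" by (simp add: S_def)
    ultimately have "dependent S"
      using independent_card_le_dim[of S UNIV] by (auto simp: dim_UNIV dimension_def)
    then obtain u where u: "\<exists>v\<in>S. u v \<noteq> 0" "(\<Sum>v\<in>S. of_rat (u v) * v) = 0"
      by (auto simp: dependent_finite S_def)
    define p where "p = (\<Sum>i\<le>n. monom (of_rat (u (x ^ i)) :: 'k) i)"
    have c: "coeff p i = (if i \<le> n then of_rat (u (x ^ i)) else 0)" for i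
      by (simp add: p_def coeff_sum)
    have "poly p x = 0"
      using u(2) True by (simp add: p_def poly_sum poly_monom S_def sum.reindex)
    moreover from u(1) obtain i where "i \<le> n" "u (x ^ i) \<noteq> 0" by (auto simp: S_def)
    then have "p \<noteq> 0" using c[of i] by auto
    moreover have "coeff p i \<in> \<rat>" for i by (simp add: c)
    ultimately show ?thesis unfolding algebraic_altdef by blast
  qed
qed

lemma number_field_span:
  assumes "number_field TYPE('k::field_char_0)"
  obtains B :: "'k::field_char_0 set" where "finite B" "\<And>x. \<exists>q. x = (\<Sum>b\<in>B. of_rat (q b) * b)"
proof -
  obtain B where B: "finite_dimensional_vector_space (\<lambda>(q::rat) (x::'k). of_rat q * x) B"
    using assms unfolding number_field_def by blast
  interpret finite_dimensional_vector_space "\<lambda>(q::rat) (x::'k). of_rat q * x" B by fact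
  have "\<exists>q. x = (\<Sum>b\<in>B. of_rat (q b) * b)" for x
    using span_Basis span_finite[OF finite_Basis] by auto
  then show thesis using that finite_Basis by blast
qed

lemma additive_of_rat:
  fixes g :: "complex \<Rightarrow> complex"
  assumes "Modules.additive g"
  shows "g (of_rat q * y) = of_rat q * g y"
proof (cases q)
  case (Fract a b)
  then have b: "of_int b \<noteq> (0::complex)" by simp
  have "of_int b * g (of_rat q * y) = g (of_int b * (of_rat q * y))"
    by (simp add: additive_of_int[OF assms])
  also have "of_int b * (of_rat q * y) = of_int a * y"
    using b by (simp add: Fract of_rat_rat)
  also have "g \<dots> = of_int b * (of_rat q * g y)"
    using b by (simp add: additive_of_int[OF assms] Fract of_rat_rat)
  finally show ?thesis using b by simp
qed

lemma partial_hom_sum: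
  assumes "partial_hom R \<Lambda>" "0 \<in> R" "\<And>b. b \<in> B \<Longrightarrow> h b \<in> R"
  shows "(\<Sum>b\<in>B. h b) \<in> R"
  using assms(3) by (induction B rule: infinite_finite_induct) (use assms(1,2) in \<open>auto simp: partial_hom_def\<close>)

lemma partial_hom_prod:
  assumes "partial_hom R \<Lambda>" "\<And>b. b \<in> B \<Longrightarrow> h b \<in> R"
  shows "(\<Prod>b\<in>B. h b) \<in> R \<and> \<Lambda> (\<Prod>b\<in>B. h b) = (\<Prod>b\<in>B. \<Lambda> (h b))"
  using assms(2) by (induction B rule: infinite_finite_induct) (use assms(1) in \<open>auto simp: partial_hom_def\<close>)

lemma partial_hom_embedding:
  assumes "partial_hom R \<Lambda>" "field_embedding f" "range f \<subseteq> R"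
  shows "field_embedding (\<lambda>x. \<Lambda> (f x))"
proof -
  have "f x \<in> R" for x using assms(3) by blast
  then show ?thesis using assms(1,2) unfolding partial_hom_def field_embedding_def by simp
qed

text \<open>The images of a finite spanning set are finitely many algebraic multipliers. They
  suffice, as every rational multiplier has an eigenvalue for any additive function.\<close>

lemma partial_hom_extends_embeddings:
  fixes F :: "('k::field_char_0 \<Rightarrow> complex) set"
  assumes nf: "number_field TYPE('k)" and F: "finite F" "\<forall>f\<in>F. field_embedding f"
    and g: "Modules.additive g" "g y0 \<noteq> 0"
  shows "\<exists>R \<Lambda>. partial_hom R \<Lambda> \<and> (\<forall>f\<in>F. range f \<subseteq> R) \<and>
    (\<forall>m c. (\<forall>y. g (m * y) = c * g y) \<longrightarrow> m \<in> R \<and> \<Lambda> m = c)"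
proof -
  obtain B :: "'k set" where B: "finite B" "\<And>x. \<exists>q. x = (\<Sum>b\<in>B. of_rat (q b) * b)"
    using number_field_span[OF nf] by blast
  have fin: "finite (\<Union>f\<in>F. f ` B)" using F(1) B(1) by simp
  have alg: "\<forall>l\<in>(\<Union>f\<in>F. f ` B). algebraic l"
    using F(2) number_field_algebraic[OF nf] by (auto intro: field_embedding_algebraic)
  obtain R \<Lambda> where R: "partial_hom R \<Lambda>" "(\<Union>f\<in>F. f ` B) \<subseteq> R"
    "\<forall>m c. (\<forall>y. g (m * y) = c * g y) \<longrightarrow> m \<in> R \<and> \<Lambda> m = c"
    using partial_hom_extends[OF fin alg g] by (elim exE conjE)
  have rat: "of_rat q \<in> R" for q
    using R(3)[rule_format, of "of_rat q" "of_rat q"] additive_of_rat[OF g(1)] by simp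
  have "f x \<in> R" if f: "f \<in> F" for f x
  proof -
    obtain q where "x = (\<Sum>b\<in>B. of_rat (q b) * b)" using B(2) by blast
    then have "f x = (\<Sum>b\<in>B. of_rat (q b) * f b)"
      using F(2) f by (simp add: field_embedding_simps field_embedding_ring_hom)
    also have "\<dots> \<in> R"
    proof (rule partial_hom_sum[OF R(1)])
      show "0 \<in> R" using rat[of 0] by simp
      show "of_rat (q b) * f b \<in> R" if "b \<in> B" for b
        using R(1,2) rat f that unfolding partial_hom_def by blast
    qed
    finally show ?thesis .
  qed
  then show ?thesis using R(1,3) by blast
qed

text \<open>
  Starting from the \<open>\<tau>\<close>-\<open>\<sigma>\<close>-semilinear functionals on the \<^typ>\<open>'k\<close>-vector space \<open>\<complex>\<close>
  replaces the extension theorem for embeddings.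
\<close>

lemma embedding_transfer:
  fixes F :: "('k::field_char_0 \<Rightarrow> complex) set"
  assumes nf: "number_field TYPE('k)" and F: "finite F" "\<forall>f\<in>F. field_embedding f"
    and \<tau>: "field_embedding \<tau>" and \<sigma>: "field_embedding \<sigma>"
  shows "\<exists>R \<Lambda>. partial_hom R \<Lambda> \<and> (\<forall>f\<in>F. range f \<subseteq> R) \<and> (\<forall>x. \<tau> x \<in> R \<and> \<Lambda> (\<tau> x) = \<sigma> x)"
proof -
  interpret vector_space_pair "\<lambda>x y. \<tau> x * y" "\<lambda>x y. \<sigma> x * y"
    by unfold_locales
      (simp_all add: distrib_left distrib_right field_embedding_ring_hom[OF \<tau>] field_embedding_ring_hom[OF \<sigma>])
  \<comment> \<open>The scalars act through \<open>\<tau>\<close> on the source and through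
    \<open>\<sigma>\<close> on the target, so homogeneity says that the multiplier
    \<open>\<tau> x\<close> has the eigenvalue \<open>\<sigma> x\<close>.\<close>
  define g where "g = construct {1} (\<lambda>_. 1)"
  have ind: "vs1.independent {1}" by simp
  interpret g: Vector_Spaces.linear "\<lambda>x y. \<tau> x * y" "\<lambda>x y. \<sigma> x * y" g
    unfolding g_def by (rule linear_construct[OF ind])
  have g1: "g 1 \<noteq> 0" unfolding g_def by (subst construct_basis[OF ind]) auto
  have add: "Modules.additive g" by unfold_locales (rule g.add)
  obtain R \<Lambda> where R: "partial_hom R \<Lambda>" "\<forall>f\<in>F. range f \<subseteq> R"
    "\<forall>m c. (\<forall>y. g (m * y) = c * g y) \<longrightarrow> m \<in> R \<and> \<Lambda> m = c"
    using partial_hom_extends_embeddings[OF nf F add g1] by (elim exE conjE)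
  have "\<tau> x \<in> R \<and> \<Lambda> (\<tau> x) = \<sigma> x" for x
    using g.scale R(3)[rule_format, of "\<tau> x" "\<sigma> x"] by blast
  with R(1,2) show ?thesis by blast
qed

text \<open>
  If \<open>z\<close> is a simple root of its minimal polynomial \<open>p = (X - z) q\<close>, then any
  \<open>\<rat>\<close>-linear \<open>f\<close> with \<open>f 1 = 0\<close> and \<open>f z = 1\<close> yields \<open>g = (\<lambda>y. f (z * y) - z * f y) \<noteq> 0\<close>,
  which is killed by \<open>q\<close>, so that its cyclic span has an eigenvalue different from \<open>z\<close>.
\<close>

lemma partial_hom_moves_irrational:
  fixes F :: "('k::field_char_0 \<Rightarrow> complex) set"
  assumes nf: "number_field TYPE('k)" and F: "finite F" "\<forall>f\<in>F. field_embedding f"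
    and z: "algebraic z" "z \<notin> \<rat>"
  shows "\<exists>R \<Lambda>. partial_hom R \<Lambda> \<and> (\<forall>f\<in>F. range f \<subseteq> R) \<and> z \<in> R \<and> \<Lambda> z \<noteq> z"
proof -
  define P where "P = (\<lambda>p::complex poly. (\<forall>i. coeff p i \<in> \<int>) \<and> p \<noteq> 0 \<and> poly p z = 0)"
  obtain p0 where "P p0" using z(1) unfolding P_def algebraic_def by blast
  then obtain p where p: "P p" and min: "\<And>p'. P p' \<Longrightarrow> degree p \<le> degree p'"
    using ex_has_least_nat[of P p0 degree] by blast
  obtain q where q: "p = [:-z, 1:] * q"
    using p unfolding P_def by (auto simp: poly_eq_0_iff_dvd elim: dvdE)
  then have "q \<noteq> 0" using p by (auto simp: P_def)
  have "degree p \<noteq> 0"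
  proof
    assume "degree p = 0"
    then obtain a where "p = [:a:]" by (elim degree_eq_zeroE)
    then show False using p unfolding P_def by auto
  qed
  \<comment> \<open>A double root would also be a root of the nonzero derivative, against the
    minimal degree of \<open>p\<close>. Hence \<open>q\<close> does not vanish at \<open>z\<close>,
    and its roots differ from \<open>z\<close>.\<close>
  have "poly (pderiv p) z \<noteq> 0"
  proof
    assume "poly (pderiv p) z = 0"
    moreover have "\<forall>i. coeff (pderiv p) i \<in> \<int>"
      using p by (auto simp: P_def coeff_pderiv intro!: Ints_mult Ints_add)
    moreover have "pderiv p \<noteq> 0" using \<open>degree p \<noteq> 0\<close> by (simp add: pderiv_eq_0_iff)
    ultimately have "degree p \<le> degree (pderiv p)" by (intro min) (simp add: P_def)
    then show False using \<open>degree p \<noteq> 0\<close> by (simp add: degree_pderiv)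
  qed
  moreover have "poly (pderiv p) z = poly q z"
    unfolding q pderiv_mult by (simp add: pderiv_pCons)
  ultimately have qz: "poly q z \<noteq> 0" by simp
  let ?s = "\<lambda>(c::rat) (x::complex). of_rat c * x"
  interpret vector_space_pair ?s ?s
    by unfold_locales (simp_all add: distrib_left distrib_right of_rat_add of_rat_mult)
  have "z \<noteq> 1" using z(2) by auto
  have ind: "vs1.independent {1, z}"
  proof (rule vs1.independent_insertI)
    show "1 \<notin> vs1.span {z}"
    proof
      assume "1 \<in> vs1.span {z}"
      then obtain c where "1 = of_rat c * z" by (auto simp: vs1.span_singleton)
      then have "of_rat c * z = 1" by simp
      then have "z = inverse (of_rat c)" by (rule inverse_unique[symmetric])
      then have "z = of_rat (inverse c)" by (simp add: of_rat_inverse)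
      then show False using z(2) by simp
    qed
    show "vs1.independent {z}" using z(2) by (auto simp: vs1.dependent_single)
  qed
  define f where "f = construct {1, z} (\<lambda>x. if x = z then 1 else 0)"
  interpret f: Vector_Spaces.linear ?s ?s f
    unfolding f_def by (rule linear_construct[OF ind])
  have f1: "f 1 = 0" "f z = 1"
    unfolding f_def using \<open>z \<noteq> 1\<close> by (simp_all add: construct_basis[OF ind])
  have f_add: "Modules.additive f" by unfold_locales (rule f.add)
  define g where "g = (\<lambda>y. f (z * y) - z * f y)"
  have g_add: "Modules.additive g"
    by unfold_locales (simp add: g_def distrib_left f.add)
  have g1: "g 1 \<noteq> 0" by (simp add: g_def f1)
  \<comment> \<open>The factorisation of \<open>p\<close> turns \<open>q\<close> acting on
    \<open>g\<close> into \<open>p\<close> acting on \<open>f\<close>. As \<open>f\<close> is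
    additive and \<open>p\<close> has integer coefficients, the result is
    \<open>f (poly p z * y)\<close>.\<close>
  have "(\<Sum>k\<le>degree q. coeff q k * g (z ^ k * y)) = 0" for y
  proof -
    have "(\<Sum>k\<le>degree q. coeff q k * g (z ^ k * y)) = (\<Sum>k\<le>degree p. coeff p k * f (z ^ k * y))"
      unfolding shift_poly_linear_factor[OF q]
      by (simp add: g_def right_diff_distrib sum_subtractf sum_distrib_left mult_ac)
    also have "\<dots> = (\<Sum>k\<le>degree p. f (coeff p k * (z ^ k * y)))"
    proof (rule sum.cong)
      fix k
      obtain m where "coeff p k = of_int m" using p unfolding P_def by (meson Ints_cases)
      then show "coeff p k * f (z ^ k * y) = f (coeff p k * (z ^ k * y))"
        by (simp add: additive_of_int[OF f_add])
    qed simp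
    also have "\<dots> = f (poly p z * y)"
      by (simp add: poly_altdef sum_distrib_right mult.assoc f.sum)
    also have "\<dots> = 0" using p by (simp add: P_def f.zero)
    finally show ?thesis .
  qed
  from eigenfunction_in_cyclic_span[where g = g, OF \<open>q \<noteq> 0\<close> g1 this]
  obtain h r y1 where h: "poly q r = 0" "(\<Sum>k\<le>degree h. coeff h k * g (z ^ k * y1)) \<noteq> 0"
    "\<forall>y. (\<Sum>k\<le>degree h. coeff h k * g (z ^ k * (z * y))) = r * (\<Sum>k\<le>degree h. coeff h k * g (z ^ k * y))"
    by blast
  define g' where "g' = (\<lambda>y. \<Sum>k\<le>degree h. coeff h k * g (z ^ k * y))"
  interpret g: Modules.additive g by (rule g_add)
  have g'_add: "Modules.additive g'"
    unfolding g'_def by unfold_locales (simp add: distrib_left g.add sum.distrib)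
  have g'1: "g' y1 \<noteq> 0" using h(2) by (simp add: g'_def)
  obtain R \<Lambda> where R: "partial_hom R \<Lambda>" "\<forall>f\<in>F. range f \<subseteq> R"
    "\<forall>m c. (\<forall>y. g' (m * y) = c * g' y) \<longrightarrow> m \<in> R \<and> \<Lambda> m = c"
    using partial_hom_extends_embeddings[OF nf F g'_add g'1] by (elim exE conjE)
  have "z \<in> R \<and> \<Lambda> z = r" using R(3)[rule_format, of z r] h(3) unfolding g'_def by blast
  moreover have "r \<noteq> z" using h(1) qz by auto
  ultimately show ?thesis using R(1,2) by blast
qed

section \<open>The product formula and the transfer of relations between moduli\<close>

abbreviation field_embeddings :: "('k::field_char_0 \<Rightarrow> complex) set" where
  "field_embeddings \<equiv> {f. field_embedding f}"

text \<open>Composition with an injective \<open>\<Lambda>\<close> is an injective self-map of a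
  finite set.\<close>

lemma partial_hom_permutes_embeddings:
  assumes fin: "finite (field_embeddings :: ('k::field_char_0 \<Rightarrow> complex) set)"
    and R: "partial_hom R \<Lambda>" "\<forall>f\<in>(field_embeddings :: ('k \<Rightarrow> complex) set). range f \<subseteq> R"
  shows "bij_betw (\<lambda>f x. \<Lambda> (f x)) (field_embeddings :: ('k \<Rightarrow> complex) set) field_embeddings"
    (is "bij_betw _ ?E ?E")
proof -
  have "inj_on (\<lambda>f x. \<Lambda> (f x)) ?E"
  proof (rule inj_onI)
    fix f h assume fh: "f \<in> ?E" "h \<in> ?E" "(\<lambda>x. \<Lambda> (f x)) = (\<lambda>x. \<Lambda> (h x))"
    show "f = h"
    proof
      fix x
      have "\<Lambda> (f x) = \<Lambda> (h x)" using fun_cong[OF fh(3)] .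
      moreover have "f x \<in> R" "h x \<in> R" using R(2) fh(1,2) by blast+
      ultimately show "f x = h x" using R(1) by (auto simp: partial_hom_def dest: inj_onD)
    qed
  qed
  moreover have "(\<lambda>f x. \<Lambda> (f x)) ` ?E \<subseteq> ?E"
    using R by (auto intro: partial_hom_embedding)
  ultimately show ?thesis using fin by (simp add: bij_betw_def endo_inj_surj)
qed

text \<open>The product of the conjugates of an algebraic integer is fixed by every
  \<open>\<Lambda>\<close> that is defined on all of them, so it is rational and therefore an
  integer. For a unit and its inverse these integers multiply to 1.\<close>

lemma norm_prod_embeddings_unit:
  assumes nf: "number_field TYPE('k::field_char_0)"
    and fin: "finite (field_embeddings :: ('k \<Rightarrow> complex) set)"
    and u: "(u::'k) \<in> integer_units"
  shows "norm (\<Prod>f\<in>field_embeddings. f u) = 1"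
proof -
  let ?E = "field_embeddings :: ('k \<Rightarrow> complex) set"
  have emb: "\<forall>f\<in>?E. field_embedding f" by simp
  have int: "(\<Prod>f\<in>?E. f x) \<in> \<int>" if x: "algebraic_int x" for x :: 'k
  proof -
    define z where "z = (\<Prod>f\<in>?E. f x)"
    have z: "algebraic_int z"
      unfolding z_def using x by (intro algebraic_int_prod) (auto intro: field_embedding_algebraic_int)
    have "z \<in> \<rat>"
    proof (rule ccontr)
      assume "z \<notin> \<rat>"
      then obtain R \<Lambda> where R: "partial_hom R \<Lambda>" "\<forall>f\<in>?E. range f \<subseteq> R" "\<Lambda> z \<noteq> z"
        using partial_hom_moves_irrational[OF nf fin emb, of z] z by auto
      have "\<Lambda> z = (\<Prod>f\<in>?E. \<Lambda> (f x))"
        unfolding z_def using R(2) by (intro partial_hom_prod[OF R(1), THEN conjunct2]) blast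
      also have "\<dots> = z"
        unfolding z_def
        by (rule prod.reindex_bij_betw[OF partial_hom_permutes_embeddings[OF fin R(1,2)], of "\<lambda>f. f x"])
      finally show False using R(3) by simp
    qed
    with z show ?thesis unfolding z_def by (rule rational_algebraic_int_is_int)
  qed
  obtain v where v: "algebraic_int u" "algebraic_int v" "u * v = 1"
    using u by (auto simp: integer_units_def ring_of_integers_def)
  obtain m n where mn: "(\<Prod>f\<in>?E. f u) = of_int m" "(\<Prod>f\<in>?E. f v) = of_int n"
    using int[OF v(1)] int[OF v(2)] by (elim Ints_cases)
  have "(of_int (m * n) :: complex) = (\<Prod>f\<in>?E. f u) * (\<Prod>f\<in>?E. f v)" by (simp add: mn)
  also have "\<dots> = (\<Prod>f\<in>?E. f u * f v)" by (simp add: prod.distrib)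
  also have "\<dots> = (\<Prod>f\<in>?E. 1)"
  proof (rule prod.cong)
    fix f assume "f \<in> ?E"
    then show "f u * f v = 1"
      using field_embedding_ring_hom(1,3)[of f] v(3) by (metis mem_Collect_eq)
  qed simp
  finally have "m * n = 1" by (simp flip: of_int_mult)
  then have "\<bar>m\<bar> = 1" by (metis zmult_eq_1_iff abs_1 abs_minus_cancel)
  then show ?thesis unfolding mn by (simp add: norm_of_int flip: of_int_abs)
qed

text \<open>Equality of moduli is made algebraic by writing the squared modulus as the product of an
  embedding and its conjugate. Then a homomorphism taking \<open>\<tau>\<^sub>1\<close> to
  \<open>\<sigma>\<close> applies, and its injectivity keeps the images of the two factors on the
  right different from \<open>\<sigma>\<close>.\<close>

lemma modulus_relation_transfer:
  assumes nf: "number_field TYPE('k::field_char_0)"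
    and emb: "field_embedding \<tau>\<^sub>1" "field_embedding \<tau>\<^sub>2" "field_embedding \<sigma>"
    and ne: "\<tau>\<^sub>2 \<noteq> \<tau>\<^sub>1" "(\<lambda>x. cnj (\<tau>\<^sub>2 x)) \<noteq> \<tau>\<^sub>1"
  shows "\<exists>\<beta> \<gamma> \<delta>. field_embedding \<beta> \<and> field_embedding \<gamma> \<and> field_embedding \<delta> \<and>
    \<gamma> \<noteq> \<sigma> \<and> \<delta> \<noteq> \<sigma> \<and> (\<forall>u::'k. norm (\<tau>\<^sub>1 u) = norm (\<tau>\<^sub>2 u) \<longrightarrow> \<sigma> u * \<beta> u = \<gamma> u * \<delta> u)"
proof -
  let ?b = "\<lambda>x. cnj (\<tau>\<^sub>1 x)" and ?d = "\<lambda>x. cnj (\<tau>\<^sub>2 x)"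
  have cnj: "field_embedding ?b" "field_embedding ?d"
    using emb by (auto simp: field_embedding_def)
  then have "\<forall>f\<in>{?b, \<tau>\<^sub>2, ?d}. field_embedding f" using emb by simp
  from embedding_transfer[OF nf _ this emb(1,3)]
  obtain R \<Lambda> where R: "partial_hom R \<Lambda>" "\<forall>f\<in>{?b, \<tau>\<^sub>2, ?d}. range f \<subseteq> R"
    "\<forall>x. \<tau>\<^sub>1 x \<in> R \<and> \<Lambda> (\<tau>\<^sub>1 x) = \<sigma> x"
    by auto
  have in_R: "?b x \<in> R" "\<tau>\<^sub>2 x \<in> R" "?d x \<in> R" "\<tau>\<^sub>1 x \<in> R" for x using R(2,3) by auto
  have ne': "(\<lambda>x. \<Lambda> (f x)) \<noteq> \<sigma>" if "f \<noteq> \<tau>\<^sub>1" "\<And>x. f x \<in> R" for f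
  proof
    assume eq: "(\<lambda>x. \<Lambda> (f x)) = \<sigma>"
    have "\<Lambda> (f x) = \<Lambda> (\<tau>\<^sub>1 x)" for x using fun_cong[OF eq, of x] R(3) by simp
    then have "f x = \<tau>\<^sub>1 x" for x
      using R(1) that(2)[of x] in_R(4)[of x] by (auto simp: partial_hom_def dest: inj_onD)
    with that(1) show False by auto
  qed
  have rel: "\<sigma> u * \<Lambda> (?b u) = \<Lambda> (\<tau>\<^sub>2 u) * \<Lambda> (?d u)" if "norm (\<tau>\<^sub>1 u) = norm (\<tau>\<^sub>2 u)" for u
  proof -
    have mult: "\<Lambda> (x * y) = \<Lambda> x * \<Lambda> y" if "x \<in> R" "y \<in> R" for x y
      using R(1) that by (simp add: partial_hom_def)
    have "\<sigma> u * \<Lambda> (?b u) = \<Lambda> (\<tau>\<^sub>1 u * ?b u)" using mult in_R R(3) by simp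
    also have "\<tau>\<^sub>1 u * ?b u = \<tau>\<^sub>2 u * ?d u" using that by (simp flip: complex_norm_square)
    finally show ?thesis using mult in_R by simp
  qed
  show ?thesis
    using partial_hom_embedding[OF R(1)] cnj emb(2) R(2) ne' ne in_R rel
    by (intro exI[of _ "\<lambda>x. \<Lambda> (?b x)"] exI[of _ "\<lambda>x. \<Lambda> (\<tau>\<^sub>2 x)"] exI[of _ "\<lambda>x. \<Lambda> (?d x)"]) auto
qed

section \<open>Growth, flux and potentials\<close>

text \<open>The upper limit \<open>L\<close> of \<open>A R / R\<^sup>2\<close> satisfies \<open>l\<^sup>2 * L = k * L\<close>.\<close>

lemma quadratic_growth_scaling:
  fixes A :: "real \<Rightarrow> real"
  assumes "0 < c" "0 < l"
    and bounds: "\<And>R. 0 < R \<Longrightarrow> c * R\<^sup>2 \<le> A R \<and> A R \<le> C * R\<^sup>2"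
    and scaling: "\<And>R. 0 < R \<Longrightarrow> \<bar>A (l * R) - k * A R\<bar> \<le> D * R"
  shows "k = l\<^sup>2"
proof -
  define B where "B = (\<lambda>R. A R / R\<^sup>2)"
  define \<kappa> where "\<kappa> = k / l\<^sup>2"
  have B: "c \<le> B R" "B R \<le> C" if "0 < R" for R
    using bounds[OF that] that by (auto simp: B_def field_simps)
  have Bl: "\<bar>B (l * R) - \<kappa> * B R\<bar> \<le> D / l\<^sup>2 / R" if R: "0 < R" for R
  proof -
    have "B (l * R) - \<kappa> * B R = (A (l * R) - k * A R) / (l\<^sup>2 * R\<^sup>2)"
      using R \<open>0 < l\<close> by (simp add: B_def \<kappa>_def field_simps power_mult_distrib)
    then have "\<bar>B (l * R) - \<kappa> * B R\<bar> = \<bar>A (l * R) - k * A R\<bar> / (l\<^sup>2 * R\<^sup>2)"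
      by (simp add: abs_mult)
    also have "\<dots> \<le> D * R / (l\<^sup>2 * R\<^sup>2)"
      using scaling[OF R] by (intro divide_right_mono) auto
    also have "\<dots> = D / l\<^sup>2 / R" using R by (simp add: power2_eq_square)
    finally show ?thesis .
  qed
  have lim: "((\<lambda>R. B (l * R) - \<kappa> * B R) \<longlongrightarrow> 0) at_top"
  proof (rule Lim_null_comparison)
    show "\<forall>\<^sub>F R in at_top. norm (B (l * R) - \<kappa> * B R) \<le> D / l\<^sup>2 / R"
      using eventually_gt_at_top[of 0] by eventually_elim (use Bl in auto)
    show "((\<lambda>R. D / l\<^sup>2 / R) \<longlongrightarrow> 0) at_top"
      by (intro tendsto_divide_0[OF tendsto_const] filterlim_at_top_imp_at_infinity filterlim_ident)
  qed
  have err: "\<forall>\<^sub>F R in at_top. \<bar>B (l * R) - \<kappa> * B R\<bar> < \<epsilon>" if "\<epsilon> > 0" for \<epsilon>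
    using tendstoD[OF lim that] by (simp add: dist_real_def)
  \<comment> \<open>Rescaling the argument preserves eventual upper bounds, so the upper limits of
    \<open>B R\<close> and \<open>B (l * R)\<close> agree.\<close>
  have scale: "(\<forall>\<^sub>F R in at_top. P (l * R)) \<longleftrightarrow> (\<forall>\<^sub>F R in at_top. P R)" for P :: "real \<Rightarrow> bool"
  proof
    assume "\<forall>\<^sub>F R in at_top. P (l * R)"
    then obtain M where M: "\<And>R. R \<ge> M \<Longrightarrow> P (l * R)" by (auto simp: eventually_at_top_linorder)
    have "P R" if "R \<ge> M * l" for R
      using M[of "R / l"] that \<open>0 < l\<close> by (simp add: field_simps)
    then show "\<forall>\<^sub>F R in at_top. P R" by (auto simp: eventually_at_top_linorder)
  next
    assume "\<forall>\<^sub>F R in at_top. P R"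
    then obtain M where M: "\<And>R. R \<ge> M \<Longrightarrow> P R" by (auto simp: eventually_at_top_linorder)
    have "P (l * R)" if "R \<ge> M / l" for R
      using M[of "l * R"] that \<open>0 < l\<close> by (simp add: field_simps)
    then show "\<forall>\<^sub>F R in at_top. P (l * R)" by (auto simp: eventually_at_top_linorder)
  qed
  \<comment> \<open>Otherwise \<open>B (l * R) - \<kappa> * B R\<close> would stay above
    \<open>c\<close>, although it tends to 0.\<close>
  have pos: "\<kappa> > 0"
  proof (rule ccontr)
    assume "\<not> \<kappa> > 0"
    have "\<forall>\<^sub>F R::real in at_top. False"
      using err[OF \<open>0 < c\<close>] eventually_gt_at_top[of 0]
    proof eventually_elim
      case (elim R)
      then have "B (l * R) \<ge> c" "\<kappa> * B R \<le> 0"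
        using B[of "l * R"] B[of R] \<open>\<not> \<kappa> > 0\<close> \<open>0 < l\<close> \<open>0 < c\<close>
        by (auto simp: mult_nonpos_nonneg)
      with elim show ?case by linarith
    qed
    then show False by simp
  qed
  define S where "S = {b. \<forall>\<^sub>F R in at_top. B R \<le> b}"
  define L where "L = Inf S"
  have lower: "c \<le> b" if "b \<in> S" for b
  proof -
    have "\<forall>\<^sub>F R::real in at_top. c \<le> b"
      using that eventually_gt_at_top[of 0] unfolding S_def mem_Collect_eq
      by eventually_elim (use B in force)
    then show ?thesis by simp
  qed
  have "C \<in> S" unfolding S_def mem_Collect_eq
    using eventually_gt_at_top[of 0] by eventually_elim (rule B)
  have "L \<ge> c" unfolding L_def using lower \<open>C \<in> S\<close> by (intro cInf_greatest) auto
  have L_le: "L \<le> b" if "b \<in> S" for b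
    unfolding L_def using lower that by (intro cInf_lower bdd_belowI) auto
  have near: "\<exists>b\<in>S. b < L + \<epsilon>" if "\<epsilon> > 0" for \<epsilon>
    using cInf_lessD[of S "L + \<epsilon>"] \<open>C \<in> S\<close> that by (auto simp: L_def)
  \<comment> \<open>An eventual upper bound \<open>b\<close> close to \<open>L\<close> also bounds
    \<open>B (l * R)\<close>, hence \<open>\<kappa> * B R\<close> up to the error; dividing by
    \<open>\<kappa>\<close> gives an eventual upper bound of \<open>B\<close>.\<close>
  have "\<kappa> * L \<le> L + \<epsilon>" if "\<epsilon> > 0" for \<epsilon>
  proof -
    obtain b where b: "b \<in> S" "b < L + \<epsilon> / 2" using near[of "\<epsilon> / 2"] \<open>\<epsilon> > 0\<close> by auto
    then have "\<forall>\<^sub>F R in at_top. B (l * R) \<le> b" using scale[of "\<lambda>R. B R \<le> b"] by (simp add: S_def)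
    then have "\<forall>\<^sub>F R in at_top. B R \<le> (b + \<epsilon> / 2) / \<kappa>"
      using err[OF half_gt_zero[OF \<open>\<epsilon> > 0\<close>]] 
    proof eventually_elim
      case (elim R)
      then have "\<kappa> * B R \<le> b + \<epsilon> / 2" by linarith
      then show ?case using pos by (simp add: pos_le_divide_eq mult.commute)
    qed
    then have "L \<le> (b + \<epsilon> / 2) / \<kappa>" by (intro L_le) (simp add: S_def)
    then show ?thesis using b(2) pos by (simp add: field_simps)
  qed
  then have "\<kappa> * L \<le> L" by (rule field_le_epsilon)
  moreover have "L \<le> \<kappa> * L + \<epsilon>" if "\<epsilon> > 0" for \<epsilon>
  proof -
    obtain b where b: "b \<in> S" "b < L + \<epsilon> / (2 * \<kappa>)"
      using near[of "\<epsilon> / (2 * \<kappa>)"] \<open>\<epsilon> > 0\<close> pos by auto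
    have "\<forall>\<^sub>F R in at_top. B R \<le> b" using b by (simp add: S_def)
    moreover have "\<forall>\<^sub>F R in at_top. \<bar>B (l * R) - \<kappa> * B R\<bar> < \<epsilon> / 2"
      by (rule err) (use \<open>\<epsilon> > 0\<close> in simp)
    ultimately have "\<forall>\<^sub>F R in at_top. B (l * R) \<le> \<kappa> * b + \<epsilon> / 2"
    proof eventually_elim
      case (elim R)
      then have "\<kappa> * B R \<le> \<kappa> * b" using pos by simp
      with elim show ?case by linarith
    qed
    then have "L \<le> \<kappa> * b + \<epsilon> / 2" using scale[of "\<lambda>R. B R \<le> \<kappa> * b + \<epsilon> / 2"] by (intro L_le) (simp add: S_def)
    moreover have "\<kappa> * b < \<kappa> * L + \<epsilon> / 2" using b(2) pos by (simp add: field_simps)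
    ultimately show ?thesis by linarith
  qed
  then have "L \<le> \<kappa> * L" by (rule field_le_epsilon)
  ultimately have "\<kappa> = 1" using \<open>L \<ge> c\<close> \<open>0 < c\<close> by simp
  then show ?thesis using \<open>0 < l\<close> by (simp add: \<kappa>_def)
qed

section \<open>Stokes' theorem for a moving disc\<close>

lemma C_on_1_has_derivative:
  assumes "C_on 1 S f" "x \<in> S"
  shows "(f has_derivative frechet_derivative f (at x)) (at x)"
  using assms frechet_derivative_works by auto

lemma C_on_1_continuous_derivative:
  assumes "C_on 1 S f"
  shows "continuous_on S (\<lambda>x. frechet_derivative f (at x) v)"
  using assms by auto

lemma C_on_1_continuous: "C_on 1 S f \<Longrightarrow> continuous_on S f"
  by (simp add: continuous_at_imp_continuous_on differentiable_imp_continuous_within)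

lemma has_real_derivative_along_curve:
  fixes P :: "'a::real_normed_vector \<Rightarrow> real"
  assumes "(P has_derivative P') (at (\<gamma> t))" "(\<gamma> has_vector_derivative w) (at t within T)"
  shows "((\<lambda>s. P (\<gamma> s)) has_real_derivative P' w) (at t within T)"
proof -
  interpret bounded_linear P' using assms(1) by (rule has_derivative_bounded_linear)
  have "((\<lambda>s. P (\<gamma> s)) has_derivative (\<lambda>h. P' (h *\<^sub>R w))) (at t within T)"
    using has_derivative_compose[OF assms(2)[unfolded has_vector_derivative_def] assms(1)] .
  moreover have "(\<lambda>h. P' (h *\<^sub>R w)) = (*) (P' w)" by (simp add: fun_eq_iff scaleR mult.commute)
  ultimately show ?thesis by (simp add: has_field_derivative_def)
qed

lemma continuous_on_compose_triple:
  assumes "continuous_on (A \<times> UNIV) (\<lambda>p. F (fst p) (fst (snd p)) (snd (snd p)))"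
    "continuous_on T a" "continuous_on T b" "continuous_on T c" "\<And>p. p \<in> T \<Longrightarrow> a p \<in> A"
  shows "continuous_on T (\<lambda>p. F (a p) (b p) (c p))"
proof -
  have "continuous_on T (\<lambda>p. (a p, b p, c p))" using assms(2-4) by (intro continuous_intros)
  then show ?thesis using continuous_on_compose2[OF assms(1)] assms(5) by force
qed

text \<open>Rotation invariance of the divergence of a plane field (P1, -P2): \<open>a1\<close>,
  \<open>b1\<close> are the partial derivatives of P1, \<open>a2\<close>, \<open>b2\<close> those of
  P2, and the left side uses the rotated frame.\<close>

lemma rotated_divergence_identity:
  fixes c s a1 a2 b1 b2 :: real
  assumes "s\<^sup>2 + c\<^sup>2 = 1"
  shows "(c * (c * a1 + s * b1) - s * (c * a2 + s * b2)) -
    (c * (- s * a2 + c * b2) + s * (- s * a1 + c * b1)) = a1 - b2"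
proof -
  have "(c * (c * a1 + s * b1) - s * (c * a2 + s * b2)) -
      (c * (- s * a2 + c * b2) + s * (- s * a1 + c * b1)) = (s\<^sup>2 + c\<^sup>2) * a1 - (s\<^sup>2 + c\<^sup>2) * b2"
    by (simp add: power2_eq_square algebra_simps)
  then show ?thesis using assms by simp
qed

text \<open>The hypothesis \<open>eq\<close> is the closedness of a 2-form with components
  \<open>h\<close> on (e1, e2), \<open>P1\<close> on (v, e2) and \<open>P2\<close> on (v, e1). Hence
  moving the disc changes the integral of \<open>h\<close> at the rate of the flux of (P1, -P2)
  through a circle of length 2 pi R, whose integrand is at most 2 D. Polar coordinates reduce the
  divergence theorem to the fundamental theorem of calculus.\<close>

lemma flux_bound_in_polar_coordinates:
  fixes h P1 P2 :: "'a::real_normed_vector \<Rightarrow> real"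
  assumes dh: "\<And>x. x \<in> S \<Longrightarrow> (h has_derivative h' x) (at x)"
    and d1: "\<And>x. x \<in> S \<Longrightarrow> (P1 has_derivative P1' x) (at x)"
    and d2: "\<And>x. x \<in> S \<Longrightarrow> (P2 has_derivative P2' x) (at x)"
    and ch: "\<And>w. continuous_on S (\<lambda>x. h' x w)"
    and c1: "\<And>w. continuous_on S (\<lambda>x. P1' x w)"
    and c2: "\<And>w. continuous_on S (\<lambda>x. P2' x w)"
    and eq: "\<And>x. x \<in> S \<Longrightarrow> h' x v = P1' x e1 - P2' x e2"
    and in_S: "\<And>\<tau> a b. \<tau> \<in> {0..1} \<Longrightarrow> x0 + \<tau> *\<^sub>R v + a *\<^sub>R e1 + b *\<^sub>R e2 \<in> S"
    and D: "\<And>\<tau> a b. \<tau> \<in> {0..1} \<Longrightarrow> \<bar>P1 (x0 + \<tau> *\<^sub>R v + a *\<^sub>R e1 + b *\<^sub>R e2)\<bar> \<le> D"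
      "\<And>\<tau> a b. \<tau> \<in> {0..1} \<Longrightarrow> \<bar>P2 (x0 + \<tau> *\<^sub>R v + a *\<^sub>R e1 + b *\<^sub>R e2)\<bar> \<le> D"
    and R: "0 \<le> R"
  shows "\<bar>integral {0..R} (\<lambda>r. integral {0..2*pi} (\<lambda>\<phi>. r * h (x0 + v + (r * cos \<phi>) *\<^sub>R e1 + (r * sin \<phi>) *\<^sub>R e2)))
      - integral {0..R} (\<lambda>r. integral {0..2*pi} (\<lambda>\<phi>. r * h (x0 + (r * cos \<phi>) *\<^sub>R e1 + (r * sin \<phi>) *\<^sub>R e2)))\<bar>
    \<le> 4 * pi * D * R"
proof -
  define X where "X = (\<lambda>\<tau> r \<phi>. x0 + \<tau> *\<^sub>R v + (r * cos \<phi>) *\<^sub>R e1 + (r * sin \<phi>) *\<^sub>R e2)"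
  have XS: "X \<tau> r \<phi> \<in> S" if "\<tau> \<in> {0..1}" for \<tau> r \<phi>
    unfolding X_def using that by (rule in_S)
  define W :: "(real \<times> real \<times> real) set" where "W = {0..1} \<times> UNIV"
  have hS: "continuous_on S h" "continuous_on S P1" "continuous_on S P2"
    using dh d1 d2 by (auto intro!: continuous_at_imp_continuous_on has_derivative_continuous)
  have comp: "continuous_on W (\<lambda>p. G (X (fst p) (fst (snd p)) (snd (snd p))))"
    if "continuous_on S G" for G :: "'a \<Rightarrow> real"
  proof (rule continuous_on_compose2[OF that])
    show "continuous_on W (\<lambda>p. X (fst p) (fst (snd p)) (snd (snd p)))"
      unfolding X_def by (intro continuous_intros)
  qed (auto simp: W_def intro: XS)
  have X_\<tau>: "((\<lambda>\<tau>. X \<tau> r \<phi>) has_vector_derivative v) (at \<tau> within T)" for \<tau> r \<phi> T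
    unfolding X_def by (auto intro!: derivative_eq_intros)
  have X_r: "((\<lambda>r. X \<tau> r \<phi>) has_vector_derivative cos \<phi> *\<^sub>R e1 + sin \<phi> *\<^sub>R e2) (at r within T)" for \<tau> r \<phi> T
    unfolding X_def by (auto intro!: derivative_eq_intros)
  have X_\<phi>: "((\<lambda>\<phi>. X \<tau> r \<phi>) has_vector_derivative (- (r * sin \<phi>)) *\<^sub>R e1 + (r * cos \<phi>) *\<^sub>R e2) (at \<phi> within T)" for \<tau> r \<phi> T
    unfolding X_def by (auto intro!: derivative_eq_intros simp: mult.commute)
  have lin: "P' x (a *\<^sub>R e1 + b *\<^sub>R e2) = a * P' x e1 + b * P' x e2"
    if "\<And>x. x \<in> S \<Longrightarrow> (P has_derivative P' x) (at x)" "x \<in> S" for P :: "'a \<Rightarrow> real" and P' x a b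
  proof -
    interpret bounded_linear "P' x" using that by (auto intro: has_derivative_bounded_linear)
    show ?thesis by (simp add: add scaleR)
  qed
  txt \<open>In polar coordinates \<open>eq\<close> becomes \<open>r * h' v = \<partial>\<^sub>r N - \<partial>\<^sub>\<phi> Q\<close>, and \<open>Q\<close> is periodic in \<open>\<phi>\<close>.\<close>
  define N where "N = (\<lambda>\<tau> r \<phi>. r * (cos \<phi> * P1 (X \<tau> r \<phi>) - sin \<phi> * P2 (X \<tau> r \<phi>)))"
  define Nr where "Nr = (\<lambda>\<tau> r \<phi>. (cos \<phi> * P1 (X \<tau> r \<phi>) - sin \<phi> * P2 (X \<tau> r \<phi>)) +
     r * (cos \<phi> * (cos \<phi> * P1' (X \<tau> r \<phi>) e1 + sin \<phi> * P1' (X \<tau> r \<phi>) e2)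
        - sin \<phi> * (cos \<phi> * P2' (X \<tau> r \<phi>) e1 + sin \<phi> * P2' (X \<tau> r \<phi>) e2)))"
  define Q where "Q = (\<lambda>\<tau> r \<phi>. cos \<phi> * P2 (X \<tau> r \<phi>) + sin \<phi> * P1 (X \<tau> r \<phi>))"
  define Q\<phi> where "Q\<phi> = (\<lambda>\<tau> r \<phi>. - sin \<phi> * P2 (X \<tau> r \<phi>) + cos \<phi> * P1 (X \<tau> r \<phi>) +
     r * (cos \<phi> * (- sin \<phi> * P2' (X \<tau> r \<phi>) e1 + cos \<phi> * P2' (X \<tau> r \<phi>) e2)
        + sin \<phi> * (- sin \<phi> * P1' (X \<tau> r \<phi>) e1 + cos \<phi> * P1' (X \<tau> r \<phi>) e2)))"
  have N_r: "((\<lambda>r. N \<tau> r \<phi>) has_real_derivative Nr \<tau> r \<phi>) (at r within T)" if "\<tau> \<in> {0..1}" for \<tau> r \<phi> T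
    unfolding N_def Nr_def
    by (rule derivative_eq_intros has_real_derivative_along_curve[OF d1[OF XS[OF that]] X_r]
       has_real_derivative_along_curve[OF d2[OF XS[OF that]] X_r] refl)+
      (simp only: lin[OF d1 XS[OF that]] lin[OF d2 XS[OF that]], simp add: algebra_simps)
  have Q_\<phi>: "((\<lambda>\<phi>. Q \<tau> r \<phi>) has_real_derivative Q\<phi> \<tau> r \<phi>) (at \<phi> within T)" if "\<tau> \<in> {0..1}" for \<tau> r \<phi> T
    unfolding Q_def Q\<phi>_def
    by (rule derivative_eq_intros has_real_derivative_along_curve[OF d1[OF XS[OF that]] X_\<phi>]
       has_real_derivative_along_curve[OF d2[OF XS[OF that]] X_\<phi>] refl)+
      (simp only: lin[OF d1 XS[OF that]] lin[OF d2 XS[OF that]], simp add: algebra_simps)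
  have key: "r * h' (X \<tau> r \<phi>) v = Nr \<tau> r \<phi> - Q\<phi> \<tau> r \<phi>" if "\<tau> \<in> {0..1}" for \<tau> r \<phi>
  proof -
    have "Nr \<tau> r \<phi> - Q\<phi> \<tau> r \<phi> = r * (P1' (X \<tau> r \<phi>) e1 - P2' (X \<tau> r \<phi>) e2)"
      unfolding Nr_def Q\<phi>_def
      by (subst rotated_divergence_identity[of "sin \<phi>" "cos \<phi>" "P1' (X \<tau> r \<phi>) e1" "P1' (X \<tau> r \<phi>) e2"
            "P2' (X \<tau> r \<phi>) e1" "P2' (X \<tau> r \<phi>) e2", symmetric]) (simp, simp add: right_diff_distrib)
    then show ?thesis using eq[OF XS[OF that]] by simp
  qed
  define m where "m = (\<lambda>\<tau> r. integral {0..2*pi} (\<lambda>\<phi>. r * h (X \<tau> r \<phi>)))"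
  define m\<tau> where "m\<tau> = (\<lambda>\<tau> r. integral {0..2*pi} (\<lambda>\<phi>. r * h' (X \<tau> r \<phi>) v))"
  define n where "n = (\<lambda>\<tau> r. integral {0..2*pi} (N \<tau> r))"
  have "continuous_on W (\<lambda>p. Nr (fst p) (fst (snd p)) (snd (snd p)))"
    unfolding Nr_def by (intro continuous_intros comp hS c1 c2)
  note cNr = continuous_on_compose_triple[OF this[unfolded W_def]]
  have "continuous_on W (\<lambda>p. N (fst p) (fst (snd p)) (snd (snd p)))"
    unfolding N_def by (intro continuous_intros comp hS)
  note cN = continuous_on_compose_triple[OF this[unfolded W_def]]
  have "continuous_on W (\<lambda>p. Q\<phi> (fst p) (fst (snd p)) (snd (snd p)))"
    unfolding Q\<phi>_def by (intro continuous_intros comp hS c1 c2)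
  note cQ\<phi> = continuous_on_compose_triple[OF this[unfolded W_def]]
  have "continuous_on W (\<lambda>p. fst (snd p) * h (X (fst p) (fst (snd p)) (snd (snd p))))"
    by (intro continuous_intros comp hS)
  note ch0 = continuous_on_compose_triple[where F = "\<lambda>\<tau> r \<phi>. r * h (X \<tau> r \<phi>)", OF this[unfolded W_def]]
  have "continuous_on W (\<lambda>p. fst (snd p) * h' (X (fst p) (fst (snd p)) (snd (snd p))) v)"
    by (intro continuous_intros comp ch)
  note ch1 = continuous_on_compose_triple[where F = "\<lambda>\<tau> r \<phi>. r * h' (X \<tau> r \<phi>) v", OF this[unfolded W_def]]
  have m\<tau>: "m\<tau> \<tau> r = integral {0..2*pi} (Nr \<tau> r)" if \<tau>: "\<tau> \<in> {0..1}" for \<tau> r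
  proof -
    have "(Q\<phi> \<tau> r has_integral (Q \<tau> r (2 * pi) - Q \<tau> r 0)) {0..2*pi}"
      using Q_\<phi>[OF \<tau>] by (intro fundamental_theorem_of_calculus) (auto simp flip: has_real_derivative_iff_has_vector_derivative)
    moreover have "Q \<tau> r (2 * pi) = Q \<tau> r 0" by (simp add: Q_def X_def)
    ultimately have "integral {0..2*pi} (Q\<phi> \<tau> r) = 0" by (simp add: integral_unique)
    moreover have "Q\<phi> \<tau> r integrable_on {0..2*pi}" "Nr \<tau> r integrable_on {0..2*pi}"
      using \<tau> by (auto intro!: integrable_continuous_real cQ\<phi> cNr continuous_intros)
    ultimately show ?thesis
      unfolding m\<tau>_def key[OF \<tau>] by (subst integral_diff) auto
  qed
  have m_\<tau>: "((\<lambda>\<tau>. m \<tau> r) has_real_derivative m\<tau> \<tau> r) (at \<tau> within {0..1})" if \<tau>: "\<tau> \<in> {0..1}" for \<tau> r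
    unfolding m_def m\<tau>_def box_real(2)[symmetric]
  proof (rule leibniz_rule_field_derivative)
    show "((\<lambda>\<tau>. r * h (X \<tau> r \<phi>)) has_real_derivative r * h' (X \<tau> r \<phi>) v) (at \<tau> within cbox 0 1)"
      if "\<tau> \<in> cbox 0 1" for \<tau> \<phi>
      using that by (intro DERIV_cmult has_real_derivative_along_curve[OF _ X_\<tau>] dh XS) simp
    show "(\<lambda>\<phi>. r * h (X \<tau> r \<phi>)) integrable_on cbox 0 (2 * pi)" if "\<tau> \<in> cbox 0 1" for \<tau>
      using that by (intro integrable_continuous ch0 continuous_intros) auto
    show "continuous_on (cbox 0 1 \<times> cbox 0 (2 * pi)) (\<lambda>(\<tau>, \<phi>). r * h' (X \<tau> r \<phi>) v)"
      unfolding case_prod_beta by (intro ch1 continuous_intros) auto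
  qed (use \<tau> in auto)
  have n_r: "((\<lambda>r. n \<tau> r) has_real_derivative m\<tau> \<tau> r) (at r within {0..R})"
    if \<tau>: "\<tau> \<in> {0..1}" and r: "r \<in> {0..R}" for \<tau> r
    unfolding n_def m\<tau>[OF \<tau>] box_real(2)[symmetric]
  proof (rule leibniz_rule_field_derivative)
    show "((\<lambda>r. N \<tau> r \<phi>) has_real_derivative Nr \<tau> r \<phi>) (at r within cbox 0 R)" for r \<phi>
      by (rule N_r[OF \<tau>])
    show "N \<tau> r integrable_on cbox 0 (2 * pi)" for r
      using \<tau> by (intro integrable_continuous cN continuous_intros) auto
    show "continuous_on (cbox 0 R \<times> cbox 0 (2 * pi)) (\<lambda>(r, \<phi>). Nr \<tau> r \<phi>)"
      unfolding case_prod_beta using \<tau> by (intro cNr continuous_intros) auto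
  qed (use r in auto)
  have n_bound: "\<bar>n \<tau> R\<bar> \<le> 4 * pi * D * R" if \<tau>: "\<tau> \<in> {0..1}" for \<tau>
  proof -
    have "norm (integral {0..2*pi} (N \<tau> R)) \<le> (R * (D + D)) * (2 * pi - 0)"
    proof (rule integral_bound)
      show "continuous_on {0..2*pi} (N \<tau> R)"
        using \<tau> by (intro cN continuous_intros) auto
      fix \<phi> :: real
      have P: "\<bar>P1 (X \<tau> R \<phi>)\<bar> \<le> D" "\<bar>P2 (X \<tau> R \<phi>)\<bar> \<le> D"
        unfolding X_def using D \<tau> by auto
      have "\<bar>cos \<phi> * P1 (X \<tau> R \<phi>)\<bar> \<le> 1 * D" "\<bar>sin \<phi> * P2 (X \<tau> R \<phi>)\<bar> \<le> 1 * D"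
        unfolding abs_mult using P by (intro mult_mono; simp)+
      then have "\<bar>cos \<phi> * P1 (X \<tau> R \<phi>) - sin \<phi> * P2 (X \<tau> R \<phi>)\<bar> \<le> D + D" by linarith
      then show "norm (N \<tau> R \<phi>) \<le> R * (D + D)"
        unfolding N_def real_norm_def abs_mult using R by (intro mult_mono) auto
    qed simp
    then show ?thesis by (simp add: n_def algebra_simps)
  qed
  \<comment> \<open>Integration in \<open>r\<close> leaves only the flux \<open>n \<tau> R\<close>
    through the outer circle: at \<open>r = 0\<close> the factor \<open>r\<close> in
    \<open>N\<close> makes the flux vanish.\<close>
  have I: "((\<lambda>\<tau>. integral {0..R} (m \<tau>)) has_real_derivative n \<tau> R) (at \<tau> within {0..1})" if \<tau>: "\<tau> \<in> {0..1}" for \<tau>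
  proof -
    have "((\<lambda>\<tau>. integral (cbox 0 R) (m \<tau>)) has_real_derivative integral (cbox 0 R) (m\<tau> \<tau>)) (at \<tau> within {0..1})"
    proof (rule leibniz_rule_field_derivative)
      show "((\<lambda>\<tau>. m \<tau> r) has_real_derivative m\<tau> \<tau> r) (at \<tau> within {0..1})" if "\<tau> \<in> {0..1}" for \<tau> r
        using that by (rule m_\<tau>)
      show "m \<tau> integrable_on cbox 0 R" if "\<tau> \<in> {0..1}" for \<tau>
      proof (rule integrable_continuous)
        show "continuous_on (cbox 0 R) (m \<tau>)"
          unfolding m_def box_real(2)[symmetric]
          by (rule integral_continuous_on_param) (unfold case_prod_beta, intro ch0 continuous_intros, use that in auto)
      qed
      have "continuous_on ({0..1} \<times> cbox 0 R) (\<lambda>p. integral (cbox 0 (2*pi)) (\<lambda>\<phi>. snd p * h' (X (fst p) (snd p) \<phi>) v))"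
        by (rule integral_continuous_on_param) (unfold case_prod_beta, intro ch1 continuous_intros, auto)
      then show "continuous_on ({0..1} \<times> cbox 0 R) (\<lambda>(\<tau>, r). m\<tau> \<tau> r)"
        by (simp add: m\<tau>_def case_prod_beta)
    qed (use \<tau> in auto)
    moreover have "(m\<tau> \<tau> has_integral (n \<tau> R - n \<tau> 0)) {0..R}"
      using n_r[OF \<tau>] R by (intro fundamental_theorem_of_calculus) (auto simp flip: has_real_derivative_iff_has_vector_derivative)
    moreover have "n \<tau> 0 = 0" by (simp add: n_def N_def)
    ultimately show ?thesis by (simp add: integral_unique)
  qed
  have "norm (integral {0..R} (m 1) - integral {0..R} (m 0)) \<le> (4 * pi * D * R) * norm (1 - 0 :: real)"
    by (rule field_differentiable_bound[OF _ I]) (use n_bound in auto)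
  then show ?thesis by (simp add: m_def X_def)
qed

text \<open>The potential integrates the form along the segments from \<open>x0\<close>. Closedness
  exchanges the two directions in the derivative of the integrand, which thereby becomes the
  derivative of \<open>t * \<theta> (y x t) v\<close> with respect to \<open>t\<close>.\<close>

lemma closed_one_form_has_potential:
  fixes \<theta> :: "'a::euclidean_space \<Rightarrow> 'a \<Rightarrow> real"
  assumes S: "open S" "convex S"
    and lin: "\<And>x. x \<in> S \<Longrightarrow> linear (\<theta> x)"
    and C1: "\<And>v. C_on 1 S (\<lambda>x. \<theta> x v)"
    and closed: "\<And>x u v. x \<in> S \<Longrightarrow> ext_deriv1 \<theta> x u v = 0"
  shows "\<exists>f. \<forall>x\<in>S. (f has_derivative \<theta> x) (at x)"
proof (cases "S = {}")
  case False
  then obtain x0 where x0: "x0 \<in> S" by blast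
  define d where "d = (\<lambda>b x. frechet_derivative (\<lambda>x. \<theta> x b) (at x))"
  have d: "((\<lambda>x. \<theta> x b) has_derivative d b x) (at x)" if "x \<in> S" for b x
    unfolding d_def by (rule C_on_1_has_derivative[OF C1 that])
  have cd: "continuous_on S (\<lambda>x. d b x v)" for b v
    unfolding d_def by (rule C_on_1_continuous_derivative[OF C1])
  have c\<theta>: "continuous_on S (\<lambda>x. \<theta> x b)" for b
    by (rule C_on_1_continuous[OF C1])
  have sym: "d v x u = d u x v" if "x \<in> S" for u v x
    using closed[OF that, of u v] by (simp add: ext_deriv1_def d_def)
  have d_lin: "linear (d b x)" if "x \<in> S" for b x
    using d[OF that] by (intro bounded_linear.linear has_derivative_bounded_linear)
  define y where "y = (\<lambda>x t. x0 + t *\<^sub>R (x - x0))"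
  have yS: "y x t \<in> S" if "x \<in> S" "t \<in> cbox 0 1" for x t
  proof -
    have "y x t = (1 - t) *\<^sub>R x0 + t *\<^sub>R x" by (simp add: y_def algebra_simps)
    then show ?thesis using convexD_alt[OF S(2) x0 that(1), of t] that(2) by simp
  qed
  have expand: "(\<Sum>b\<in>Basis. (w \<bullet> b) * g b) = g w" if "linear g" for w and g :: "'a \<Rightarrow> real"
  proof -
    have "g w = g (\<Sum>b\<in>Basis. (w \<bullet> b) *\<^sub>R b)" by (simp add: euclidean_representation)
    then show ?thesis by (simp add: linear_sum[OF that] linear_scale[OF that])
  qed
  \<comment> \<open>On the domain this is \<open>\<theta> (y x t) (x - x0)\<close>. The expansion in
    coordinates reduces its derivative to the components of the form on fixed vectors.\<close>
  define G where "G = (\<lambda>x t. \<Sum>b\<in>Basis. ((x - x0) \<bullet> b) * \<theta> (y x t) b)"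
  define G' where "G' = (\<lambda>x t v. \<theta> (y x t) v + t * d v (y x t) (x - x0))"
  have G: "(G x t) = \<theta> (y x t) (x - x0)" if "x \<in> S" "t \<in> cbox 0 1" for x t
    unfolding G_def by (rule expand[OF lin[OF yS[OF that]]])
  have DG: "((\<lambda>x. G x t) has_derivative G' x t) (at x within S)" if x: "x \<in> S" and t: "t \<in> cbox 0 1" for x t
  proof -
    have Dy: "((\<lambda>x. y x t) has_derivative (\<lambda>v. t *\<^sub>R v)) (at x within S)"
      unfolding y_def by (auto intro!: derivative_eq_intros)
    have "((\<lambda>x. G x t) has_derivative
        (\<lambda>v. \<Sum>b\<in>Basis. ((x - x0) \<bullet> b) * d b (y x t) (t *\<^sub>R v) + (v \<bullet> b) * \<theta> (y x t) b)) (at x within S)"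
      unfolding G_def
      by (intro has_derivative_sum has_derivative_mult has_derivative_compose[OF Dy d[OF yS[OF x t]]])
        (auto intro!: derivative_eq_intros)
    moreover have "(\<Sum>b\<in>Basis. ((x - x0) \<bullet> b) * d b (y x t) (t *\<^sub>R v) + (v \<bullet> b) * \<theta> (y x t) b) = G' x t v" for v
    proof -
      have "d b (y x t) (t *\<^sub>R v) = t * d v (y x t) b" for b
        using sym[OF yS[OF x t]] linear_scale[OF d_lin[OF yS[OF x t]], of b t v] by simp
      then have "(\<Sum>b\<in>Basis. ((x - x0) \<bullet> b) * d b (y x t) (t *\<^sub>R v)) = t * (\<Sum>b\<in>Basis. ((x - x0) \<bullet> b) * d v (y x t) b)"
        by (simp add: sum_distrib_left mult_ac)
      then show ?thesis
        using expand[OF d_lin[OF yS[OF x t]], of "x - x0" v] expand[OF lin[OF yS[OF x t]], of v]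
        by (simp add: sum.distrib G'_def)
    qed
    ultimately show ?thesis by simp
  qed
  have bl: "bounded_linear (G' x t)" if "x \<in> S" "t \<in> cbox 0 1" for x t
    using DG[OF that] by (rule has_derivative_bounded_linear)
  have cy: "continuous_on (S \<times> cbox 0 1) (\<lambda>p. y (fst p) (snd p))"
    unfolding y_def by (intro continuous_intros)
  have cG': "continuous_on (S \<times> cbox 0 1) (\<lambda>p. G' (fst p) (snd p) v)" for v
  proof -
    have "continuous_on (S \<times> cbox 0 1) (\<lambda>p. d v (y (fst p) (snd p)) (fst p - x0))"
    proof -
      have "continuous_on (S \<times> cbox 0 1) (\<lambda>p. \<Sum>b\<in>Basis. ((fst p - x0) \<bullet> b) * d v (y (fst p) (snd p)) b)"
        by (intro continuous_intros continuous_on_compose2[OF cd cy]) (auto intro: yS)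
      then show ?thesis
        by (rule continuous_on_eq) (auto intro!: expand d_lin yS)
    qed
    then show ?thesis
      unfolding G'_def by (intro continuous_intros continuous_on_compose2[OF c\<theta> cy]) (auto intro: yS)
  qed
  define f where "f = (\<lambda>x. integral (cbox 0 1) (G x))"
  have "(f has_derivative \<theta> x) (at x)" if x: "x \<in> S" for x
  proof -
    have int_eq: "integral (cbox 0 1) (\<lambda>t. G' x t v) = \<theta> x v" for v
    proof -
      have "((\<lambda>t. t * \<theta> (y x t) v) has_real_derivative G' x t v) (at t within {0..1})" if t: "t \<in> {0..1}" for t
      proof -
        have "((\<lambda>t. y x t) has_vector_derivative (x - x0)) (at t within {0..1})"
          unfolding y_def by (auto intro!: derivative_eq_intros)
        from has_real_derivative_along_curve[OF d[OF yS[OF x]] this] t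
        have "((\<lambda>t. \<theta> (y x t) v) has_real_derivative d v (y x t) (x - x0)) (at t within {0..1})" by simp
        then show ?thesis unfolding G'_def by (auto intro!: derivative_eq_intros)
      qed
      then have "((\<lambda>t. G' x t v) has_integral (1 * \<theta> (y x 1) v - 0 * \<theta> (y x 0) v)) {0..1}"
        by (intro fundamental_theorem_of_calculus) (auto simp flip: has_real_derivative_iff_has_vector_derivative)
      then show ?thesis by (simp add: integral_unique y_def)
    qed
    \<comment> \<open>Differentiation under the integral needs the derivative as a continuous family
      of bounded linear maps; in finite dimension continuity can be tested on vectors.\<close>
    have cB: "continuous_on (S \<times> cbox 0 1) (\<lambda>p. Blinfun (G' (fst p) (snd p)))"
    proof (rule continuous_on_blinfun_componentwise)
      fix v
      show "continuous_on (S \<times> cbox 0 1) (\<lambda>p. blinfun_apply (Blinfun (G' (fst p) (snd p))) v)"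
        using cG'[of v] by (rule continuous_on_eq) (auto simp: bounded_linear_Blinfun_apply bl)
    qed
    have deriv: "(f has_derivative blinfun_apply (integral (cbox 0 1) (\<lambda>t. Blinfun (G' x t)))) (at x within S)"
      unfolding f_def
    proof (rule leibniz_rule[where fx = "\<lambda>x t. Blinfun (G' x t)"])
      show "((\<lambda>x. G x t) has_derivative blinfun_apply (Blinfun (G' x t))) (at x within S)"
        if "x \<in> S" "t \<in> cbox 0 1" for x t
        using DG[OF that] bl[OF that] by (simp add: bounded_linear_Blinfun_apply)
      show "G x integrable_on cbox 0 1" if "x \<in> S" for x
        unfolding G_def y_def
        by (intro integrable_continuous continuous_intros continuous_on_compose2[OF c\<theta>])
          (use yS[OF that] in \<open>auto simp: y_def\<close>)
      show "continuous_on (S \<times> cbox 0 1) (\<lambda>(x, t). Blinfun (G' x t))"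
        using cB by (simp add: case_prod_beta)
    qed (use x S in auto)
    have eq: "blinfun_apply (integral (cbox 0 1) (\<lambda>t. Blinfun (G' x t))) = \<theta> x"
    proof
      fix v
      have "(\<lambda>t. Blinfun (G' x t)) integrable_on cbox 0 1"
      proof (rule integrable_continuous)
        have "continuous_on (cbox 0 1) (\<lambda>t. (x, t))" by (intro continuous_intros)
        from continuous_on_compose2[OF cB this] x
        show "continuous_on (cbox 0 1) (\<lambda>t. Blinfun (G' x t))" by auto
      qed
      then have "blinfun_apply (integral (cbox 0 1) (\<lambda>t. Blinfun (G' x t))) v =
          integral (cbox 0 1) (\<lambda>t. blinfun_apply (Blinfun (G' x t)) v)"
        by (rule blinfun_apply_integral)
      also have "\<dots> = integral (cbox 0 1) (\<lambda>t. G' x t v)"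
        by (rule Henstock_Kurzweil_Integration.integral_cong) (simp add: bounded_linear_Blinfun_apply bl[OF x])
      finally show "blinfun_apply (integral (cbox 0 1) (\<lambda>t. Blinfun (G' x t))) v = \<theta> x v"
        using int_eq by simp
    qed
    show ?thesis using deriv unfolding eq at_within_open[OF x S(1)] .
  qed
  then show ?thesis by blast
qed simp

text \<open>The derivative with respect to the shift is the difference of \<open>F\<close> at the
  two ends of a period, which is 0.\<close>

lemma integral_periodic_shift:
  fixes F :: "real \<Rightarrow> real"
  assumes F: "continuous_on UNIV F" "\<And>x. F (x + p) = F x" and "0 \<le> p"
  shows "integral {0..p} (\<lambda>x. F (x + a)) = integral {0..p} F"
proof -
  have cont: "continuous_on T F" for T using F(1) by (rule continuous_on_subset) simp
  define I where "I = (\<lambda>a. integral {0..p} (\<lambda>x. F (x + a)))"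
  \<comment> \<open>The lower limit lies strictly below every shift between
    \<open>-\<bar>a\<bar>\<close> and \<open>\<bar>a\<bar>\<close>, so \<open>G\<close> has a
    two-sided derivative at all of them.\<close>
  define G where "G = (\<lambda>b. integral {- \<bar>a\<bar> - 1..b} F)"
  have G: "(G has_real_derivative F b) (at b)" if "b > - \<bar>a\<bar> - 1" for b
  proof -
    have "(G has_real_derivative F b) (at b within {- \<bar>a\<bar> - 1..b + 1})"
      unfolding G_def using that by (intro integral_has_real_derivative cont) auto
    then show ?thesis using that by (subst (asm) at_within_interior) auto
  qed
  have I: "I b = G (b + p) - G b" if "b \<ge> - \<bar>a\<bar>" for b
  proof -
    have "((\<lambda>x. F (x + b)) has_integral (G (p + b) - G (0 + b))) {0..p}"
    proof (rule fundamental_theorem_of_calculus[OF \<open>0 \<le> p\<close>])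
      fix x assume "x \<in> {0..p}"
      then have "(G has_real_derivative F (x + b)) (at (x + b))" using that by (intro G) auto
      then have "((\<lambda>x. G (x + b)) has_real_derivative F (x + b)) (at x)" by (simp add: DERIV_shift)
      then show "((\<lambda>x. G (x + b)) has_vector_derivative F (x + b)) (at x within {0..p})"
        by (auto simp: has_real_derivative_iff_has_vector_derivative intro: has_vector_derivative_at_within)
    qed
    then show ?thesis by (simp add: I_def integral_unique add.commute)
  qed
  have "I a = I 0"
  proof -
    have "((\<lambda>b. G (b + p) - G b) has_real_derivative 0) (at b within {- \<bar>a\<bar>..\<bar>a\<bar>})"
      if b: "b \<in> {- \<bar>a\<bar>..\<bar>a\<bar>}" for b
    proof -
      have "(G has_real_derivative F b) (at (b + p))"
        using G[of "b + p"] b F(2)[of b] \<open>0 \<le> p\<close> by auto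
      then have "((\<lambda>b. G (b + p)) has_real_derivative F b) (at b)" by (simp add: DERIV_shift)
      moreover have "(G has_real_derivative F b) (at b)" using G b by auto
      ultimately have "((\<lambda>b. G (b + p) - G b) has_real_derivative F b - F b) (at b)"
        by (rule DERIV_diff)
      then show ?thesis by (auto intro: has_field_derivative_at_within)
    qed
    then obtain c where "\<And>b. b \<in> {- \<bar>a\<bar>..\<bar>a\<bar>} \<Longrightarrow> G (b + p) - G b = c"
      using has_field_derivative_zero_constant[of "{- \<bar>a\<bar>..\<bar>a\<bar>}" "\<lambda>b. G (b + p) - G b"] by auto
    from this[of a] this[of 0] show ?thesis using I[of a] I[of 0] by auto
  qed
  then show ?thesis by (simp add: I_def)
qed

section \<open>The action of units and integers\<close>

lemma open_Collect_all_finite: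
  fixes P :: "'i::finite \<Rightarrow> 'a::topological_space \<Rightarrow> bool"
  assumes "\<And>i. open {x. P i x}"
  shows "open {x. \<forall>i. P i x}"
  using assms by (simp add: Collect_all_eq open_INT)

locale ot_action =
  fixes \<sigma> :: "'s::finite + 't::finite \<Rightarrow> 'k::field_char_0 \<Rightarrow> complex" and U :: "'k set"
  assumes labelling: "embedding_labelling \<sigma>" and ot: "oeljeklaus_toma \<sigma> U"
begin

abbreviation M :: "(complex ^ ('s + 't)) set" where "M \<equiv> ot_domain"

abbreviation \<Gamma> :: "('k \<times> 'k) set" where "\<Gamma> \<equiv> U \<times> ring_of_integers"

definition \<rho> :: "'s \<Rightarrow> 'k \<Rightarrow> real" where "\<rho> i u = Re (\<sigma> (Inl i) u)"

definition lin :: "'k \<Rightarrow> complex ^ ('s + 't) \<Rightarrow> complex ^ ('s + 't)" where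
  "lin u v = (\<chi> i. \<sigma> i u * v $ i)"

lemma real_embedding: "\<sigma> (Inl i) \<in> real_embeddings"
  using labelling by (auto simp: embedding_labelling_def bij_betw_def)

lemma complex_embedding: "\<sigma> (Inr j) \<in> complex_embeddings"
proof -
  have "case_sum (\<lambda>j. \<sigma> (Inr j)) (\<lambda>j x. cnj (\<sigma> (Inr j) x)) (Inl j) \<in> complex_embeddings"
    using labelling unfolding embedding_labelling_def bij_betw_def by blast
  then show ?thesis by simp
qed

lemma embedding: "field_embedding (\<sigma> i)"
  using real_embedding complex_embedding
  by (cases i) (auto simp: real_embeddings_def complex_embeddings_def)

lemmas \<sigma>_simps = field_embedding_ring_hom[OF embedding] field_embedding_simps[OF embedding]

lemma \<sigma>_Inl: "\<sigma> (Inl i) x = of_real (\<rho> i x)"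
  using real_embedding[of i] unfolding real_embeddings_def \<rho>_def by (auto simp: complex_is_Real_iff complex_eq_iff)

lemma embeddings_eq: "field_embeddings = real_embeddings \<union> (complex_embeddings :: ('k \<Rightarrow> complex) set)"
  by (auto simp: real_embeddings_def complex_embeddings_def)

lemma finite_embeddings:
  "finite (real_embeddings :: ('k \<Rightarrow> complex) set)" "finite (complex_embeddings :: ('k \<Rightarrow> complex) set)"
  using labelling unfolding embedding_labelling_def by (meson bij_betw_finite finite_UNIV finite)+

lemma subgroup: "totally_positive_unit_subgroup U"
  and properly_discontinuous: "ot_properly_discontinuous \<sigma> U"
  and compact_quotient: "compact_space (ot_space \<sigma> U)"
  using ot by (auto simp: oeljeklaus_toma_def)

lemma U_group:
  "1 \<in> U" "u \<in> U \<Longrightarrow> v \<in> U \<Longrightarrow> u * v \<in> U" "u \<in> U \<Longrightarrow> inverse u \<in> U"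
  using subgroup by (auto simp: totally_positive_unit_subgroup_def)

lemma U_tpu: "u \<in> U \<Longrightarrow> u \<in> totally_positive_units"
  using subgroup by (auto simp: totally_positive_unit_subgroup_def)

lemma U_unit: "u \<in> U \<Longrightarrow> u \<in> integer_units"
  using U_tpu by (auto simp: totally_positive_units_def)

lemma U_nonzero: "u \<in> U \<Longrightarrow> u \<noteq> 0"
  using U_unit[of u] by (auto simp: integer_units_def)

lemma \<rho>_pos: "u \<in> U \<Longrightarrow> 0 < \<rho> i u"
  using U_tpu[of u] real_embedding[of i] by (auto simp: totally_positive_units_def \<rho>_def)

lemma ring_of_integers_closed:
  "(0::'k) \<in> ring_of_integers" "(1::'k) \<in> ring_of_integers"
  "a \<in> ring_of_integers \<Longrightarrow> b \<in> ring_of_integers \<Longrightarrow> a + b \<in> (ring_of_integers :: 'k set)"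
  "a \<in> ring_of_integers \<Longrightarrow> b \<in> ring_of_integers \<Longrightarrow> a * b \<in> (ring_of_integers :: 'k set)"
  "a \<in> ring_of_integers \<Longrightarrow> - a \<in> (ring_of_integers :: 'k set)"
  by (auto simp: ring_of_integers_def intro: algebraic_int_plus algebraic_int_times)

lemma U_integer: "u \<in> U \<Longrightarrow> u \<in> ring_of_integers"
  using U_unit by (auto simp: integer_units_def)

lemma act_one: "ot_act \<sigma> (1, 0) x = x"
  by (simp add: ot_act_def \<sigma>_simps(1,4) Finite_Cartesian_Product.vec_eq_iff)

lemma act_act: "ot_act \<sigma> (u, a) (ot_act \<sigma> (v, b) x) = ot_act \<sigma> (u * v, a + u * b) x"
  by (rule ot_act_compose) (rule embedding)

lemma act_inverse:
  assumes "u \<in> U" "a \<in> ring_of_integers"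
  shows "(inverse u, - (inverse u * a)) \<in> \<Gamma>"
    "ot_act \<sigma> (inverse u, - (inverse u * a)) (ot_act \<sigma> (u, a) x) = x"
proof -
  show "(inverse u, - (inverse u * a)) \<in> \<Gamma>"
    using assms U_group(3) U_integer ring_of_integers_closed(4,5) by simp
  show "ot_act \<sigma> (inverse u, - (inverse u * a)) (ot_act \<sigma> (u, a) x) = x"
    using U_nonzero[OF assms(1)] by (simp add: act_act act_one)
qed

lemma act_domain: "u \<in> U \<Longrightarrow> x \<in> M \<Longrightarrow> ot_act \<sigma> (u, a) x \<in> M"
  by (rule ot_act_domain[OF labelling]) (auto intro: U_tpu)

lemma Im_act: "Im (ot_act \<sigma> (u, a) x $ Inl i) = \<rho> i u * Im (x $ Inl i)"
  by (simp add: ot_act_def \<sigma>_Inl)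

lemma act_add: "ot_act \<sigma> (u, a) (x + v) = ot_act \<sigma> (u, a) x + lin u v"
  by (simp add: ot_act_def lin_def Finite_Cartesian_Product.vec_eq_iff algebra_simps)

lemma linear_lin: "linear (lin u)"
  by (intro linearI) (simp_all add: lin_def Finite_Cartesian_Product.vec_eq_iff algebra_simps)

lemma act_has_derivative: "(ot_act \<sigma> (u, a) has_derivative lin u) (at x within S)"
proof -
  have "bounded_linear (lin u)" using linear_lin by (simp add: linear_conv_bounded_linear)
  then have "((\<lambda>x. ot_act \<sigma> (u, a) 0 + lin u x) has_derivative lin u) (at x within S)"
    by (auto intro!: derivative_eq_intros bounded_linear_imp_has_derivative)
  moreover have "(\<lambda>x. ot_act \<sigma> (u, a) 0 + lin u x) = ot_act \<sigma> (u, a)"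
    by (rule ext) (simp only: act_add[symmetric] add_0_left)
  ultimately show ?thesis by simp
qed

lemma continuous_on_act: "continuous_on S (ot_act \<sigma> (u, a))"
  using act_has_derivative by (auto intro!: has_derivative_continuous_on)

lemma orbit_self: "x \<in> ot_orbit \<sigma> U x"
  unfolding ot_orbit_def using U_group(1) ring_of_integers_closed(1) act_one[of x]
  by (metis (no_types, lifting) SigmaI image_iff)

lemma orbit_act:
  assumes "u \<in> U" "a \<in> ring_of_integers"
  shows "ot_orbit \<sigma> U (ot_act \<sigma> (u, a) x) = ot_orbit \<sigma> U x"
proof -
  have sub: "ot_orbit \<sigma> U (ot_act \<sigma> (u, a) x) \<subseteq> ot_orbit \<sigma> U x"
    if "u \<in> U" "a \<in> ring_of_integers" for u a x
  proof
    fix y assume "y \<in> ot_orbit \<sigma> U (ot_act \<sigma> (u, a) x)"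
    then obtain v b where "v \<in> U" "b \<in> ring_of_integers" "y = ot_act \<sigma> (v, b) (ot_act \<sigma> (u, a) x)"
      by (auto simp: ot_orbit_def)
    moreover from this that have "(v * u, b + v * a) \<in> \<Gamma>"
      using U_group(2) ring_of_integers_closed(3,4) U_integer by simp
    ultimately show "y \<in> ot_orbit \<sigma> U x"
      unfolding ot_orbit_def act_act by blast
  qed
  show ?thesis
    using sub[OF assms, of x] sub[of "inverse u" "- (inverse u * a)" "ot_act \<sigma> (u, a) x"] act_inverse[OF assms]
    by auto
qed

lemma orbit_eqE:
  assumes "ot_orbit \<sigma> U x = ot_orbit \<sigma> U y"
  obtains u a where "u \<in> U" "a \<in> ring_of_integers" "y = ot_act \<sigma> (u, a) x"
proof -
  have "y \<in> ot_orbit \<sigma> U x" using orbit_self[of y] assms by simp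
  then show thesis using that unfolding ot_orbit_def by blast
qed

section \<open>The domain, its compact pieces and the quotient\<close>

lemma M_iff: "x \<in> M \<longleftrightarrow> (\<forall>i. 0 < Im (x $ Inl i))"
  by (simp add: ot_domain_def)

lemma open_M: "open M"
  unfolding ot_domain_def by (intro open_Collect_all_finite open_Collect_less continuous_intros)

lemma convex_M: "convex M"
  unfolding convex_def M_iff
proof (intro ballI allI impI)
  fix x y :: "complex ^ ('s + 't)" and a b :: real and i
  assume xy: "x \<in> M" "y \<in> M" and ab: "0 \<le> a" "0 \<le> b" "a + b = 1"
  have "0 < Im (x $ Inl i)" "0 < Im (y $ Inl i)" using xy by (auto simp: M_iff)
  then show "0 < Im ((a *\<^sub>R x + b *\<^sub>R y) $ Inl i)"
    using ab by (cases "a = 0") (auto intro: add_pos_nonneg)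
qed

definition slab :: "real \<Rightarrow> real \<Rightarrow> (complex ^ ('s + 't)) set" where
  "slab r m = {x. norm x \<le> r \<and> (\<forall>i. m \<le> Im (x $ Inl i))}"

lemma compact_slab: "compact (slab r m)"
proof -
  have "slab r m = cball 0 r \<inter> {x. \<forall>i. m \<le> Im (x $ Inl i)}" by (auto simp: slab_def)
  moreover have "closed {x :: complex ^ ('s + 't). \<forall>i. m \<le> Im (x $ Inl i)}"
    by (intro closed_Collect_all closed_Collect_le continuous_intros)
  ultimately show ?thesis by (simp add: compact_Int_closed)
qed

lemma slab_subset_M: "0 < m \<Longrightarrow> slab r m \<subseteq> M"
  by (fastforce simp: slab_def M_iff intro: less_le_trans)

text \<open>The complex coordinates are 0, so a unit moves this point only through its values at the
  real places.\<close>

definition base :: "complex ^ ('s + 't)" where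
  "base = (\<chi> i. case i of Inl _ \<Rightarrow> \<i> | Inr _ \<Rightarrow> 0)"

lemma base_simps [simp]: "base $ Inl i = \<i>" "base $ Inr j = 0"
  by (simp_all add: base_def)

lemma free:
  assumes "u \<in> U" "x \<in> M" "ot_act \<sigma> (u, a) x = x"
  shows "u = 1" "a = 0"
proof -
  obtain i :: 's where True by simp
  have "\<rho> i u * Im (x $ Inl i) = Im (x $ Inl i)"
    using Im_act[of u a x i] assms(3) by simp
  then have "\<rho> i u = 1" using assms(2) by (simp add: M_iff) (metis less_irrefl)
  then have "\<sigma> (Inl i) u = \<sigma> (Inl i) 1" by (simp add: \<sigma>_Inl \<sigma>_simps(1)[of "Inl i", unfolded \<sigma>_Inl])
  then show u: "u = 1" using \<sigma>_simps(13) by blast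
  have "\<sigma> (Inl i) u * x $ Inl i + \<sigma> (Inl i) a = x $ Inl i"
    using arg_cong[OF assms(3), of "\<lambda>z. z $ Inl i"] by (simp add: ot_act_def)
  then have "\<sigma> (Inl i) a = 0" using u \<sigma>_simps(1) by simp
  then show "a = 0" using \<sigma>_simps(11) by blast
qed

text \<open>By proper discontinuity only finitely many group elements bring a small closed ball back
  to itself. Apart from the identity none of them fixes \<open>x\<close>, so each is excluded by
  shrinking the neighbourhood.\<close>

lemma locally_injective:
  assumes "x \<in> M"
  obtains V where "open V" "x \<in> V" "V \<subseteq> M" "inj_on (ot_orbit \<sigma> U) V"
proof -
  obtain e where e: "e > 0" "cball x e \<subseteq> M"
    using open_M assms open_contains_cball by blast
  define F where "F = {\<gamma> \<in> \<Gamma>. ot_act \<sigma> \<gamma> ` cball x e \<inter> cball x e \<noteq> {}}"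
  have F: "finite F"
    using properly_discontinuous e(2) unfolding ot_properly_discontinuous_def F_def by simp
  have "\<exists>W. open W \<and> x \<in> W \<and> (\<forall>y\<in>W. ot_act \<sigma> \<gamma> y \<notin> W)" if \<gamma>: "\<gamma> \<in> F - {(1, 0)}" for \<gamma>
  proof -
    obtain u a where ua: "\<gamma> = (u, a)" "u \<in> U" using \<gamma> by (auto simp: F_def)
    have "ot_act \<sigma> \<gamma> x \<noteq> x" using free[OF ua(2) assms, of a] \<gamma> ua(1) by auto
    then obtain A B where AB: "open A" "open B" "ot_act \<sigma> \<gamma> x \<in> A" "x \<in> B" "A \<inter> B = {}"
      by (meson hausdorff)
    have "open (ot_act \<sigma> \<gamma> -` A)"
      using continuous_on_act[of UNIV u a] AB(1) unfolding ua(1) by (simp add: open_vimage)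
    then show ?thesis using AB by (intro exI[of _ "B \<inter> ot_act \<sigma> \<gamma> -` A"]) auto
  qed
  then obtain W where W: "\<And>\<gamma>. \<gamma> \<in> F - {(1, 0)} \<Longrightarrow> open (W \<gamma>) \<and> x \<in> W \<gamma> \<and> (\<forall>y\<in>W \<gamma>. ot_act \<sigma> \<gamma> y \<notin> W \<gamma>)"
    by metis
  define V where "V = ball x e \<inter> (\<Inter>\<gamma>\<in>F - {(1, 0)}. W \<gamma>)"
  have "open V" unfolding V_def using F W by (intro open_Int open_ball open_INT) auto
  moreover have "x \<in> V" using e W by (auto simp: V_def)
  moreover have "V \<subseteq> M" using e by (auto simp: V_def)
  moreover have "inj_on (ot_orbit \<sigma> U) V"
  proof (rule inj_onI, rule ccontr)
    fix y z assume yz: "y \<in> V" "z \<in> V" "ot_orbit \<sigma> U y = ot_orbit \<sigma> U z" "y \<noteq> z"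
    obtain u a where ua: "u \<in> U" "a \<in> ring_of_integers" "z = ot_act \<sigma> (u, a) y"
      using yz(3) by (rule orbit_eqE)
    have "z \<in> ot_act \<sigma> (u, a) ` cball x e \<inter> cball x e"
      using yz(1,2) ua(3) by (auto simp: V_def)
    then have "(u, a) \<in> F" using ua(1,2) by (auto simp: F_def)
    moreover have "(u, a) \<noteq> (1, 0)" using yz(4) ua(3) act_one by auto
    ultimately have "(u, a) \<in> F - {(1, 0)}" by simp
    then have "ot_act \<sigma> (u, a) y \<notin> W (u, a)" "z \<in> W (u, a)" using W yz(1,2) by (auto simp: V_def)
    with ua(3) show False by simp
  qed
  ultimately show thesis by (rule that)
qed

text \<open>The domain is an increasing union of open sets contained in slabs. Their images in the
  quotient are open, so by compactness one of them is everything.\<close>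

lemma fundamental_slab:
  "\<exists>r m. 0 < m \<and> (\<forall>x\<in>M. \<exists>u\<in>U. \<exists>a\<in>ring_of_integers. \<exists>c\<in>slab r m. x = ot_act \<sigma> (u, a) c)"
proof -
  define K where "K = (\<lambda>n::nat. {x :: complex ^ ('s + 't). norm x < real n + 1 \<and> (\<forall>i. 1 / (real n + 1) < Im (x $ Inl i))})"
  have oK: "open (K n)" for n
  proof -
    have "open (ball 0 (real n + 1) \<inter> {x :: complex ^ ('s + 't). \<forall>i. 1 / (real n + 1) < Im (x $ Inl i)})"
      by (intro open_Int open_ball open_Collect_all_finite open_Collect_less continuous_intros) simp
    also have "ball 0 (real n + 1) \<inter> {x. \<forall>i. 1 / (real n + 1) < Im (x $ Inl i)} = K n"
      unfolding K_def ball_def dist_0_norm by blast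
    finally show ?thesis .
  qed
  have KM: "K n \<subseteq> M" for n
  proof
    fix x assume "x \<in> K n"
    then have "1 / (real n + 1) < Im (x $ Inl i)" for i unfolding K_def by blast
    moreover have "0 < 1 / (real n + 1)" by simp
    ultimately show "x \<in> M" unfolding M_iff by (meson less_trans)
  qed
  have mono: "K n \<subseteq> K n'" if "n \<le> n'" for n n'
  proof -
    have "1 / (real n' + 1) \<le> 1 / (real n + 1)" using that by (intro divide_left_mono) auto
    then show ?thesis using that unfolding K_def by (auto intro: order_le_less_trans less_le_trans)
  qed
  have cover: "\<exists>n. x \<in> K n" if "x \<in> M" for x
  proof -
    have "\<forall>\<^sub>F n in sequentially. norm x < real n"
      using filterlim_real_sequentially by (simp add: filterlim_at_top_dense)
    moreover have "\<forall>\<^sub>F n in sequentially. \<forall>i. 1 / (real n + 1) < Im (x $ Inl i)"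
    proof (rule eventually_all_finite)
      fix i
      have "(\<lambda>n. 1 / (real n + 1)) \<longlonglongrightarrow> 0" 
        using LIMSEQ_inverse_real_of_nat by (simp add: inverse_eq_divide add.commute)
      then show "\<forall>\<^sub>F n in sequentially. 1 / (real n + 1) < Im (x $ Inl i)"
        using that by (intro order_tendstoD) (auto simp: M_iff)
    qed
    ultimately have "\<forall>\<^sub>F n in sequentially. x \<in> K n" by eventually_elim (simp add: K_def)
    then show ?thesis by (auto simp: eventually_sequentially)
  qed
  let ?q = "ot_orbit \<sigma> U"
  have top: "topspace (ot_space \<sigma> U) = ?q ` M"
    by (simp add: ot_space_def topspace_quotient_topology)
  have "openin (ot_space \<sigma> U) (?q ` K n)" for n
  proof -
    have "{x \<in> M. ?q x \<in> ?q ` K n} = M \<inter> (\<Union>\<gamma>\<in>\<Gamma>. ot_act \<sigma> \<gamma> -` K n)"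
    proof (intro equalityI subsetI)
      fix x assume "x \<in> {x \<in> M. ?q x \<in> ?q ` K n}"
      then obtain y where "x \<in> M" "y \<in> K n" "?q x = ?q y" by auto
      then show "x \<in> M \<inter> (\<Union>\<gamma>\<in>\<Gamma>. ot_act \<sigma> \<gamma> -` K n)" by (auto elim!: orbit_eqE)
    next
      fix x assume "x \<in> M \<inter> (\<Union>\<gamma>\<in>\<Gamma>. ot_act \<sigma> \<gamma> -` K n)"
      then obtain u a where "x \<in> M" "u \<in> U" "a \<in> ring_of_integers" "ot_act \<sigma> (u, a) x \<in> K n" by auto
      then show "x \<in> {x \<in> M. ?q x \<in> ?q ` K n}"
        using orbit_act[of u a x] by (auto intro!: image_eqI[of _ _ "ot_act \<sigma> (u, a) x"])
    qed
    moreover have "open (ot_act \<sigma> \<gamma> -` K n)" for \<gamma>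
      using continuous_on_act[of UNIV "fst \<gamma>" "snd \<gamma>"] oK[of n] by (simp add: open_vimage)
    then have "open (\<Union>\<gamma>\<in>\<Gamma>. ot_act \<sigma> \<gamma> -` K n)" by blast
    then have "openin (top_of_set M) (M \<inter> (\<Union>\<gamma>\<in>\<Gamma>. ot_act \<sigma> \<gamma> -` K n))"
      by (rule openin_open_Int)
    ultimately have "openin (top_of_set M) {x \<in> M. ?q x \<in> ?q ` K n}" by simp
    then show ?thesis
      unfolding ot_space_def openin_quotient_topology topspace_euclidean_subtopology
      by (intro conjI image_mono KM)
  qed
  then have opens: "\<forall>W\<in>range (\<lambda>n. ?q ` K n). openin (ot_space \<sigma> U) W" by simp
  have "(\<Union>n. K n) = M"
  proof
    show "(\<Union>n. K n) \<subseteq> M" using KM by (rule UN_least)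
    show "M \<subseteq> (\<Union>n. K n)" using cover by (intro subsetI) simp
  qed
  then have "\<Union> (range (\<lambda>n. ?q ` K n)) = topspace (ot_space \<sigma> U)"
    unfolding top by (simp flip: image_UN)
  with opens obtain \<F> where \<F>: "finite \<F>" "\<F> \<subseteq> range (\<lambda>n. ?q ` K n)" "\<Union>\<F> = ?q ` M"
    using compact_quotient[unfolded compact_space, rule_format, of "range (\<lambda>n. ?q ` K n)"] unfolding top by auto
  obtain I where I: "finite I" "\<F> = (\<lambda>n. ?q ` K n) ` I"
    using finite_subset_image[OF \<F>(1,2)] by blast
  define N where "N = Max (insert 0 I)"
  have "\<exists>u\<in>U. \<exists>a\<in>ring_of_integers. \<exists>c\<in>slab (real N + 1) (1 / (real N + 1)). x = ot_act \<sigma> (u, a) c"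
    if "x \<in> M" for x
  proof -
    have "?q x \<in> \<Union>\<F>" using \<F>(3) that by simp
    then obtain n c where n: "n \<in> I" "c \<in> K n" "?q x = ?q c" using I(2) by auto
    have "n \<le> N" unfolding N_def using I(1) n(1) by (intro Max_ge) auto
    then have "c \<in> K N" using mono n(2) by blast
    then have "c \<in> slab (real N + 1) (1 / (real N + 1))"
      by (auto simp: K_def slab_def intro: less_imp_le)
    moreover obtain u a where "u \<in> U" "a \<in> ring_of_integers" "x = ot_act \<sigma> (u, a) c"
      using n(3)[symmetric] by (rule orbit_eqE)
    ultimately show ?thesis by blast
  qed
  then show ?thesis by (intro exI[of _ "real N + 1"] exI[of _ "1 / (real N + 1)"]) auto
qed

lemma finite_bounded_units:
  assumes "0 < a"
  shows "finite {u \<in> U. \<forall>i. a \<le> \<rho> i u \<and> \<rho> i u \<le> b}"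
proof -
  \<comment> \<open>Large enough to contain \<open>base\<close>, with norm \<open>norm base\<close>
    and imaginary parts 1, as well as its image under every unit in question.\<close>
  define C where "C = slab (max 1 b * norm base) (min 1 a)"
  have "compact C" "C \<subseteq> M" unfolding C_def using assms by (auto intro!: compact_slab slab_subset_M)
  then have fin: "finite {\<gamma> \<in> \<Gamma>. ot_act \<sigma> \<gamma> ` C \<inter> C \<noteq> {}}"
    using properly_discontinuous unfolding ot_properly_discontinuous_def by blast
  have "(\<lambda>u. (u, 0)) ` {u \<in> U. \<forall>i. a \<le> \<rho> i u \<and> \<rho> i u \<le> b} \<subseteq> {\<gamma> \<in> \<Gamma>. ot_act \<sigma> \<gamma> ` C \<inter> C \<noteq> {}}"
  proof safe
    fix u assume u: "u \<in> U" "\<forall>i. a \<le> \<rho> i u \<and> \<rho> i u \<le> b"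
      and empty: "ot_act \<sigma> (u, 0) ` C \<inter> C = {}"
    have "1 * norm base \<le> max 1 b * norm base" by (intro mult_right_mono) auto
    then have "base \<in> C" by (simp add: C_def slab_def)
    moreover have "ot_act \<sigma> (u, 0) base \<in> C"
    proof -
      have "norm (ot_act \<sigma> (u, 0) base) \<le> norm (max 1 b *\<^sub>R base)"
      proof (rule norm_le_componentwise_cart)
        fix i show "norm (ot_act \<sigma> (u, 0) base $ i) \<le> norm ((max 1 b *\<^sub>R base) $ i)"
          using u(2) \<rho>_pos[OF u(1)] \<sigma>_simps(4)
          by (cases i) (auto simp: ot_act_def \<sigma>_Inl norm_mult abs_of_pos le_max_iff_disj)
      qed
      moreover have "min 1 a \<le> Im (ot_act \<sigma> (u, 0) base $ Inl i)" for i
        using u(2) by (simp add: Im_act min_le_iff_disj)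
      ultimately show ?thesis by (simp add: C_def slab_def)
    qed
    ultimately have "ot_act \<sigma> (u, 0) base \<in> ot_act \<sigma> (u, 0) ` C \<inter> C" by blast
    with empty show False by blast
  qed (simp add: ring_of_integers_closed)
  then have "finite ((\<lambda>u. (u, 0::'k)) ` {u \<in> U. \<forall>i. a \<le> \<rho> i u \<and> \<rho> i u \<le> b})"
    using fin by (rule finite_subset)
  then show ?thesis by (rule finite_imageD) (auto intro: inj_onI)
qed

text \<open>
  This replaces the fact that the integers form a lattice in \<open>\<real>\<^sup>s \<times> \<complex>\<^sup>t\<close>: only finitely many
  units are needed to move the strip to the fundamental slab.
\<close>

lemma strip_covered_by_translates:
  assumes "0 < p"
  shows "\<exists>C. compact C \<and> C \<subseteq> M \<and> (\<forall>x. (\<forall>i. p \<le> Im (x $ Inl i) \<and> Im (x $ Inl i) \<le> q) \<longrightarrow>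
    (\<exists>a\<in>ring_of_integers. \<exists>c\<in>C. x = ot_act \<sigma> (1, a) c))"
proof -
  obtain r m where rm: "0 < m" "\<forall>x\<in>M. \<exists>u\<in>U. \<exists>a\<in>ring_of_integers. \<exists>c\<in>slab r m. x = ot_act \<sigma> (u, a) c"
    using fundamental_slab by blast
  \<comment> \<open>A unit that carries a slab point, with imaginary parts between \<open>m\<close>
    and \<open>max 1 r\<close>, into the strip has its real values in this range. The maximum
    ensures a positive denominator.\<close>
  define F where "F = {u \<in> U. \<forall>i. p / max 1 r \<le> \<rho> i u \<and> \<rho> i u \<le> q / m}"
  define C where "C = (\<Union>u\<in>F. ot_act \<sigma> (u, 0) ` slab r m)"
  have "finite F" unfolding F_def using assms by (intro finite_bounded_units) simp
  then have "compact C"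
    unfolding C_def by (intro compact_UN compact_continuous_image continuous_on_act compact_slab)
  moreover have "C \<subseteq> M"
    using slab_subset_M[OF rm(1)] by (auto simp: C_def F_def intro!: act_domain)
  moreover have "\<exists>a\<in>ring_of_integers. \<exists>c\<in>C. x = ot_act \<sigma> (1, a) c"
    if x: "\<forall>i. p \<le> Im (x $ Inl i) \<and> Im (x $ Inl i) \<le> q" for x
  proof -
    have "x \<in> M" unfolding M_iff using x assms less_le_trans by blast
    with rm(2) obtain u a c where uac: "u \<in> U" "a \<in> ring_of_integers" "c \<in> slab r m" "x = ot_act \<sigma> (u, a) c"
      by blast
    have "p / max 1 r \<le> \<rho> i u \<and> \<rho> i u \<le> q / m" for i
    proof -
      have "Im (c $ Inl i) \<le> norm c"
        using abs_Im_le_cmod[of "c $ Inl i"] Finite_Cartesian_Product.norm_nth_le[of c "Inl i"] by linarith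
      then have c: "m \<le> Im (c $ Inl i)" "Im (c $ Inl i) \<le> max 1 r"
        using uac(3) by (auto simp: slab_def)
      have eq: "Im (x $ Inl i) = \<rho> i u * Im (c $ Inl i)" using uac(4) by (simp add: Im_act)
      have "p \<le> \<rho> i u * max 1 r"
        using x[rule_format, of i] eq mult_left_mono[OF c(2), of "\<rho> i u"] \<rho>_pos[OF uac(1), of i] by linarith
      moreover have "\<rho> i u * m \<le> q"
        using x[rule_format, of i] eq mult_left_mono[OF c(1), of "\<rho> i u"] \<rho>_pos[OF uac(1), of i] by linarith
      ultimately show ?thesis using rm(1) by (simp add: pos_divide_le_eq pos_le_divide_eq)
    qed
    then have "u \<in> F" using uac(1) by (simp add: F_def)
    then have "ot_act \<sigma> (u, 0) c \<in> C" using uac(3) by (auto simp: C_def)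
    moreover have "x = ot_act \<sigma> (1, a) (ot_act \<sigma> (u, 0) c)" using uac(4) by (simp add: act_act)
    ultimately show ?thesis using uac(2) by blast
  qed
  ultimately show ?thesis by blast
qed

text \<open>
  For a linear relation between the logarithms, \<open>x \<mapsto> (\<Sum>i. c i * ln (Im x\<^sub>i))\<close> descends to
  the compact quotient, although it is unbounded unless \<open>c = 0\<close>.
\<close>

lemma log_units_no_relation:
  assumes "\<And>u. u \<in> U \<Longrightarrow> (\<Sum>i\<in>UNIV. c i * ln (\<rho> i u)) = 0"
  shows "c i0 = 0"
proof (rule ccontr)
  assume "c i0 \<noteq> 0"
  obtain r m where rm: "0 < m" "\<forall>x\<in>M. \<exists>u\<in>U. \<exists>a\<in>ring_of_integers. \<exists>c\<in>slab r m. x = ot_act \<sigma> (u, a) c"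
    using fundamental_slab by blast
  define F :: "complex ^ ('s + 't) \<Rightarrow> real" where "F = (\<lambda>x. \<Sum>i\<in>UNIV. c i * ln (Im (x $ Inl i)))"
  have F_act: "F (ot_act \<sigma> (u, a) x) = F x" if "u \<in> U" "x \<in> M" for u a x
  proof -
    have "F (ot_act \<sigma> (u, a) x) = (\<Sum>i\<in>UNIV. c i * ln (\<rho> i u) + c i * ln (Im (x $ Inl i)))"
      unfolding F_def Im_act
    proof (rule sum.cong)
      fix i
      have "0 < \<rho> i u" "0 < Im (x $ Inl i)" using that \<rho>_pos by (auto simp: M_iff)
      then show "c i * ln (\<rho> i u * Im (x $ Inl i)) = c i * ln (\<rho> i u) + c i * ln (Im (x $ Inl i))"
        by (simp add: ln_mult distrib_left)
    qed simp
    also have "\<dots> = F x" using assms[OF that(1)] by (simp add: sum.distrib F_def)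
    finally show ?thesis .
  qed
  have "continuous_on M F"
    unfolding F_def by (intro continuous_intros) (simp add: M_iff less_imp_neq[symmetric])
  then have "compact (F ` slab r m)"
    using slab_subset_M[OF rm(1)] compact_slab by (meson compact_continuous_image continuous_on_subset)
  then obtain b where b: "\<forall>x\<in>slab r m. \<bar>F x\<bar> \<le> b"
    by (auto dest!: compact_imp_bounded simp: bounded_iff)
  have bM: "\<bar>F x\<bar> \<le> b" if "x \<in> M" for x
  proof -
    from rm(2) that obtain u a c where "u \<in> U" "c \<in> slab r m" "x = ot_act \<sigma> (u, a) c" by blast
    moreover from this have "c \<in> M" using slab_subset_M[OF rm(1)] by blast
    ultimately show ?thesis using F_act[of u c a] b by simp
  qed
  \<comment> \<open>The point below has imaginary part \<open>exp T\<close> at \<open>i0\<close> and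
    1 at the other real places, where the logarithm vanishes; so \<open>F\<close> takes the value
    \<open>b + 1\<close> there.\<close>
  define T where "T = (b + 1) / c i0"
  define x :: "complex ^ ('s + 't)" where
    "x = (\<chi> i. if i = Inl i0 then \<i> * of_real (exp T) else base $ i)"
  have "x \<in> M" by (auto simp: x_def M_iff)
  have "F x = (\<Sum>i\<in>UNIV. if i = i0 then c i0 * T else 0)"
    unfolding F_def by (intro sum.cong) (auto simp: x_def)
  also have "\<dots> = b + 1" using \<open>c i0 \<noteq> 0\<close> by (simp add: T_def)
  finally show False using bM[OF \<open>x \<in> M\<close>] by simp
qed

text \<open>If 1 were the only unit in \<open>U\<close>, all logarithms would vanish and satisfy the
  relation with all coefficients 1.\<close>

lemma nontrivial_unit: obtains u where "u \<in> U" "u \<noteq> 1"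
proof -
  have "\<exists>u\<in>U. u \<noteq> 1"
  proof (rule ccontr)
    assume "\<not> (\<exists>u\<in>U. u \<noteq> 1)"
    then have "(\<Sum>i\<in>UNIV. (1::real) * ln (\<rho> i u)) = 0" if "u \<in> U" for u
      using that \<sigma>_simps(1) by (auto simp: \<rho>_def)
    from log_units_no_relation[of "\<lambda>_. 1", OF this] show False by simp
  qed
  then show thesis using that by blast
qed

end

section \<open>Lifting the metric to the universal cover\<close>

text \<open>Both functions have the same derivatives at \<open>x\<close>, so the choice operator
  selects the same one.\<close>

lemma frechet_derivative_cong_open:
  assumes "open V" "x \<in> V" "\<And>y. y \<in> V \<Longrightarrow> f y = g y"
  shows "frechet_derivative f (at x) = frechet_derivative g (at x)"
proof -
  have "(f has_derivative D) (at x) \<longleftrightarrow> (g has_derivative D) (at x)" for D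
    using assms has_derivative_transform_within_open[of f D x UNIV V g]
      has_derivative_transform_within_open[of g D x UNIV V f] by auto
  then show ?thesis by (simp add: frechet_derivative_def)
qed

text \<open>For tensor fields glued from charts: near each point they agree with one local
  expression, but with different ones at different points.\<close>

lemma C_on_1_local:
  assumes "\<And>x. x \<in> S \<Longrightarrow> \<exists>V g. open V \<and> x \<in> V \<and> C_on 1 V g \<and> (\<forall>y\<in>V. f y = g y)"
  shows "C_on 1 S f"
proof -
  have "f differentiable (at x) \<and> isCont (\<lambda>y. frechet_derivative f (at y) v) x" if x: "x \<in> S" for x v
  proof -
    obtain V g where V: "open V" "x \<in> V" "C_on 1 V g" "\<forall>y\<in>V. f y = g y" using assms[OF x] by blast
    have "(g has_derivative frechet_derivative g (at x)) (at x)"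
      using C_on_1_has_derivative[OF V(3,2)] .
    then have "(f has_derivative frechet_derivative g (at x)) (at x)"
      using has_derivative_transform_within_open[of g _ x UNIV V f] V by auto
    then have "f differentiable (at x)" by (auto simp: differentiable_def)
    moreover have "isCont (\<lambda>y. frechet_derivative g (at y) v) x"
      using C_on_1_continuous_derivative[OF V(3), of v] V(1,2) by (simp add: continuous_on_eq_continuous_at)
    moreover have "\<forall>\<^sub>F y in nhds x. frechet_derivative f (at y) v = frechet_derivative g (at y) v"
      unfolding eventually_nhds
      using frechet_derivative_cong_open[OF V(1), of _ f g] V(1,2,4) by (intro exI[of _ V]) auto
    then have "isCont (\<lambda>y. frechet_derivative f (at y) v) x \<longleftrightarrow> isCont (\<lambda>y. frechet_derivative g (at y) v) x"
      by (rule isCont_cong)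
    ultimately show ?thesis by simp
  qed
  then show ?thesis by (simp add: continuous_at_imp_continuous_on)
qed

context ot_action
begin

section \<open>Charts of the quotient and invariant tensor fields\<close>

definition inj_nbhd :: "(complex ^ ('s + 't)) set \<Rightarrow> bool" where
  "inj_nbhd V \<longleftrightarrow> open V \<and> V \<subseteq> M \<and> inj_on (ot_orbit \<sigma> U) V"

definition ot_chart :: "(complex ^ ('s + 't)) set \<Rightarrow> ((complex ^ ('s + 't)) set, 's + 't) chart" where
  "ot_chart V = (ot_orbit \<sigma> U ` V, inv_into V (ot_orbit \<sigma> U))"

lemma ot_chart_in_atlas: "inj_nbhd V \<Longrightarrow> ot_chart V \<in> ot_atlas \<sigma> U"
  by (auto simp: ot_atlas_def ot_chart_def inj_nbhd_def)

lemma snd_ot_chart: "inj_nbhd V \<Longrightarrow> x \<in> V \<Longrightarrow> snd (ot_chart V) (ot_orbit \<sigma> U x) = x"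
  by (simp add: ot_chart_def inj_nbhd_def)

lemma fst_ot_chart: "x \<in> V \<Longrightarrow> ot_orbit \<sigma> U x \<in> fst (ot_chart V)"
  by (simp add: ot_chart_def)

lemma chart_image_ot_chart: "inj_nbhd V \<Longrightarrow> chart_image (ot_chart V) = V"
  by (force simp: chart_image_def ot_chart_def inj_nbhd_def)

lemma inj_nbhd_exists:
  assumes "x \<in> M"
  shows "\<exists>V. inj_nbhd V \<and> x \<in> V"
  using locally_injective[OF assms] unfolding inj_nbhd_def by metis

text \<open>The inverse of a chart is the orbit map, which is unchanged by \<open>(u, a)\<close>. So
  near \<open>x\<close> the change of charts is the action of \<open>(u, a)\<close> itself.\<close>

lemma transition_deriv_ot_chart:
  assumes V: "inj_nbhd V" "x \<in> V" and V': "inj_nbhd V'" "ot_act \<sigma> (u, a) x \<in> V'"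
    and ua: "u \<in> U" "a \<in> ring_of_integers"
  shows "transition_deriv (ot_chart V) (ot_chart V') (ot_orbit \<sigma> U x) = lin u"
proof -
  have injs: "inj_on (ot_orbit \<sigma> U) V" "inj_on (ot_orbit \<sigma> U) V'" using V V' by (auto simp: inj_nbhd_def)
  have eq: "transition (ot_chart V) (ot_chart V') y = ot_act \<sigma> (u, a) y"
    if "y \<in> V \<inter> ot_act \<sigma> (u, a) -` V'" for y
  proof -
    have y: "y \<in> V" "ot_act \<sigma> (u, a) y \<in> V'" using that by auto
    have "inj_on (inv_into V (ot_orbit \<sigma> U)) (ot_orbit \<sigma> U ` V)" by (rule inj_on_inv_into) simp
    moreover have "inv_into V (ot_orbit \<sigma> U) (ot_orbit \<sigma> U y) = y" using injs(1) y(1) by simp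
    ultimately have "inv_into (ot_orbit \<sigma> U ` V) (inv_into V (ot_orbit \<sigma> U)) y = ot_orbit \<sigma> U y"
      using y(1) by (metis imageI inv_into_f_f)
    then have "transition (ot_chart V) (ot_chart V') y = inv_into V' (ot_orbit \<sigma> U) (ot_orbit \<sigma> U (ot_act \<sigma> (u, a) y))"
      by (simp add: transition_def ot_chart_def orbit_act[OF ua])
    also have "\<dots> = ot_act \<sigma> (u, a) y" using injs(2) y(2) by simp
    finally show ?thesis .
  qed
  have "open (V \<inter> ot_act \<sigma> (u, a) -` V')"
    using V V' continuous_on_act[of UNIV u a] by (auto simp: inj_nbhd_def intro: open_vimage)
  moreover have "x \<in> V \<inter> ot_act \<sigma> (u, a) -` V'" using V V' by simp
  ultimately have "frechet_derivative (transition (ot_chart V) (ot_chart V')) (at x) = frechet_derivative (ot_act \<sigma> (u, a)) (at x)"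
    using eq by (rule frechet_derivative_cong_open)
  also have "\<dots> = lin u" using frechet_derivative_at[OF act_has_derivative[of u a x UNIV]] by simp
  finally show ?thesis using V by (simp add: transition_deriv_def snd_ot_chart)
qed

lemma lin_one: "lin 1 v = v"
  using \<sigma>_simps(1) by (simp add: lin_def Finite_Cartesian_Product.vec_eq_iff)

end

text \<open>The pullback of the metric and of its Lee form to the domain, in its global coordinates.
  Class C^1 is recorded because the argument differentiates once.\<close>

locale lifted_lck = ot_action \<sigma> U
  for \<sigma> :: "'s::finite + 't::finite \<Rightarrow> 'k::field_char_0 \<Rightarrow> complex" and U +
  fixes g :: "complex ^ ('s + 't) \<Rightarrow> complex ^ ('s + 't) \<Rightarrow> complex ^ ('s + 't) \<Rightarrow> real"
    and \<theta> :: "complex ^ ('s + 't) \<Rightarrow> complex ^ ('s + 't) \<Rightarrow> real"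
  assumes bilinear: "x \<in> ot_domain \<Longrightarrow> bilinear (g x)"
    and g_sym: "x \<in> ot_domain \<Longrightarrow> g x v w = g x w v"
    and g_pos: "x \<in> ot_domain \<Longrightarrow> v \<noteq> 0 \<Longrightarrow> 0 < g x v v"
    and g_herm: "x \<in> ot_domain \<Longrightarrow> g x (\<i> *s v) (\<i> *s w) = g x v w"
    and g_C1: "C_on 1 ot_domain (\<lambda>x. g x v w)"
    and \<theta>_linear: "x \<in> ot_domain \<Longrightarrow> linear (\<theta> x)"
    and \<theta>_C1: "C_on 1 ot_domain (\<lambda>x. \<theta> x v)"
    and \<theta>_closed: "x \<in> ot_domain \<Longrightarrow> ext_deriv1 \<theta> x v w = 0"
    and lck: "x \<in> ot_domain \<Longrightarrow> ext_deriv2 (\<lambda>x v w. g x (\<i> *s v) w) x v w z =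
      wedge12 \<theta> (\<lambda>x v w. g x (\<i> *s v) w) x v w z"
    and g_act: "u \<in> U \<Longrightarrow> a \<in> ring_of_integers \<Longrightarrow> x \<in> ot_domain \<Longrightarrow>
      g (ot_act \<sigma> (u, a) x) (lin u v) (lin u w) = g x v w"
    and \<theta>_act: "u \<in> U \<Longrightarrow> a \<in> ring_of_integers \<Longrightarrow> x \<in> ot_domain \<Longrightarrow>
      \<theta> (ot_act \<sigma> (u, a) x) (lin u v) = \<theta> x v"

context ot_action
begin

text \<open>At each point the local expression in a chosen chart is used. Compatibility under the
  changes of charts gives independence of the choice for \<open>(1, 0)\<close>, and invariance for
  general \<open>(u, a)\<close>.\<close>

lemma lck_metric_lift:
  assumes "lck_metric (ot_atlas \<sigma> U) g0"
  shows "\<exists>g \<theta>. lifted_lck \<sigma> U g \<theta>"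
proof -
  let ?A = "ot_atlas \<sigma> U"
  obtain \<theta>0 where herm: "hermitian_metric ?A g0" and \<theta>0: "closed_one_form ?A \<theta>0" and
    d\<omega>: "\<And>c x u v w. c \<in> ?A \<Longrightarrow> x \<in> chart_image c \<Longrightarrow>
      ext_deriv2 (fundamental_form g0 c) x u v w = wedge12 (\<theta>0 c) (fundamental_form g0 c) x u v w"
    using assms unfolding lck_metric_def by blast
  obtain V where V: "\<And>x. x \<in> M \<Longrightarrow> inj_nbhd (V x) \<and> x \<in> V x" using inj_nbhd_exists by metis
  define g where "g = (\<lambda>x. g0 (ot_chart (V x)) x)"
  define \<theta> where "\<theta> = (\<lambda>x. \<theta>0 (ot_chart (V x)) x)"
  have g_trans: "g0 (ot_chart W) x v w = g0 (ot_chart W') (ot_act \<sigma> (u, a) x) (lin u v) (lin u w)"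
    and \<theta>_trans: "\<theta>0 (ot_chart W) x v = \<theta>0 (ot_chart W') (ot_act \<sigma> (u, a) x) (lin u v)"
    if W: "inj_nbhd W" "x \<in> W" and W': "inj_nbhd W'" "ot_act \<sigma> (u, a) x \<in> W'"
      and ua: "u \<in> U" "a \<in> ring_of_integers" for W W' x u a v w
  proof -
    have p: "ot_orbit \<sigma> U x \<in> fst (ot_chart W) \<inter> fst (ot_chart W')"
      using fst_ot_chart[OF W(2)] fst_ot_chart[OF W'(2)] orbit_act[OF ua, of x] by simp
    have s: "snd (ot_chart W) (ot_orbit \<sigma> U x) = x"
      "snd (ot_chart W') (ot_orbit \<sigma> U x) = ot_act \<sigma> (u, a) x"
      using snd_ot_chart[OF W] snd_ot_chart[OF W'] orbit_act[OF ua, of x] by simp_all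
    note t = transition_deriv_ot_chart[OF W W' ua]
    have "g0 (ot_chart W) (snd (ot_chart W) (ot_orbit \<sigma> U x)) v w =
        g0 (ot_chart W') (snd (ot_chart W') (ot_orbit \<sigma> U x))
          (transition_deriv (ot_chart W) (ot_chart W') (ot_orbit \<sigma> U x) v)
          (transition_deriv (ot_chart W) (ot_chart W') (ot_orbit \<sigma> U x) w)"
      using herm ot_chart_in_atlas[OF W(1)] ot_chart_in_atlas[OF W'(1)] p unfolding hermitian_metric_def by blast
    then show "g0 (ot_chart W) x v w = g0 (ot_chart W') (ot_act \<sigma> (u, a) x) (lin u v) (lin u w)"
      unfolding s t .
    have "\<theta>0 (ot_chart W) (snd (ot_chart W) (ot_orbit \<sigma> U x)) v =
        \<theta>0 (ot_chart W') (snd (ot_chart W') (ot_orbit \<sigma> U x))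
          (transition_deriv (ot_chart W) (ot_chart W') (ot_orbit \<sigma> U x) v)"
      using \<theta>0 ot_chart_in_atlas[OF W(1)] ot_chart_in_atlas[OF W'(1)] p
      unfolding closed_one_form_def one_form_def by blast
    then show "\<theta>0 (ot_chart W) x v = \<theta>0 (ot_chart W') (ot_act \<sigma> (u, a) x) (lin u v)"
      unfolding s t .
  qed
  have eq: "g x v w = g0 (ot_chart W) x v w" "\<theta> x v = \<theta>0 (ot_chart W) x v"
    if W: "inj_nbhd W" "x \<in> W" for W x v w
  proof -
    have "x \<in> M" using W by (auto simp: inj_nbhd_def)
    note Vx = V[OF this, THEN conjunct1] V[OF this, THEN conjunct2]
    have "ot_act \<sigma> (1, 0) x \<in> W" using W(2) by (simp add: act_one)
    note g_trans[OF Vx W(1) this U_group(1) ring_of_integers_closed(1), of v w]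
      \<theta>_trans[OF Vx W(1) this U_group(1) ring_of_integers_closed(1), of v]
    then show "g x v w = g0 (ot_chart W) x v w" "\<theta> x v = \<theta>0 (ot_chart W) x v"
      by (simp_all add: g_def \<theta>_def act_one lin_one)
  qed
  have chart: "ot_chart (V x) \<in> ?A" "x \<in> chart_image (ot_chart (V x))"
    and open_V: "open (V x)" if "x \<in> M" for x
    using V[OF that] by (auto simp: ot_chart_in_atlas chart_image_ot_chart inj_nbhd_def)
  have eq_fun: "g x = g0 (ot_chart (V x)) x" "\<theta> x = \<theta>0 (ot_chart (V x)) x" for x
    by (simp_all add: g_def \<theta>_def)
  have fund: "frechet_derivative (\<lambda>y. g y v w) (at x) = frechet_derivative (\<lambda>y. g0 (ot_chart (V x)) y v w) (at x)"
    and frechet_\<theta>: "frechet_derivative (\<lambda>y. \<theta> y v) (at x) = frechet_derivative (\<lambda>y. \<theta>0 (ot_chart (V x)) y v) (at x)"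
    if "x \<in> M" for x v w
    using V[OF that] eq by (auto intro!: frechet_derivative_cong_open[OF open_V[OF that]])
  have "lifted_lck \<sigma> U g \<theta>"
  proof (intro lifted_lck.intro lifted_lck_axioms.intro ot_action_axioms)
    fix x assume x: "x \<in> M"
    note h = herm[unfolded hermitian_metric_def, THEN conjunct1, rule_format, OF chart[OF x]]
    show "bilinear (g x)" unfolding eq_fun using h by blast
    show "g x v w = g x w v" for v w unfolding eq_fun using h by blast
    show "0 < g x v v" if "v \<noteq> 0" for v using that unfolding eq_fun using h by blast
    show "g x (\<i> *s v) (\<i> *s w) = g x v w" for v w unfolding eq_fun using h by blast
    show "linear (\<theta> x)" unfolding eq_fun
      using \<theta>0 chart[OF x] unfolding closed_one_form_def one_form_def by blast
    show "ext_deriv1 \<theta> x u v = 0" for u v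
    proof -
      have "ext_deriv1 (\<theta>0 (ot_chart (V x))) x u v = 0"
        using \<theta>0 chart[OF x] unfolding closed_one_form_def by blast
      then show ?thesis unfolding ext_deriv1_def frechet_\<theta>[OF x] .
    qed
    show "ext_deriv2 (\<lambda>x v w. g x (\<i> *s v) w) x u v w = wedge12 \<theta> (\<lambda>x v w. g x (\<i> *s v) w) x u v w" for u v w
      using d\<omega>[OF chart[OF x], of u v w]
      unfolding ext_deriv2_def wedge12_def fundamental_form_def fund[OF x] eq_fun[of x] .
  next
    fix v w
    show "C_on 1 M (\<lambda>x. g x v w)"
    proof (rule C_on_1_local)
      fix x assume x: "x \<in> M"
      have "C_on 1 (chart_image (ot_chart (V x))) (\<lambda>y. g0 (ot_chart (V x)) y v w)"
        using herm chart(1)[OF x] unfolding hermitian_metric_def smooth_on_def by blast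
      then show "\<exists>W h. open W \<and> x \<in> W \<and> C_on 1 W h \<and> (\<forall>y\<in>W. g y v w = h y)"
        using V[OF x] open_V[OF x] eq(1) chart_image_ot_chart by metis
    qed
    show "C_on 1 M (\<lambda>x. \<theta> x v)"
    proof (rule C_on_1_local)
      fix x assume x: "x \<in> M"
      have "C_on 1 (chart_image (ot_chart (V x))) (\<lambda>y. \<theta>0 (ot_chart (V x)) y v)"
        using \<theta>0 chart(1)[OF x] unfolding closed_one_form_def one_form_def smooth_on_def by blast
      then show "\<exists>W h. open W \<and> x \<in> W \<and> C_on 1 W h \<and> (\<forall>y\<in>W. \<theta> y v = h y)"
        using V[OF x] open_V[OF x] eq(2) chart_image_ot_chart by metis
    qed
  next
    fix u a :: 'k and x v w assume ua: "u \<in> U" "a \<in> ring_of_integers" and x: "x \<in> M"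
    have "ot_act \<sigma> (u, a) x \<in> M" using ua(1) x by (rule act_domain)
    note V' = V[OF this, THEN conjunct1] V[OF this, THEN conjunct2]
    note Vx = V[OF x, THEN conjunct1] V[OF x, THEN conjunct2]
    show "g (ot_act \<sigma> (u, a) x) (lin u v) (lin u w) = g x v w"
      using g_trans[OF Vx V' ua, of v w] by (simp add: g_def)
    show "\<theta> (ot_act \<sigma> (u, a) x) (lin u v) = \<theta> x v"
      using \<theta>_trans[OF Vx V' ua, of v] by (simp add: \<theta>_def)
  qed
  then show ?thesis by blast
qed

end

section \<open>The homothety factors of the units\<close>

context ot_action
begin

text \<open>Additivity and invariance make \<open>k\<close> vanish on all integral multiples of
  \<open>u - 1\<close>, and a positive integer multiple of \<open>a\<close> is among them.\<close>

lemma unit_invariant_character_trivial: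
  fixes k :: "'k \<Rightarrow> real"
  assumes add: "\<And>a b. a \<in> ring_of_integers \<Longrightarrow> b \<in> ring_of_integers \<Longrightarrow> k (a + b) = k a + k b"
    and inv: "\<And>u a. u \<in> U \<Longrightarrow> a \<in> ring_of_integers \<Longrightarrow> k (u * a) = k a"
    and a: "a \<in> ring_of_integers"
  shows "k a = 0"
proof -
  obtain u where u: "u \<in> U" "u \<noteq> 1" using nontrivial_unit by blast
  have "u - 1 \<in> ring_of_integers"
    using ring_of_integers_closed(3)[OF U_integer[OF u(1)] ring_of_integers_closed(5)[OF ring_of_integers_closed(2)]]
    by simp
  then obtain w N where w: "algebraic_int w" "N \<noteq> 0" "(u - 1) * w = of_int N"
    using algebraic_int_dvd_of_int[of "u - 1"] u(2) by (auto simp: ring_of_integers_def)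
  \<comment> \<open>The sign is chosen so that the multiple of \<open>u - 1\<close> is a natural
    number; then additivity needs to be iterated only over naturals.\<close>
  define w' where "w' = (if N > 0 then w else - w)"
  define n where "n = nat \<bar>N\<bar>"
  have w': "w' \<in> ring_of_integers" using w(1) by (simp add: w'_def ring_of_integers_def)
  have n: "n > 0" "(u - 1) * w' = of_nat n"
    using w(2,3) by (auto simp: n_def w'_def)
  have of_nat: "of_nat m * a \<in> ring_of_integers \<and> k (of_nat m * a) = of_nat m * k a" for m
  proof (induction m)
    case 0
    have "k 0 = 0" using add[of 0 0] ring_of_integers_closed(1) by simp
    then show ?case by (simp add: ring_of_integers_closed)
  next
    case (Suc m)
    then show ?case using add[of a "of_nat m * a"] ring_of_integers_closed(3) a
      by (simp add: distrib_right)
  qed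
  have wa: "w' * a \<in> ring_of_integers" using w' a by (rule ring_of_integers_closed)
  have "u * (w' * a) = ((u - 1) * w') * a + w' * a" by (simp add: algebra_simps)
  then have "u * (w' * a) = of_nat n * a + w' * a" unfolding n(2) .
  then have "k (w' * a) = of_nat n * k a + k (w' * a)"
    using inv[OF u(1) wa] add[of "of_nat n * a" "w' * a"] of_nat[of n] wa by simp
  then show ?thesis using n(1) by simp
qed

text \<open>The strip is unbounded, but up to translation by integers it lies in a compact
  set.\<close>

lemma periodic_bounded_on_strip:
  fixes F :: "complex ^ ('s + 't) \<Rightarrow> real"
  assumes "continuous_on M F"
    and "\<forall>a\<in>ring_of_integers. \<forall>x\<in>M. F (ot_act \<sigma> (1, a) x) = F x" and "0 < p"
  shows "\<exists>D. \<forall>x. (\<forall>i. p \<le> Im (x $ Inl i) \<and> Im (x $ Inl i) \<le> q) \<longrightarrow> \<bar>F x\<bar> \<le> D"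
proof -
  obtain C where C: "compact C" "C \<subseteq> M" "\<forall>x. (\<forall>i. p \<le> Im (x $ Inl i) \<and> Im (x $ Inl i) \<le> q) \<longrightarrow>
      (\<exists>a\<in>ring_of_integers. \<exists>c\<in>C. x = ot_act \<sigma> (1, a) c)"
    using strip_covered_by_translates[OF assms(3), of q] by (elim exE conjE)
  have "compact (F ` C)"
    using compact_continuous_image[OF continuous_on_subset[OF assms(1) C(2)] C(1)] .
  then obtain D where D: "\<forall>x\<in>C. \<bar>F x\<bar> \<le> D" by (auto dest!: compact_imp_bounded simp: bounded_iff)
  have "\<bar>F x\<bar> \<le> D" if x: "\<forall>i. p \<le> Im (x $ Inl i) \<and> Im (x $ Inl i) \<le> q" for x
  proof -
    obtain a c where "a \<in> ring_of_integers" "c \<in> C" "x = ot_act \<sigma> (1, a) c"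
      using C(3) x by blast
    then show ?thesis using assms(2) D C(2) by auto
  qed
  then show ?thesis by blast
qed

end

context lifted_lck
begin

section \<open>The potential of the Lee form and the closed form \<open>\<Omega>\<close>\<close>

definition f :: "complex ^ ('s + 't) \<Rightarrow> real" where
  "f = (SOME f. \<forall>x\<in>M. (f has_derivative \<theta> x) (at x))"

lemma f_has_derivative: "x \<in> M \<Longrightarrow> (f has_derivative \<theta> x) (at x)"
  using someI_ex[OF closed_one_form_has_potential[OF open_M convex_M \<theta>_linear \<theta>_C1 \<theta>_closed]]
  unfolding f_def by blast

lemma base_M: "base \<in> M"
  by (simp add: M_iff)

text \<open>The difference is the same at every point of the domain, and \<open>base\<close> merely
  represents it. The homothety factor of \<open>(u, a)\<close> on \<open>\<Omega>\<close> is
  \<open>exp (- \<kappa> u a)\<close>.\<close>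

definition \<kappa> :: "'k \<Rightarrow> 'k \<Rightarrow> real" where
  "\<kappa> u a = f (ot_act \<sigma> (u, a) base) - f base"

text \<open>Invariance of \<open>\<theta>\<close> makes the difference of the two potentials locally
  constant, and the domain is convex.\<close>

lemma f_act:
  assumes "u \<in> U" "a \<in> ring_of_integers" "x \<in> M"
  shows "f (ot_act \<sigma> (u, a) x) = f x + \<kappa> u a"
proof -
  have const: "((\<lambda>x. f (ot_act \<sigma> (u, a) x) - f x) has_derivative (\<lambda>v. 0)) (at x within M)" if x: "x \<in> M" for x
  proof -
    have "((\<lambda>x. f (ot_act \<sigma> (u, a) x)) has_derivative (\<lambda>v. \<theta> (ot_act \<sigma> (u, a) x) (lin u v))) (at x within M)"
      using act_domain[OF assms(1) x] by (intro has_derivative_compose[OF act_has_derivative f_has_derivative])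
    moreover have "(f has_derivative \<theta> x) (at x within M)"
      using f_has_derivative[OF x] by (rule has_derivative_at_withinI)
    ultimately have "((\<lambda>x. f (ot_act \<sigma> (u, a) x) - f x) has_derivative
        (\<lambda>v. \<theta> (ot_act \<sigma> (u, a) x) (lin u v) - \<theta> x v)) (at x within M)"
      by (rule has_derivative_diff)
    then show ?thesis by (simp add: \<theta>_act[OF assms(1,2) x])
  qed
  have "\<exists>c. \<forall>x\<in>M. f (ot_act \<sigma> (u, a) x) - f x = c"
    by (rule has_derivative_zero_constant[OF convex_M const])
  then obtain c where "\<forall>x\<in>M. f (ot_act \<sigma> (u, a) x) - f x = c" by (elim exE)
  from bspec[OF this assms(3)] bspec[OF this base_M] show ?thesis by (simp add: \<kappa>_def)
qed

lemma \<kappa>_mult: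
  assumes "u \<in> U" "a \<in> ring_of_integers" "v \<in> U" "b \<in> ring_of_integers"
  shows "\<kappa> (u * v) (a + u * b) = \<kappa> u a + \<kappa> v b"
proof -
  have "f (ot_act \<sigma> (u, a) (ot_act \<sigma> (v, b) base)) = f base + \<kappa> v b + \<kappa> u a"
    using f_act[OF assms(1,2) act_domain[OF assms(3) base_M]] f_act[OF assms(3,4) base_M] by simp
  then show ?thesis unfolding act_act by (simp add: \<kappa>_def)
qed

text \<open>On the integers \<open>\<kappa>\<close> is additive. It is invariant under units,
  because translation by \<open>a\<close> followed by \<open>u\<close> is \<open>u\<close> followed
  by translation by \<open>u * a\<close>.\<close>

lemma \<kappa>_integer:
  assumes "a \<in> ring_of_integers"
  shows "\<kappa> 1 a = 0"
proof (rule unit_invariant_character_trivial[OF _ _ assms])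
  show "\<kappa> 1 (a + b) = \<kappa> 1 a + \<kappa> 1 b" if "a \<in> ring_of_integers" "b \<in> ring_of_integers" for a b
    using \<kappa>_mult[OF U_group(1) that(1) U_group(1) that(2)] by simp
  show "\<kappa> 1 (u * a) = \<kappa> 1 a" if "u \<in> U" "a \<in> ring_of_integers" for u a
  proof -
    have "u * a \<in> ring_of_integers" using U_integer[OF that(1)] that(2) by (rule ring_of_integers_closed)
    from \<kappa>_mult[OF U_group(1) this that(1) ring_of_integers_closed(1)]
      \<kappa>_mult[OF that(1) ring_of_integers_closed(1) U_group(1) that(2)]
    show ?thesis by simp
  qed
qed

definition \<Omega> :: "complex ^ ('s + 't) \<Rightarrow> complex ^ ('s + 't) \<Rightarrow> complex ^ ('s + 't) \<Rightarrow> real" where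
  "\<Omega> x v w = exp (- f x) * g x (\<i> *s v) w"

definition \<Omega>' :: "complex ^ ('s + 't) \<Rightarrow> complex ^ ('s + 't) \<Rightarrow> complex ^ ('s + 't) \<Rightarrow> complex ^ ('s + 't) \<Rightarrow> real" where
  "\<Omega>' v w x z = exp (- f x) *
    (frechet_derivative (\<lambda>x. g x (\<i> *s v) w) (at x) z - \<theta> x z * g x (\<i> *s v) w)"

lemma \<Omega>_has_derivative:
  assumes "x \<in> M"
  shows "((\<lambda>x. \<Omega> x v w) has_derivative \<Omega>' v w x) (at x)"
proof -
  have "((\<lambda>x. g x (\<i> *s v) w) has_derivative frechet_derivative (\<lambda>x. g x (\<i> *s v) w) (at x)) (at x)"
    using g_C1 assms by (rule C_on_1_has_derivative)
  from has_derivative_mult[OF has_derivative_exp[OF has_derivative_minus[OF f_has_derivative[OF assms]]] this]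
  show ?thesis unfolding \<Omega>_def \<Omega>'_def
    by (rule has_derivative_eq_rhs) (auto simp: algebra_simps)
qed

lemma continuous_on_f: "continuous_on M f"
  using f_has_derivative by (auto intro!: continuous_at_imp_continuous_on has_derivative_continuous)

lemma continuous_on_\<Omega>': "continuous_on M (\<lambda>x. \<Omega>' v w x z)"
  unfolding \<Omega>'_def
  by (intro continuous_intros continuous_on_f C_on_1_continuous_derivative[OF g_C1]
      C_on_1_continuous[OF g_C1] C_on_1_continuous[OF \<theta>_C1])

lemma continuous_on_\<Omega>: "continuous_on M (\<lambda>x. \<Omega> x v w)"
  using \<Omega>_has_derivative by (auto intro!: continuous_at_imp_continuous_on has_derivative_continuous)

text \<open>The factor \<open>exp (- f x)\<close> cancels the Lee form. The vanishing of the
  exterior derivative is solved for the derivative along \<open>u\<close>, the form in which the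
  flux bound uses it.\<close>

lemma \<Omega>_closed:
  assumes "x \<in> M"
  shows "\<Omega>' v w x u = \<Omega>' u w x v - \<Omega>' u v x w"
proof -
  have "\<Omega>' v w x u - \<Omega>' u w x v + \<Omega>' u v x w = exp (- f x) *
    (ext_deriv2 (\<lambda>x v w. g x (\<i> *s v) w) x u v w - wedge12 \<theta> (\<lambda>x v w. g x (\<i> *s v) w) x u v w)"
    by (simp add: \<Omega>'_def ext_deriv2_def wedge12_def algebra_simps)
  then show ?thesis using lck[OF assms, of u v w] by simp
qed

lemma \<Omega>_periodic:
  "\<forall>a\<in>ring_of_integers. \<forall>x\<in>M. \<Omega> (ot_act \<sigma> (1, a) x) v w = \<Omega> x v w"
proof (intro ballI)
  fix a :: 'k and x assume ax: "a \<in> ring_of_integers" "x \<in> M"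
  then show "\<Omega> (ot_act \<sigma> (1, a) x) v w = \<Omega> x v w"
    using g_act[OF U_group(1) ax, of "\<i> *s v" w] f_act[OF U_group(1) ax] \<kappa>_integer[OF ax(1)]
    by (simp add: \<Omega>_def lin_one)
qed

text \<open>
  \<open>A b R\<close> is the integral of \<open>\<Omega>\<close> over the disc of radius \<open>R\<close> and centre \<open>b\<close> in the
  \<open>j\<close>-th complex coordinate line, in polar coordinates.
\<close>

lemma norm_\<sigma>_unit:
  assumes u: "u \<in> U"
  shows "(norm (\<sigma> (Inr j) u))\<^sup>2 = exp (- \<kappa> u 0)"
proof -
  define e1 e2 :: "complex ^ ('s + 't)" where "e1 = axis (Inr j) 1" and "e2 = axis (Inr j) \<i>"
  have e12: "\<i> *s e1 = e2" "\<i> *s e2 = - e1"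
    by (auto simp: e1_def e2_def axis_def Finite_Cartesian_Product.vec_eq_iff)
  have e1_nz: "e1 \<noteq> 0" by (simp add: e1_def axis_eq_0_iff)
  have e_Inl: "e1 $ Inl i = 0" "e2 $ Inl i = 0" for i by (simp_all add: e1_def e2_def axis_def)
  \<comment> \<open>The area density of \<open>\<Omega>\<close> on the complex line; it is positive
    because \<open>e2\<close> is \<open>\<i> *s e1\<close>.\<close>
  define h where "h = (\<lambda>x. \<Omega> x e1 e2)"
  have h_eq: "h x = exp (- f x) * g x e1 e1" if "x \<in> M" for x
    using g_herm[OF that, of e1 e1] by (simp add: h_def \<Omega>_def e12)
  have h_pos: "0 < h x" if "x \<in> M" for x
    using h_eq[OF that] g_pos[OF that e1_nz] by simp
  define s where "s = \<sigma> (Inr j) u"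
  define l where "l = norm s"
  define \<alpha> where "\<alpha> = Arg s"
  have "s \<noteq> 0" using U_nonzero[OF u] \<sigma>_simps(11) by (simp add: s_def)
  then have l: "0 < l" by (simp add: l_def)
  have s: "s = of_real (l * cos \<alpha>) + \<i> * of_real (l * sin \<alpha>)"
    using arg_cong[OF rcis_cmod_Arg[of s], of Re] arg_cong[OF rcis_cmod_Arg[of s], of Im]
    by (simp add: l_def \<alpha>_def complex_eq_iff)
  \<comment> \<open>On the line the unit scales by \<open>l\<close> and rotates by
    \<open>\<alpha>\<close>.\<close>
  have lin_e: "lin u (p *\<^sub>R e1 + q *\<^sub>R e2) =
      (l * (p * cos \<alpha> - q * sin \<alpha>)) *\<^sub>R e1 + (l * (q * cos \<alpha> + p * sin \<alpha>)) *\<^sub>R e2" for p q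
  proof -
    have "\<sigma> i u * (p *\<^sub>R e1 + q *\<^sub>R e2) $ i =
        ((l * (p * cos \<alpha> - q * sin \<alpha>)) *\<^sub>R e1 + (l * (q * cos \<alpha> + p * sin \<alpha>)) *\<^sub>R e2) $ i" for i
      using s by (auto simp: e1_def e2_def axis_def s_def[symmetric] complex_eq_iff algebra_simps)
    then show ?thesis by (simp add: lin_def Finite_Cartesian_Product.vec_eq_iff)
  qed
  \<comment> \<open>A Hermitian metric makes \<open>e1\<close> and \<open>e2\<close> orthogonal and
    equally long, so \<open>lin u\<close> stretches areas in the line by \<open>l\<^sup>2\<close>;
    the remaining factor comes from the change of \<open>f\<close>.\<close>
  have h_act: "h (ot_act \<sigma> (u, 0) x) * l\<^sup>2 = exp (- \<kappa> u 0) * h x" if x: "x \<in> M" for x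
  proof -
    let ?y = "ot_act \<sigma> (u, 0) x"
    have y: "?y \<in> M" using u x by (rule act_domain)
    have bl: "bilinear (g ?y)" using y by (rule bilinear)
    have "g ?y e2 e2 = g ?y e1 e1" using g_herm[OF y, of e1 e1] by (simp add: e12)
    moreover have "g ?y e1 e2 = 0"
      using g_herm[OF y, of e1 e2] g_sym[OF y, of e1 e2] by (simp add: e12 bilinear_rneg[OF bl])
    moreover have "g ?y e2 e1 = 0" using calculation(2) g_sym[OF y] by simp
    ultimately have "g ?y (lin u e1) (lin u e1) = l\<^sup>2 * ((sin \<alpha>)\<^sup>2 + (cos \<alpha>)\<^sup>2) * g ?y e1 e1"
      using lin_e[of 1 0] bilinear_ladd[OF bl] bilinear_radd[OF bl] bilinear_lmul[OF bl] bilinear_rmul[OF bl]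
      by (simp add: power2_eq_square algebra_simps del: sin_cos_squared_add sin_cos_squared_add2 sin_cos_squared_add3)
    then have l2: "l\<^sup>2 * g ?y e1 e1 = g x e1 e1"
      using g_act[OF u ring_of_integers_closed(1) x, of e1 e1] by simp
    have "h ?y * l\<^sup>2 = exp (- f ?y) * (l\<^sup>2 * g ?y e1 e1)" by (simp add: h_eq[OF y])
    also have "\<dots> = exp (- \<kappa> u 0) * h x"
      unfolding l2 f_act[OF u ring_of_integers_closed(1) x] h_eq[OF x]
      by (simp add: exp_diff exp_minus field_simps)
    finally show ?thesis .
  qed
  define b' where "b' = ot_act \<sigma> (u, 0) base"
  define v where "v = b' - base"
  define X where "X = (\<lambda>b r \<phi>. b + (r * cos \<phi>) *\<^sub>R e1 + (r * sin \<phi>) *\<^sub>R e2)"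
  have b'_Inl: "b' $ Inl i = \<i> * of_real (\<rho> i u)" for i
    using \<sigma>_simps(4) by (simp add: b'_def ot_act_def \<sigma>_Inl)
  \<comment> \<open>The imaginary parts are 1 at \<open>base\<close> and \<open>\<rho> i u\<close>
    at \<open>b'\<close>, so these bounds hold along the whole segment of centres, and on the discs,
    which do not change the real coordinates.\<close>
  define p where "p = Min (insert 1 (range (\<lambda>i. \<rho> i u)))"
  define q where "q = Max (insert 1 (range (\<lambda>i. \<rho> i u)))"
  have p: "0 < p" unfolding p_def using \<rho>_pos[OF u] by (subst Min_gr_iff) auto
  have pq: "p \<le> 1" "1 \<le> q" "p \<le> \<rho> i u" "\<rho> i u \<le> q" for i
    unfolding p_def q_def by (rule Min_le Max_ge, simp, blast)+
  have strip: "p \<le> Im ((base + \<tau> *\<^sub>R v + a *\<^sub>R e1 + b *\<^sub>R e2) $ Inl i) \<and>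
      Im ((base + \<tau> *\<^sub>R v + a *\<^sub>R e1 + b *\<^sub>R e2) $ Inl i) \<le> q"
    if \<tau>: "\<tau> \<in> {0..1}" for \<tau> a b i
  proof -
    have "Im ((base + \<tau> *\<^sub>R v + a *\<^sub>R e1 + b *\<^sub>R e2) $ Inl i) = (1 - \<tau>) * 1 + \<tau> * \<rho> i u"
      by (simp add: v_def e_Inl b'_Inl algebra_simps)
    moreover have "(1 - \<tau>) * p + \<tau> * p \<le> (1 - \<tau>) * 1 + \<tau> * \<rho> i u"
      using \<tau> pq by (intro add_mono mult_left_mono) auto
    moreover have "(1 - \<tau>) * 1 + \<tau> * \<rho> i u \<le> (1 - \<tau>) * q + \<tau> * q"
      using \<tau> pq by (intro add_mono mult_left_mono) auto
    ultimately show ?thesis by (simp add: algebra_simps)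
  qed
  have strip_M: "base + \<tau> *\<^sub>R v + a *\<^sub>R e1 + b *\<^sub>R e2 \<in> M" if "\<tau> \<in> {0..1}" for \<tau> a b
    unfolding M_iff using strip[OF that] p less_le_trans by blast
  obtain D1 where D1: "\<forall>x. (\<forall>i. p \<le> Im (x $ Inl i) \<and> Im (x $ Inl i) \<le> q) \<longrightarrow> \<bar>\<Omega> x v e2\<bar> \<le> D1"
    using periodic_bounded_on_strip[OF continuous_on_\<Omega>[of v e2] \<Omega>_periodic p, of q] by (elim exE)
  obtain D2 where D2: "\<forall>x. (\<forall>i. p \<le> Im (x $ Inl i) \<and> Im (x $ Inl i) \<le> q) \<longrightarrow> \<bar>\<Omega> x v e1\<bar> \<le> D2"
    using periodic_bounded_on_strip[OF continuous_on_\<Omega>[of v e1] \<Omega>_periodic p, of q] by (elim exE)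
  define D where "D = max D1 D2"
  obtain C where C: "\<forall>x. (\<forall>i. p \<le> Im (x $ Inl i) \<and> Im (x $ Inl i) \<le> q) \<longrightarrow> \<bar>h x\<bar> \<le> C"
    using periodic_bounded_on_strip[OF continuous_on_\<Omega>[of e1 e2] \<Omega>_periodic p, of q] unfolding h_def by (elim exE)
  \<comment> \<open>A positive lower bound for \<open>h\<close> on the strip comes from an upper
    bound for its inverse, which has the same periods.\<close>
  have cont_inv: "continuous_on M (\<lambda>x. inverse (h x))"
    using h_pos unfolding h_def by (intro continuous_on_inverse continuous_on_\<Omega>) force
  have "\<forall>a\<in>ring_of_integers. \<forall>x\<in>M. inverse (h (ot_act \<sigma> (1, a) x)) = inverse (h x)"
    using \<Omega>_periodic by (simp add: h_def)
  from periodic_bounded_on_strip[OF cont_inv this p, of q]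
  obtain c' where c': "\<forall>x. (\<forall>i. p \<le> Im (x $ Inl i) \<and> Im (x $ Inl i) \<le> q) \<longrightarrow> \<bar>inverse (h x)\<bar> \<le> c'"
    by (elim exE)
  define c where "c = inverse (max 1 c')"
  have c: "0 < c" by (simp add: c_def)
  have XM: "X base r \<phi> \<in> M" for r \<phi>
    using strip_M[of 0 "r * cos \<phi>" "r * sin \<phi>"] by (simp add: X_def)
  have h_bounds: "c \<le> h (X base r \<phi>)" "h (X base r \<phi>) \<le> C" for r \<phi>
  proof -
    have st: "\<forall>i. p \<le> Im (X base r \<phi> $ Inl i) \<and> Im (X base r \<phi> $ Inl i) \<le> q"
      using strip[of 0 "r * cos \<phi>" "r * sin \<phi>"] by (simp add: X_def)
    show "h (X base r \<phi>) \<le> C" using C st by fastforce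
    have "\<bar>inverse (h (X base r \<phi>))\<bar> \<le> c'" using c' st by blast
    then have "inverse (h (X base r \<phi>)) \<le> max 1 c'" by linarith
    then have "inverse (max 1 c') \<le> inverse (inverse (h (X base r \<phi>)))"
      using h_pos[OF XM] by (intro le_imp_inverse_le) auto
    then show "c \<le> h (X base r \<phi>)" by (simp add: c_def)
  qed
  define A where "A = (\<lambda>b R. integral {0..R} (\<lambda>r. integral {0..2*pi} (\<lambda>\<phi>. r * h (X b r \<phi>))))"
  \<comment> \<open>The centre moves along \<open>v\<close>, and the side components
    \<open>\<Omega> x v e1\<close> and \<open>\<Omega> x v e2\<close> are bounded on the strip by
    periodicity.\<close>
  have flux: "\<bar>A b' R - A base R\<bar> \<le> 4 * pi * D * R" if R: "0 \<le> R" for R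
  proof -
    have "\<bar>integral {0..R} (\<lambda>r. integral {0..2*pi} (\<lambda>\<phi>. r * h (base + v + (r * cos \<phi>) *\<^sub>R e1 + (r * sin \<phi>) *\<^sub>R e2)))
      - integral {0..R} (\<lambda>r. integral {0..2*pi} (\<lambda>\<phi>. r * h (base + (r * cos \<phi>) *\<^sub>R e1 + (r * sin \<phi>) *\<^sub>R e2)))\<bar>
      \<le> 4 * pi * D * R"
    proof (rule flux_bound_in_polar_coordinates[where S = M and h' = "\<Omega>' e1 e2" and P1' = "\<Omega>' v e2"
          and P2' = "\<Omega>' v e1" and ?P1.0 = "\<lambda>x. \<Omega> x v e2" and ?P2.0 = "\<lambda>x. \<Omega> x v e1"])
      show "(h has_derivative \<Omega>' e1 e2 x) (at x)" if "x \<in> M" for x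
        unfolding h_def using that by (rule \<Omega>_has_derivative)
      show "\<Omega>' e1 e2 x v = \<Omega>' v e2 x e1 - \<Omega>' v e1 x e2" if "x \<in> M" for x
        using that by (rule \<Omega>_closed)
      show "\<bar>\<Omega> (base + \<tau> *\<^sub>R v + a *\<^sub>R e1 + b *\<^sub>R e2) v e2\<bar> \<le> D" if "\<tau> \<in> {0..1}" for \<tau> a b
        unfolding D_def using D1 strip[OF that] by (intro max.coboundedI1) blast
      show "\<bar>\<Omega> (base + \<tau> *\<^sub>R v + a *\<^sub>R e1 + b *\<^sub>R e2) v e1\<bar> \<le> D" if "\<tau> \<in> {0..1}" for \<tau> a b
        unfolding D_def using D2 strip[OF that] by (intro max.coboundedI2) blast
    qed (use R strip_M \<Omega>_has_derivative continuous_on_\<Omega>' in auto)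
    then show ?thesis by (simp add: A_def X_def v_def)
  qed
  have cont_h: "continuous_on (UNIV :: (real \<times> real) set) (\<lambda>z. h (X b (fst z) (snd z)))" if "\<And>r \<phi>. X b r \<phi> \<in> M" for b
    unfolding h_def using that
    by (intro continuous_on_compose2[OF continuous_on_\<Omega>]) (auto simp: X_def intro!: continuous_intros)
  have cont_h1: "continuous_on T (\<lambda>\<phi>. h (X b r \<phi>))" if "\<And>r \<phi>. X b r \<phi> \<in> M" for b r T
  proof -
    have "continuous_on T (\<lambda>\<phi>. (r, \<phi>))" by (intro continuous_intros)
    from continuous_on_compose2[OF cont_h[OF that] this] show ?thesis by simp
  qed
  have cont_m: "continuous_on T (\<lambda>r. integral {0..2*pi} (\<lambda>\<phi>. r * h (X b r \<phi>)))" if "\<And>r \<phi>. X b r \<phi> \<in> M" for b T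
  proof -
    have "continuous_on (T \<times> cbox 0 (2*pi)) (\<lambda>(r, \<phi>). r * h (X b r \<phi>))"
      unfolding case_prod_beta by (intro continuous_intros continuous_on_subset[OF cont_h[OF that]]) auto
    from integral_continuous_on_param[OF this] show ?thesis by simp
  qed
  have A_bounds: "(pi * c) * R\<^sup>2 \<le> A base R \<and> A base R \<le> (pi * C) * R\<^sup>2" if R: "0 < R" for R
  proof -
    have quad: "integral {0..R} (\<lambda>r. 2 * pi * k * r) = (pi * k) * R\<^sup>2" for k
    proof -
      have "((\<lambda>r. 2 * pi * k * r) has_integral (pi * k * R\<^sup>2 - pi * k * 0\<^sup>2)) {0..R}"
        using R by (intro fundamental_theorem_of_calculus)
          (auto intro!: derivative_eq_intros simp flip: has_real_derivative_iff_has_vector_derivative)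
      from integral_unique[OF this] show ?thesis by simp
    qed
    have inner: "2 * pi * c * r \<le> integral {0..2*pi} (\<lambda>\<phi>. r * h (X base r \<phi>))"
      "integral {0..2*pi} (\<lambda>\<phi>. r * h (X base r \<phi>)) \<le> 2 * pi * C * r" if r: "r \<in> {0..R}" for r
    proof -
      have int: "(\<lambda>\<phi>. r * h (X base r \<phi>)) integrable_on {0..2*pi}"
        by (intro integrable_continuous_real continuous_intros cont_h1 XM)
      have "integral {0..2*pi} (\<lambda>\<phi>. r * c) \<le> integral {0..2*pi} (\<lambda>\<phi>. r * h (X base r \<phi>))"
        using r h_bounds(1) int by (intro integral_le) (auto intro: mult_left_mono)
      then show "2 * pi * c * r \<le> integral {0..2*pi} (\<lambda>\<phi>. r * h (X base r \<phi>))" by (simp add: mult_ac)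
      have "integral {0..2*pi} (\<lambda>\<phi>. r * h (X base r \<phi>)) \<le> integral {0..2*pi} (\<lambda>\<phi>. r * C)"
        using r h_bounds(2) int by (intro integral_le) (auto intro: mult_left_mono)
      then show "integral {0..2*pi} (\<lambda>\<phi>. r * h (X base r \<phi>)) \<le> 2 * pi * C * r" by (simp add: mult_ac)
    qed
    have int: "(\<lambda>r. integral {0..2*pi} (\<lambda>\<phi>. r * h (X base r \<phi>))) integrable_on {0..R}"
      "(\<lambda>r. 2 * pi * k * r) integrable_on {0..R}" for k
      by (intro integrable_continuous_real cont_m XM continuous_intros)+
    have "integral {0..R} (\<lambda>r. 2 * pi * c * r) \<le> A base R" "A base R \<le> integral {0..R} (\<lambda>r. 2 * pi * C * r)"
      unfolding A_def by (rule integral_le[OF int(2,1) inner(1)], assumption,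
          rule integral_le[OF int(1,2) inner(2)], assumption)
    then show ?thesis by (simp only: quad)
  qed
  have act_X: "ot_act \<sigma> (u, 0) (X base r \<phi>) = X b' (l * r) (\<phi> + \<alpha>)" for r \<phi>
  proof -
    have "ot_act \<sigma> (u, 0) (X base r \<phi>) = b' + lin u ((r * cos \<phi>) *\<^sub>R e1 + (r * sin \<phi>) *\<^sub>R e2)"
      unfolding X_def b'_def add.assoc by (rule act_add)
    then show ?thesis unfolding lin_e X_def by (simp add: cos_add sin_add algebra_simps)
  qed
  have X'M: "X b' r \<phi> \<in> M" for r \<phi>
    using strip_M[of 1 "r * cos \<phi>" "r * sin \<phi>"] by (simp add: X_def v_def)
  \<comment> \<open>The unit maps the disc about \<open>base\<close> to that of radius
    \<open>l * R\<close> about \<open>b'\<close>. The rotation disappears by periodicity in the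
    angle; of the area factor \<open>l\<^sup>2\<close>, one \<open>l\<close> is the change of the
    weight \<open>r\<close> and the other that of the radial variable.\<close>
  have A_scale: "A b' (l * R) = exp (- \<kappa> u 0) * A base R" if R: "0 < R" for R
  proof -
    define m where "m = (\<lambda>r. integral {0..2*pi} (\<lambda>\<phi>. r * h (X b' r \<phi>)))"
    have m: "l * m (l * r) = exp (- \<kappa> u 0) * integral {0..2*pi} (\<lambda>\<phi>. r * h (X base r \<phi>))" for r
    proof -
      have "integral {0..2*pi} (\<lambda>\<phi>. h (X b' (l * r) (\<phi> + \<alpha>))) = integral {0..2*pi} (\<lambda>\<phi>. h (X b' (l * r) \<phi>))"
        using cont_h1[OF X'M] by (intro integral_periodic_shift) (auto simp: X_def)
      moreover have "h (X b' (l * r) (\<phi> + \<alpha>)) = exp (- \<kappa> u 0) / l\<^sup>2 * h (X base r \<phi>)" for \<phi>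
        using h_act[OF XM, of r \<phi>] l by (simp add: act_X field_simps)
      ultimately have "integral {0..2*pi} (\<lambda>\<phi>. h (X b' (l * r) \<phi>)) =
          exp (- \<kappa> u 0) / l\<^sup>2 * integral {0..2*pi} (\<lambda>\<phi>. h (X base r \<phi>))"
        by simp
      then show ?thesis using l by (simp add: m_def power2_eq_square)
    qed
    define G where "G = (\<lambda>R. integral {0..R} m)"
    have cm: "continuous_on T m" for T unfolding m_def by (rule cont_m[OF X'M])
    have "((\<lambda>r. m (l * r) * l) has_integral (G (l * R) - G (l * 0))) {0..R}"
    proof (rule fundamental_theorem_of_calculus)
      fix r assume r: "r \<in> {0..R}"
      have "(G has_real_derivative m (l * r)) (at (l * r) within {0..l * R})"
        unfolding G_def using r l by (intro integral_has_real_derivative cm) auto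
      moreover have "(\<lambda>r. l * r) ` {0..R} \<subseteq> {0..l * R}" using l by auto
      ultimately have "(G has_real_derivative m (l * r)) (at (l * r) within (\<lambda>r. l * r) ` {0..R})"
        by (rule DERIV_subset)
      then have "((\<lambda>r. G (l * r)) has_real_derivative m (l * r) * l) (at r within {0..R})"
        by (rule DERIV_image_chain[unfolded o_def]) (auto intro!: derivative_eq_intros)
      then show "((\<lambda>r. G (l * r)) has_vector_derivative m (l * r) * l) (at r within {0..R})"
        by (simp add: has_real_derivative_iff_has_vector_derivative)
    qed (use R in simp)
    from integral_unique[OF this] have "integral {0..R} (\<lambda>r. l * m (l * r)) = G (l * R)"
      by (simp add: mult.commute[of _ l] G_def)
    then show ?thesis unfolding m by (simp add: A_def G_def m_def)
  qed
  \<comment> \<open>Moving the centre back from \<open>b'\<close> to \<open>base\<close> costs only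
    the flux term, so the integrals about \<open>base\<close> alone obey the scaling law up to order
    \<open>R\<close>.\<close>
  have "exp (- \<kappa> u 0) = l\<^sup>2"
  proof (rule quadratic_growth_scaling)
    show "0 < pi * c" using c by simp
    show "\<bar>A base (l * R) - exp (- \<kappa> u 0) * A base R\<bar> \<le> (4 * pi * D * l) * R" if "0 < R" for R
      using flux[of "l * R"] A_scale[OF that] l that by (simp add: abs_minus_commute mult_ac)
  qed (use l A_bounds in auto)
  then show ?thesis by (simp add: l_def s_def)
qed

end

section \<open>Units with equal moduli at the complex places\<close>

context ot_action
begin

lemma \<sigma>_Inl_inj: "\<sigma> (Inl i) = \<sigma> (Inl k) \<longleftrightarrow> i = k"
  using labelling by (auto simp: embedding_labelling_def bij_betw_def dest: injD)

text \<open>A non-real embedding and its conjugate contribute the same modulus, whence the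
  square.\<close>

lemma norm_prod_labelled:
  assumes nf: "number_field TYPE('k)" and u: "u \<in> U"
  shows "(\<Prod>i\<in>UNIV. \<rho> i u) * (\<Prod>j\<in>UNIV. norm (\<sigma> (Inr j) u))\<^sup>2 = 1"
proof -
  let ?c = "case_sum (\<lambda>j. \<sigma> (Inr j)) (\<lambda>j x. cnj (\<sigma> (Inr j) x))"
  have bij: "bij_betw (\<lambda>i. \<sigma> (Inl i)) UNIV real_embeddings" "bij_betw ?c UNIV complex_embeddings"
    using labelling by (simp_all add: embedding_labelling_def)
  have fin: "finite (field_embeddings :: ('k \<Rightarrow> complex) set)"
    using finite_embeddings by (simp add: embeddings_eq)
  have disj: "real_embeddings \<inter> (complex_embeddings :: ('k \<Rightarrow> complex) set) = {}"
    by (auto simp: real_embeddings_def complex_embeddings_def)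
  have "(\<Prod>f\<in>real_embeddings. f u) = (\<Prod>i\<in>UNIV. \<sigma> (Inl i) u)"
    by (rule prod.reindex_bij_betw[OF bij(1), symmetric])
  moreover have "(\<Prod>f\<in>complex_embeddings. f u) = (\<Prod>x\<in>UNIV. ?c x u)"
    by (rule prod.reindex_bij_betw[OF bij(2), symmetric])
  moreover have "norm (\<Prod>x\<in>UNIV. ?c x u) = (\<Prod>j\<in>UNIV. norm (\<sigma> (Inr j) u))\<^sup>2"
    unfolding UNIV_Plus_UNIV[symmetric]
    by (subst prod.Plus) (simp_all add: norm_mult power2_eq_square flip: prod_norm)
  moreover have "norm (\<Prod>i\<in>UNIV. \<sigma> (Inl i) u) = (\<Prod>i\<in>UNIV. \<rho> i u)"
    using \<rho>_pos[OF u] by (simp add: \<sigma>_Inl flip: prod_norm) (simp add: abs_of_pos)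
  moreover have "norm (\<Prod>f\<in>field_embeddings. f u) = 1"
    using nf fin U_unit[OF u] by (rule norm_prod_embeddings_unit)
  ultimately show ?thesis
    unfolding embeddings_eq prod.union_disjoint[OF finite_embeddings disj] by (simp add: norm_mult)
qed

text \<open>
  The logarithms of all absolute values in terms of those at the real places, multiplied
  by the number of non-real embeddings; their coefficients are read off from the product formula.
\<close>

definition log_coeff :: "('k \<Rightarrow> complex) \<Rightarrow> 's \<Rightarrow> real" where
  "log_coeff f i = (if f \<in> real_embeddings then if f = \<sigma> (Inl i) then 2 * real CARD('t) else 0 else - 1)"

text \<open>With equal moduli the product formula for a non-real \<open>f\<close> says that the
  product of the real values times the power of \<open>norm (f u)\<close> with exponent
  \<open>2 * CARD('t)\<close> is 1; taking logarithms gives the coefficients -1.\<close>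

lemma log_norm_embedding:
  assumes nf: "number_field TYPE('k)" and u: "u \<in> U"
    and eq: "\<forall>j j'. norm (\<sigma> (Inr j) u) = norm (\<sigma> (Inr j') u)"
    and f: "field_embedding f"
  shows "2 * real CARD('t) * ln (norm (f u)) = (\<Sum>i\<in>UNIV. log_coeff f i * ln (\<rho> i u))"
proof (cases "f \<in> real_embeddings")
  case True
  moreover have "range (\<lambda>i. \<sigma> (Inl i)) = real_embeddings"
    using labelling by (simp add: embedding_labelling_def bij_betw_def)
  ultimately obtain k where k: "f = \<sigma> (Inl k)" by blast
  have "(\<Sum>i\<in>UNIV. log_coeff f i * ln (\<rho> i u)) =
      (\<Sum>i\<in>UNIV. if i = k then 2 * real CARD('t) * ln (\<rho> k u) else 0)"
    using True by (intro sum.cong) (auto simp: log_coeff_def k \<sigma>_Inl_inj)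
  also have "\<dots> = 2 * real CARD('t) * ln (norm (f u))"
    using \<rho>_pos[OF u, of k] by (simp add: k \<sigma>_Inl)
  finally show ?thesis by simp
next
  case False
  then have "f \<in> complex_embeddings"
    using f by (auto simp: real_embeddings_def complex_embeddings_def)
  then have "f \<in> range (case_sum (\<lambda>j. \<sigma> (Inr j)) (\<lambda>j x. cnj (\<sigma> (Inr j) x)))"
    using labelling by (simp add: embedding_labelling_def bij_betw_def)
  then obtain x where x: "f = case_sum (\<lambda>j. \<sigma> (Inr j)) (\<lambda>j x. cnj (\<sigma> (Inr j) x)) x" by blast
  have n: "norm (\<sigma> (Inr j) u) = norm (f u)" for j
    using eq x by (cases x) auto
  have nz: "0 < norm (f u)"
    using U_nonzero[OF u] field_embedding_simps(8)[OF f] by simp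
  have "(\<Prod>i\<in>UNIV. \<rho> i u) * (norm (f u) ^ CARD('t))\<^sup>2 = 1"
    using norm_prod_labelled[OF nf u] unfolding n by simp
  then have "ln ((\<Prod>i\<in>UNIV. \<rho> i u) * (norm (f u) ^ CARD('t))\<^sup>2) = 0" by simp
  moreover have "ln ((\<Prod>i\<in>UNIV. \<rho> i u) * (norm (f u) ^ CARD('t))\<^sup>2) =
      (\<Sum>i\<in>UNIV. ln (\<rho> i u)) + 2 * (real CARD('t) * ln (norm (f u)))"
  proof -
    have "0 < (\<Prod>i\<in>UNIV. \<rho> i u)" by (intro prod_pos) (simp add: \<rho>_pos[OF u])
    moreover have "ln (\<Prod>i\<in>UNIV. \<rho> i u) = (\<Sum>i\<in>UNIV. ln (\<rho> i u))"
      by (rule ln_prod) (simp_all add: \<rho>_pos[OF u] less_imp_neq[symmetric])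
    ultimately show ?thesis using nz by (simp add: ln_mult_pos ln_realpow)
  qed
  ultimately show ?thesis using False by (simp add: log_coeff_def sum_negf)
qed

lemma equal_moduli_imp_one_place:
  assumes nf: "number_field TYPE('k)"
    and eq: "\<forall>u\<in>U. \<forall>j j'. norm (\<sigma> (Inr j) u) = norm (\<sigma> (Inr j') u)"
  shows "CARD('t) = 1"
proof (rule ccontr)
  assume "CARD('t) \<noteq> 1"
  then obtain j\<^sub>1 j\<^sub>2 :: 't where j: "j\<^sub>1 \<noteq> j\<^sub>2"
    by (metis card_1_singleton_iff One_nat_def UNIV_eq_I singletonI)
  obtain i0 :: 's where True by simp
  let ?c = "case_sum (\<lambda>j. \<sigma> (Inr j)) (\<lambda>j x. cnj (\<sigma> (Inr j) x))"
  have inj: "inj ?c" using labelling by (simp add: embedding_labelling_def bij_betw_def)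
  have "?c (Inl j\<^sub>2) \<noteq> ?c (Inl j\<^sub>1)" "?c (Inr j\<^sub>2) \<noteq> ?c (Inl j\<^sub>1)"
    unfolding inj_eq[OF inj] using j by simp_all
  then have ne: "\<sigma> (Inr j\<^sub>2) \<noteq> \<sigma> (Inr j\<^sub>1)" "(\<lambda>x. cnj (\<sigma> (Inr j\<^sub>2) x)) \<noteq> \<sigma> (Inr j\<^sub>1)"
    by simp_all
  obtain \<beta> \<gamma> \<delta> where emb: "field_embedding \<beta>" "field_embedding \<gamma>" "field_embedding \<delta>"
    and ne': "\<gamma> \<noteq> \<sigma> (Inl i0)" "\<delta> \<noteq> \<sigma> (Inl i0)"
    and rel: "\<forall>u. norm (\<sigma> (Inr j\<^sub>1) u) = norm (\<sigma> (Inr j\<^sub>2) u) \<longrightarrow> \<sigma> (Inl i0) u * \<beta> u = \<gamma> u * \<delta> u"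
    using modulus_relation_transfer[OF nf embedding embedding embedding ne, of "Inl i0"] by blast
  let ?s = "\<sigma> (Inl i0)"
  define c where "c = (\<lambda>i. log_coeff ?s i + log_coeff \<beta> i - log_coeff \<gamma> i - log_coeff \<delta> i)"
  have "(\<Sum>i\<in>UNIV. c i * ln (\<rho> i u)) = 0" if u: "u \<in> U" for u
  proof -
    have pos: "0 < norm (f u)" if "field_embedding f" for f
      using U_nonzero[OF u] field_embedding_simps(8)[OF that] by simp
    have "norm (?s u) * norm (\<beta> u) = norm (\<gamma> u) * norm (\<delta> u)"
      using rel eq u by (metis norm_mult)
    then have "ln (norm (?s u) * norm (\<beta> u)) = ln (norm (\<gamma> u) * norm (\<delta> u))" by simp
    then have ln: "ln (norm (?s u)) + ln (norm (\<beta> u)) = ln (norm (\<gamma> u)) + ln (norm (\<delta> u))"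
      using pos[OF emb(1)] pos[OF emb(2)] pos[OF emb(3)] pos[OF embedding] by (simp add: ln_mult)
    have equ: "\<forall>j j'. norm (\<sigma> (Inr j) u) = norm (\<sigma> (Inr j') u)" using eq u by blast
    have "(\<Sum>i\<in>UNIV. c i * ln (\<rho> i u)) =
        2 * real CARD('t) * (ln (norm (?s u)) + ln (norm (\<beta> u)) - ln (norm (\<gamma> u)) - ln (norm (\<delta> u)))"
      unfolding c_def left_diff_distrib distrib_right sum.distrib sum_subtractf
        right_diff_distrib distrib_left
      by (simp only: log_norm_embedding[OF nf u equ] emb embedding)
    then show ?thesis unfolding ln by simp
  qed
  then have "c i0 = 0" by (rule log_units_no_relation)
  moreover have "log_coeff ?s i0 = 2 * real CARD('t)"
    by (simp add: log_coeff_def real_embedding)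
  \<comment> \<open>Since \<open>\<gamma>\<close> and \<open>\<delta>\<close> differ from
    \<open>\<sigma> (Inl i0)\<close>, they cannot cancel its coefficient, and \<open>\<beta>\<close>
    lowers it by at most 1. What remains is at least \<open>2 * CARD('t) - 1\<close>, which is
    positive.\<close>
  moreover have "log_coeff \<beta> i0 \<ge> - 1" "log_coeff \<gamma> i0 \<le> 0" "log_coeff \<delta> i0 \<le> 0"
    using ne' by (auto simp: log_coeff_def)
  moreover have "real CARD('t) \<ge> 1" by (simp add: Suc_leI)
  ultimately show False by (simp add: c_def)
qed

end

theorem corollary1:
  fixes \<sigma> :: "'s::finite + 't::finite \<Rightarrow> 'k::field_char_0 \<Rightarrow> complex"
    and U :: "'k set"
  assumes "number_field TYPE('k)"
    and "embedding_labelling \<sigma>"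
    and "oeljeklaus_toma \<sigma> U"
    and "\<exists>g. lck_metric (ot_atlas \<sigma> U) g"
  shows "card (complex_embeddings :: ('k \<Rightarrow> complex) set) = 2"
proof -
  interpret ot_action \<sigma> U using assms(2,3) by unfold_locales
  obtain g0 where "lck_metric (ot_atlas \<sigma> U) g0" using assms(4) by blast
  from lck_metric_lift[OF this] obtain g \<theta> where "lifted_lck \<sigma> U g \<theta>" by blast
  then interpret lifted_lck \<sigma> U g \<theta> .
  have "norm (\<sigma> (Inr j) u) = norm (\<sigma> (Inr j') u)" if "u \<in> U" for u j j'
    using norm_\<sigma>_unit[OF that, of j] norm_\<sigma>_unit[OF that, of j'] by (metis norm_ge_zero power2_eq_imp_eq)
  then have "CARD('t) = 1" using equal_moduli_imp_one_place[OF assms(1)] by blast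
  moreover have "card (complex_embeddings :: ('k \<Rightarrow> complex) set) = CARD('t + 't)"
    using assms(2) unfolding embedding_labelling_def by (metis bij_betw_same_card)
  ultimately show ?thesis by simp
qed

end
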